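(* Let $\kappa\in(0,1/2)$, let $W\in\mathbb{R}^{n\times n}$ be a symmetric matrix with $\kappa I\preceq W\preceq(1-\kappa)I$, and let $v\in\{\pm\frac{1}{\sqrt n}\}^n$. Let $P$ denote the kernel of the Glauber dynamics chain with stationary distribution $\mu_{W+\lambda vv^\top}$, and let $x_0\in\{\pm1\}^n$ be arbitrary. There exists a large enough constant $\lambda>0$ such that for $T=\widetilde{\Theta}(n^5)$ and $\mathbf{t}$ uniform on $[0,T]$, with probability $1-o(1)$ over $\mathbf{t}$, \[\mathbb{E}_{\mathbf{x}\sim P_{\mathbf{t}}\delta_{x_0}}\left[|\langle \mathbf{x},v\rangle|\right]\ge\left(\kappa\exp\left(-\frac1\kappa\right)-o(1)\right)\sqrt n.\]
   Context: For a symmetric $J\in\mathbb{R}^{n\times n}$ and $h\in\mathbb{R}^n$, the Ising model $\mu_{J,h}$ is the distribution on $\{\pm1\}^n$ with $\mu_{J,h}(x)\propto\exp(\frac12 x^\top Jx+\langle h,x\rangle)$, and $\mu_J=\mu_{J,0}$. Glauber dynamics for a distribution $\pi$ on $\{\pm1\}^n$: from $x$, pick $i\in[n]$ uniformly, move to $x^{\oplus i}$ ($x$ with the $i$th coordinate flipped) with probability $\frac{\pi(x^{\oplus i})}{\pi(x)+\pi(x^{\oplus i})}$, otherwise stay. $P_t=\exp(-t(I-P))$ is the continuous-time kernel and $\delta_{x_0}$ the point mass at $x_0$. Asymptotic notation is as $n\to\infty$ with $\kappa$ fixed; $\widetilde\Theta$ hides polylogarithmic factors. *)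

theory Defs
  imports
    "HOL-Probability.Probability"
    "HOL-Library.Landau_Symbols"
    "Jordan_Normal_Form.Matrix"
begin

text \<open>Both \<open>HOL-Analysis\<close> and \<open>Jordan_Normal_Form\<close> provide vectors. The dimension \<open>n\<close> is a
  quantified variable here, so vectors and matrices are those of \<open>Jordan_Normal_Form\<close>.\<close>

unbundle no vec_syntax
unbundle no inner_syntax

hide_type (open) Finite_Cartesian_Product.vec
hide_const (open) Finite_Cartesian_Product.vec

section \<open>Matrices\<close>

text \<open>The Loewner order, for matrices of equal dimensions (symmetry is not part of the definition).\<close>

definition loewner_le :: "real mat \<Rightarrow> real mat \<Rightarrow> bool" (infix "\<preceq>\<^sub>L" 50) where
  "A \<preceq>\<^sub>L B \<longleftrightarrow> (\<forall>u \<in> carrier_vec (dim_row A). 0 \<le> u \<bullet> ((B - A) *\<^sub>v u))"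

definition outer_square :: "real Matrix.vec \<Rightarrow> real mat" where
  "outer_square v = mat (dim_vec v) (dim_vec v) (\<lambda>(i, j). v $ i * v $ j)"


section \<open>The Ising model\<close>

definition cube :: "nat \<Rightarrow> real Matrix.vec set" where
  "cube n = {x \<in> carrier_vec n. \<forall>i<n. x $ i \<in> {-1, 1}}"

definition ising_weight :: "real mat \<Rightarrow> real Matrix.vec \<Rightarrow> real Matrix.vec \<Rightarrow> real" where
  "ising_weight J h x = exp (1/2 * (x \<bullet> (J *\<^sub>v x)) + h \<bullet> x)"

definition ising :: "real mat \<Rightarrow> real Matrix.vec \<Rightarrow> real Matrix.vec pmf" where
  "ising J h = embed_pmf (\<lambda>x. if x \<in> cube (dim_row J)
     then ising_weight J h x / (\<Sum>y\<in>cube (dim_row J). ising_weight J h y) else 0)"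

abbreviation ising0 :: "real mat \<Rightarrow> real Matrix.vec pmf" where
  "ising0 J \<equiv> ising J (0\<^sub>v (dim_row J))"

lemma finite_cube: "finite (cube n)"
proof (rule finite_subset)
  show "cube n \<subseteq> vec_of_list ` {xs. set xs \<subseteq> {-1, 1} \<and> length xs = n}"
  proof
    fix x assume x: "x \<in> cube n"
    have "set (list_of_vec x) \<subseteq> {-1, 1}"
      using x by (auto simp: cube_def set_list_of_vec vec_set_def)
    moreover have "length (list_of_vec x) = n"
      using x by (auto simp: cube_def)
    moreover have "x = vec_of_list (list_of_vec x)"
      by (simp add: vec_list)
    ultimately show "x \<in> vec_of_list ` {xs. set xs \<subseteq> {-1, 1} \<and> length xs = n}"
      by blast
  qed
  show "finite (vec_of_list ` {xs::real list. set xs \<subseteq> {-1, 1} \<and> length xs = n})"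
    by (intro finite_imageI finite_lists_length_eq) auto
qed

lemma cube_nonempty: "cube n \<noteq> {}"
proof -
  have "Matrix.vec n (\<lambda>_. 1) \<in> cube n"
    by (auto simp: cube_def)
  then show ?thesis by blast
qed

lemma pmf_ising:
  "pmf (ising J h) x = (if x \<in> cube (dim_row J)
     then ising_weight J h x / (\<Sum>y\<in>cube (dim_row J). ising_weight J h y) else 0)"
proof -
  let ?C = "cube (dim_row J)"
  let ?Z = "\<Sum>y\<in>?C. ising_weight J h y"
  let ?f = "\<lambda>x. if x \<in> ?C then ising_weight J h x / ?Z else 0"
  have Z: "0 < ?Z"
    using finite_cube cube_nonempty by (intro sum_pos) (auto simp: ising_weight_def)
  have nonneg: "0 \<le> ?f y" for y
    using Z by (auto simp: ising_weight_def)
  have "(\<integral>\<^sup>+y. ennreal (?f y) \<partial>count_space UNIV) = (\<Sum>y\<in>?C. ennreal (?f y))"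
    by (rule nn_integral_count_space') (auto simp: finite_cube)
  also have "\<dots> = ennreal (\<Sum>y\<in>?C. ?f y)"
    by (rule sum_ennreal) (rule nonneg)
  also have "(\<Sum>y\<in>?C. ?f y) = 1"
    using Z by (simp add: sum_divide_distrib [symmetric])
  finally show ?thesis
    unfolding ising_def using nonneg by (subst pmf_embed_pmf) auto
qed


section \<open>Glauber dynamics\<close>

definition flip :: "nat \<Rightarrow> real Matrix.vec \<Rightarrow> real Matrix.vec" where
  "flip i x = Matrix.vec (dim_vec x) (\<lambda>j. if j = i then - x $ j else x $ j)"

text \<open>\<open>glauber p x\<close> is the law of the state after one step from \<open>x\<close> (of positive dimension).\<close>

definition glauber :: "real Matrix.vec pmf \<Rightarrow> real Matrix.vec \<Rightarrow> real Matrix.vec pmf" where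
  "glauber p x = do {
     i \<leftarrow> pmf_of_set {..<dim_vec x};
     b \<leftarrow> bernoulli_pmf (pmf p (flip i x) / (pmf p x + pmf p (flip i x)));
     return_pmf (if b then flip i x else x)
   }"

text \<open>Matrices with rows and columns indexed by a finite set \<open>S\<close>: powers and exponential.\<close>

primrec kernel_pow :: "'a set \<Rightarrow> ('a \<Rightarrow> 'a \<Rightarrow> real) \<Rightarrow> nat \<Rightarrow> 'a \<Rightarrow> 'a \<Rightarrow> real" where
  "kernel_pow S Q 0 = (\<lambda>x y. of_bool (x = y))"
| "kernel_pow S Q (Suc k) = (\<lambda>x y. \<Sum>z\<in>S. kernel_pow S Q k x z * Q z y)"

definition kernel_exp :: "'a set \<Rightarrow> ('a \<Rightarrow> 'a \<Rightarrow> real) \<Rightarrow> 'a \<Rightarrow> 'a \<Rightarrow> real" where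
  "kernel_exp S Q x y = (\<Sum>k. kernel_pow S Q k x y / fact k)"

text \<open>The kernel \<open>exp (- t (I - P))\<close>; \<open>heat_kernel S P t x y\<close> is the mass that
  \<open>P\<^sub>t \<delta>\<^sub>x\<close> gives to \<open>y\<close>.\<close>

definition heat_kernel :: "'a set \<Rightarrow> ('a \<Rightarrow> 'a pmf) \<Rightarrow> real \<Rightarrow> 'a \<Rightarrow> 'a \<Rightarrow> real" where
  "heat_kernel S P t = kernel_exp S (\<lambda>x y. - t * (of_bool (x = y) - pmf (P x) y))"

definition heat_expectation ::
  "'a set \<Rightarrow> ('a \<Rightarrow> 'a pmf) \<Rightarrow> real \<Rightarrow> 'a \<Rightarrow> ('a \<Rightarrow> real) \<Rightarrow> real" where
  "heat_expectation S P t x f = (\<Sum>y\<in>S. heat_kernel S P t x y * f y)"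


section \<open>Asymptotics up to polylogarithmic factors\<close>

definition soft_Theta :: "(nat \<Rightarrow> real) \<Rightarrow> (nat \<Rightarrow> real) set" where
  "soft_Theta g = {f. \<exists>k::nat. f \<in> O(\<lambda>n. g n * ln (real n) ^ k) \<and> f \<in> \<Omega>(\<lambda>n. g n / ln (real n) ^ k)}"

end

theory Submission
  imports Defs "HOL-Real_Asymp.Real_Asymp"
begin

text \<open>
  Write \<open>M x = \<langle>x, v\<rangle>\<close>. The relative entropy of the law at time \<open>t\<close> is at most linear in \<open>n\<close> at \<open>t = 0\<close> and is
  dissipated at the rate of the Dirichlet form, so for most \<open>t\<close> in \<open>[0, T]\<close> the square root \<open>\<phi>\<close> of the density has
  Dirichlet form at most \<open>n\<^sup>-\<^sup>5\<^sup>/\<^sup>2\<close>. Decouple the outlier,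
  \<open>exp (lam/2 * M\<^sup>2) = \<integral> \<gamma>(r) * exp (r * M) dr\<close> with \<open>\<gamma>\<close> the density of \<open>N(0, lam)\<close>. For every fixed \<open>r\<close> the weight
  \<open>exp (1/2 * x\<^sup>T W x + r * M)\<close> satisfies a Poincare inequality with constant \<open>2/\<kappa>\<close>, obtained by removing the
  interaction in infinitesimal random tilts. Hence the law is close to a mixture of these weights with mixing density
  \<open>A(r)\<^sup>2 * \<gamma>(r) * Z(r)\<close>, where \<open>A\<close>, the conditional mean of \<open>\<phi>\<close>, varies slowly. Since \<open>\<gamma> * Z\<close> increases in \<open>\<bar>r\<bar>\<close> up to
  \<open>lam * sqrt n / 2\<close>, about half of the mixing mass lies at \<open>\<bar>r\<bar> \<ge> lam * sqrt n / 4\<close>; as \<open>r\<close> given \<open>x\<close> is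
  \<open>N(lam * M x, lam)\<close>, this forces \<open>\<bar>M\<bar>\<close> to be of order \<open>sqrt n\<close>.
\<close>

section \<open>Variance and Dirichlet form of a weighted finite set\<close>

text \<open>The obstacle is the two wells of the measure: the share of the law sitting at positive
  and at negative \<open>M\<close> depends on \<open>x\<^sub>0\<close> and is not controlled, so the
  law is never compared with the stationary one. A small Dirichlet form says only that
  \<open>\<phi>\<close> is nearly constant under each fixed tilt and that its conditional mean
  changes slowly with \<open>r\<close>. This is why the one-dimensional argument is run on each half
  line separately: it excludes mass trapped near \<open>r = 0\<close> and says nothing about the
  balance between the two sides. \<open>\<kappa>\<close> enters the estimates only through the
  Poincare constant \<open>2 / \<kappa>\<close>. The threshold for \<open>lam\<close> does not
  depend on it. The proof yields a multiple of \<open>sqrt n\<close> slightly below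
  \<open>1/8\<close>, lowered a little by fixed error margins, and
  \<open>\<kappa> * exp (- 1 / \<kappa>)\<close> is at most \<open>1/10\<close> for every admissible
  \<open>\<kappa>\<close>. Concavity of the conductance in the pair of weights is used twice: for
  finite sign averages in the Poincare inequality and for the Gaussian mixture over
  \<open>r\<close>.\<close>

definition wmean :: "'a set \<Rightarrow> ('a \<Rightarrow> real) \<Rightarrow> ('a \<Rightarrow> real) \<Rightarrow> real" where
  "wmean S w g = (\<Sum>x\<in>S. w x * g x) / (\<Sum>x\<in>S. w x)"

text \<open>Not divided by the total weight: \<open>wvar\<close> and \<open>dirichlet\<close> are
  then both homogeneous of degree one in the weight, and Poincare inequalities can be averaged over
  mixtures without normalizing constants.\<close>

definition wvar :: "'a set \<Rightarrow> ('a \<Rightarrow> real) \<Rightarrow> ('a \<Rightarrow> real) \<Rightarrow> real" where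
  "wvar S w g = (\<Sum>x\<in>S. w x * (g x - wmean S w g)\<^sup>2)"

text \<open>For the weights of \<open>x\<close> and \<open>flip i x\<close> this is the weight of
  \<open>x\<close> times the heat-bath probability of flipping site \<open>i\<close>, in a form that
  shows detailed balance.\<close>

definition conductance :: "real \<Rightarrow> real \<Rightarrow> real" where
  "conductance a b = a * b / (a + b)"

text \<open>The factor \<open>1/2\<close> compensates for listing every edge from both ends. Neither
  the probability \<open>1 / n\<close> of choosing the site nor the normalization of
  \<open>w\<close> is included; the former reappears in \<open>entropy_deriv_le\<close>.\<close>

definition dirichlet :: "nat \<Rightarrow> (real Matrix.vec \<Rightarrow> real) \<Rightarrow> (real Matrix.vec \<Rightarrow> real) \<Rightarrow> real" where
  "dirichlet n w g =
     1/2 * (\<Sum>i<n. \<Sum>x\<in>cube n. conductance (w x) (w (flip i x)) * (g x - g (flip i x))\<^sup>2)"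

lemma conductance_commute: "conductance a b = conductance b a"
  by (simp add: conductance_def ac_simps)

lemma conductance_nonneg: "0 \<le> a \<Longrightarrow> 0 \<le> b \<Longrightarrow> 0 \<le> conductance a b"
  by (simp add: conductance_def)

lemma conductance_scale: "conductance (c * a) (c * b) = c * conductance a b"
proof (cases "c = 0")
  case False
  then have "c * a * (c * b) / (c * a + c * b) = c * (c * (a * b)) / (c * (a + b))"
    by (simp add: algebra_simps)
  with False show ?thesis by (simp add: conductance_def)
qed (simp add: conductance_def)

lemma conductance_le_quarter:
  assumes "0 < a" "0 < b"
  shows "conductance a b \<le> (a + b) / 4"
proof -
  have "4 * (a * b) \<le> (a + b) * (a + b)"
    using zero_le_power2[of "a - b"] by (simp add: power2_eq_square algebra_simps)
  then show ?thesis
    using assms by (simp add: conductance_def field_simps)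
qed

text \<open>Concavity of the conductance: it is the minimum of the linear functions on the right.\<close>

lemma conductance_le_linear:
  assumes "0 < a" "0 < b"
  shows "conductance a b \<le> \<theta>\<^sup>2 * a + (1 - \<theta>)\<^sup>2 * b"
proof -
  have "(\<theta>\<^sup>2 * a + (1 - \<theta>)\<^sup>2 * b) * (a + b) - a * b = (\<theta> * a - (1 - \<theta>) * b)\<^sup>2"
    by (simp add: power2_eq_square algebra_simps)
  then have "a * b \<le> (\<theta>\<^sup>2 * a + (1 - \<theta>)\<^sup>2 * b) * (a + b)"
    using zero_le_power2[of "\<theta> * a - (1 - \<theta>) * b"] by linarith
  with assms show ?thesis
    by (simp add: conductance_def divide_le_eq)
qed

lemma conductance_eq_linear:
  assumes "0 < a" "0 < b"
  shows "conductance a b = (b / (a + b))\<^sup>2 * a + (1 - b / (a + b))\<^sup>2 * b"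
proof -
  have eq: "1 - b / (a + b) = a / (a + b)"
    using assms by (simp add: field_simps)
  have "(b / (a + b))\<^sup>2 * a + (a / (a + b))\<^sup>2 * b = (b\<^sup>2 * a + a\<^sup>2 * b) / (a + b)\<^sup>2"
    by (simp add: power_divide add_divide_distrib)
  also have "b\<^sup>2 * a + a\<^sup>2 * b = (a * b) * (a + b)"
    by (simp add: power2_eq_square algebra_simps)
  also have "(a * b) * (a + b) / (a + b)\<^sup>2 = conductance a b"
    using assms by (simp add: conductance_def power2_eq_square)
  finally show ?thesis by (simp add: eq)
qed

text \<open>Jensen by hand: the linear upper bound with the \<open>\<theta>\<close> that is optimal
  for the averaged pair is applied to every term and is exact for the average.\<close>

lemma conductance_avg:
  assumes "finite E" "E \<noteq> {}" "\<And>e. e \<in> E \<Longrightarrow> 0 < p e" "\<And>e. e \<in> E \<Longrightarrow> 0 < a e" "\<And>e. e \<in> E \<Longrightarrow> 0 < b e"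
  shows "(\<Sum>e\<in>E. p e * conductance (a e) (b e)) \<le> conductance (\<Sum>e\<in>E. p e * a e) (\<Sum>e\<in>E. p e * b e)"
proof -
  let ?A = "\<Sum>e\<in>E. p e * a e" and ?B = "\<Sum>e\<in>E. p e * b e"
  define \<theta> where "\<theta> = ?B / (?A + ?B)"
  have pos: "0 < ?A" "0 < ?B"
    using assms by (auto intro!: sum_pos)
  have "(\<Sum>e\<in>E. p e * conductance (a e) (b e)) \<le> (\<Sum>e\<in>E. p e * (\<theta>\<^sup>2 * a e + (1 - \<theta>)\<^sup>2 * b e))"
    using assms by (intro sum_mono mult_left_mono conductance_le_linear) (auto intro: less_imp_le)
  also have "\<dots> = \<theta>\<^sup>2 * ?A + (1 - \<theta>)\<^sup>2 * ?B"
    by (simp add: sum.distrib sum_distrib_left algebra_simps)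
  also have "\<dots> = conductance ?A ?B"
    unfolding \<theta>_def by (rule conductance_eq_linear[OF pos, symmetric])
  finally show ?thesis .
qed

lemma sum_centered_zero:
  assumes "0 < (\<Sum>x\<in>S. w x)"
  shows "(\<Sum>x\<in>S. w x * (g x - wmean S w g)) = 0"
  using assms by (simp add: right_diff_distrib sum_subtractf sum_distrib_right[symmetric])
    (simp add: wmean_def)

lemma sum_sq_shift:
  assumes "0 < (\<Sum>x\<in>S. w x)"
  shows "(\<Sum>x\<in>S. w x * (g x - c)\<^sup>2) = wvar S w g + (\<Sum>x\<in>S. w x) * (wmean S w g - c)\<^sup>2"
proof -
  let ?m = "wmean S w g"
  have "w x * (g x - c)\<^sup>2 = w x * (g x - ?m)\<^sup>2 + 2 * (?m - c) * (w x * (g x - ?m)) + w x * (?m - c)\<^sup>2" for x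
    by (simp add: power2_eq_square algebra_simps)
  then have "(\<Sum>x\<in>S. w x * (g x - c)\<^sup>2) = wvar S w g
      + 2 * (?m - c) * (\<Sum>x\<in>S. w x * (g x - ?m)) + (\<Sum>x\<in>S. w x) * (?m - c)\<^sup>2"
    by (simp add: sum.distrib wvar_def sum_distrib_left sum_distrib_right)
  then show ?thesis
    using sum_centered_zero[OF assms, of g] by simp
qed

lemma wvar_le_sum_sq:
  assumes "0 < (\<Sum>x\<in>S. w x)"
  shows "wvar S w g \<le> (\<Sum>x\<in>S. w x * (g x - c)\<^sup>2)"
  using sum_sq_shift[OF assms, of g c] assms by (simp add: less_imp_le)

lemma wvar_nonneg: "(\<And>x. x \<in> S \<Longrightarrow> 0 \<le> w x) \<Longrightarrow> 0 \<le> wvar S w g"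
  unfolding wvar_def by (intro sum_nonneg mult_nonneg_nonneg) auto

lemma wvar_eq:
  assumes "0 < (\<Sum>x\<in>S. w x)"
  shows "wvar S w g = (\<Sum>x\<in>S. w x * (g x)\<^sup>2) - (\<Sum>x\<in>S. w x) * (wmean S w g)\<^sup>2"
  using sum_sq_shift[OF assms, of g 0] by simp

lemma weighted_cauchy_schwarz:
  fixes w f g :: "'a \<Rightarrow> real"
  assumes "\<And>x. x \<in> S \<Longrightarrow> 0 \<le> w x"
  shows "(\<Sum>x\<in>S. w x * (f x * g x))\<^sup>2 \<le> (\<Sum>x\<in>S. w x * (f x)\<^sup>2) * (\<Sum>x\<in>S. w x * (g x)\<^sup>2)"
proof -
  have "(\<Sum>x\<in>S. (sqrt (w x) * f x) * (sqrt (w x) * g x))\<^sup>2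
     \<le> (\<Sum>x\<in>S. (sqrt (w x) * f x)\<^sup>2) * (\<Sum>x\<in>S. (sqrt (w x) * g x)\<^sup>2)"
    by (rule Cauchy_Schwarz_ineq_sum)
  moreover have "(\<Sum>x\<in>S. (sqrt (w x) * f x) * (sqrt (w x) * g x)) = (\<Sum>x\<in>S. w x * (f x * g x))"
    using assms by (intro sum.cong refl) (simp add: real_sqrt_mult_self mult.left_commute mult.assoc)
  ultimately show ?thesis
    using assms by (simp add: power_mult_distrib)
qed

text \<open>The decomposition of a mixture's variance into a part within and a part between
  components. The centre \<open>c\<close> is free, which turns the identity into an inequality;
  \<open>variance_step\<close> takes for it the mean under the untilted weight.\<close>

lemma wvar_mixture:
  assumes "finite E" "finite S" "S \<noteq> {}"
    and p: "\<And>e. e \<in> E \<Longrightarrow> 0 \<le> p e" and w: "\<And>e x. e \<in> E \<Longrightarrow> x \<in> S \<Longrightarrow> 0 < w e x"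
    and pos: "0 < (\<Sum>x\<in>S. \<Sum>e\<in>E. p e * w e x)"
  shows "wvar S (\<lambda>x. \<Sum>e\<in>E. p e * w e x) g
     \<le> (\<Sum>e\<in>E. p e * wvar S (w e) g) + (\<Sum>e\<in>E. p e * ((\<Sum>x\<in>S. w e x) * (wmean S (w e) g - c)\<^sup>2))"
proof -
  have "wvar S (\<lambda>x. \<Sum>e\<in>E. p e * w e x) g \<le> (\<Sum>x\<in>S. (\<Sum>e\<in>E. p e * w e x) * (g x - c)\<^sup>2)"
    by (rule wvar_le_sum_sq[OF pos])
  also have "\<dots> = (\<Sum>e\<in>E. p e * (\<Sum>x\<in>S. w e x * (g x - c)\<^sup>2))"
    unfolding sum_distrib_right sum_distrib_left by (subst sum.swap) (simp add: mult.assoc)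
  also have "\<dots> = (\<Sum>e\<in>E. p e * (wvar S (w e) g + (\<Sum>x\<in>S. w e x) * (wmean S (w e) g - c)\<^sup>2))"
  proof (rule sum.cong[OF refl])
    fix e assume "e \<in> E"
    then have "0 < (\<Sum>x\<in>S. w e x)" using assms w by (intro sum_pos) auto
    then show "p e * (\<Sum>x\<in>S. w e x * (g x - c)\<^sup>2) = p e * (wvar S (w e) g + (\<Sum>x\<in>S. w e x) * (wmean S (w e) g - c)\<^sup>2)"
      by (subst sum_sq_shift) auto
  qed
  finally show ?thesis by (simp add: distrib_left sum.distrib)
qed

section \<open>Flips of the cube\<close>

lemma cube_dim: "x \<in> cube n \<Longrightarrow> dim_vec x = n"
  by (auto simp: cube_def)

lemma cube_cases: "x \<in> cube n \<Longrightarrow> i < n \<Longrightarrow> x $ i = 1 \<or> x $ i = -1"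
  by (auto simp: cube_def)

lemma cube_sq: "x \<in> cube n \<Longrightarrow> i < n \<Longrightarrow> (x $ i)\<^sup>2 = 1"
  using cube_cases by fastforce

lemma cube_mult_self: "x \<in> cube n \<Longrightarrow> i < n \<Longrightarrow> x $ i * x $ i = 1"
  using cube_cases by fastforce

lemma cube_abs: "x \<in> cube n \<Longrightarrow> i < n \<Longrightarrow> \<bar>x $ i\<bar> = 1"
  using cube_cases by fastforce

lemma flip_cube: "x \<in> cube n \<Longrightarrow> flip i x \<in> cube n"
  by (force simp: cube_def flip_def)

lemma flip_flip: "flip i (flip i x) = x"
  by (rule eq_vecI) (auto simp: flip_def)

lemma flip_index: "x \<in> cube n \<Longrightarrow> j < n \<Longrightarrow> flip i x $ j = (if j = i then - x $ j else x $ j)"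
  by (auto simp: flip_def cube_def)

lemma flip_bij: "bij_betw (flip i) (cube n) (cube n)"
  by (rule bij_betwI[where g = "flip i"]) (auto simp: flip_flip flip_cube)

lemma sum_flip: "(\<Sum>x\<in>cube n. F (flip i x)) = (\<Sum>x\<in>cube n. F x)"
  by (rule sum.reindex_bij_betw[OF flip_bij])

text \<open>Concavity acts in the useful direction: a Poincare inequality that holds for all
  components has its right-hand side bounded by that of the mixture.\<close>

lemma dirichlet_mixture:
  assumes "finite E" "E \<noteq> {}" "\<And>e. e \<in> E \<Longrightarrow> 0 < p e" "\<And>e x. e \<in> E \<Longrightarrow> x \<in> cube n \<Longrightarrow> 0 < w e x"
  shows "(\<Sum>e\<in>E. p e * dirichlet n (w e) g) \<le> dirichlet n (\<lambda>x. \<Sum>e\<in>E. p e * w e x) g"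
proof -
  have "(\<Sum>e\<in>E. p e * dirichlet n (w e) g) = 1/2 * (\<Sum>i<n. \<Sum>x\<in>cube n.
      (\<Sum>e\<in>E. p e * conductance (w e x) (w e (flip i x))) * (g x - g (flip i x))\<^sup>2)"
    unfolding dirichlet_def sum_distrib_left sum_distrib_right
    by (subst sum.swap, rule sum.cong[OF refl], subst sum.swap) (simp add: mult_ac)
  also have "\<dots> \<le> dirichlet n (\<lambda>x. \<Sum>e\<in>E. p e * w e x) g"
    unfolding dirichlet_def using assms
    by (intro mult_left_mono sum_mono mult_right_mono conductance_avg) (auto simp: flip_cube)
  finally show ?thesis .
qed

lemma dirichlet_nonneg:
  "(\<And>x. x \<in> cube n \<Longrightarrow> 0 \<le> w x) \<Longrightarrow> 0 \<le> dirichlet n w g"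
  unfolding dirichlet_def
  by (intro mult_nonneg_nonneg sum_nonneg conductance_nonneg) (auto simp: flip_cube)

definition lin :: "nat \<Rightarrow> (nat \<Rightarrow> real) \<Rightarrow> real Matrix.vec \<Rightarrow> real" where
  "lin n u x = (\<Sum>i<n. u i * x $ i)"

lemma lin_flip:
  assumes "x \<in> cube n" "i < n"
  shows "lin n u (flip i x) = lin n u x - 2 * u i * x $ i"
proof -
  have "lin n u (flip i x) = (\<Sum>j<n. u j * x $ j - (if j = i then 2 * u i * x $ i else 0))"
    unfolding lin_def by (intro sum.cong refl) (auto simp: flip_index[OF assms(1)])
  also have "\<dots> = lin n u x - 2 * u i * x $ i"
    using assms by (simp add: lin_def sum_subtractf)
  finally show ?thesis .
qed

text \<open>A flip at \<open>i\<close> changes \<open>lin n u\<close> by \<open>2 * u i\<close> in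
  absolute value; the resulting factor \<open>4\<close> cancels against the quarter in
  \<open>conductance_le_quarter\<close>.\<close>

lemma dirichlet_lin_le:
  assumes "\<And>x. x \<in> cube n \<Longrightarrow> 0 < w x"
  shows "dirichlet n w (lin n u) \<le> (\<Sum>x\<in>cube n. w x) * (\<Sum>i<n. (u i)\<^sup>2)"
proof -
  have "(\<Sum>x\<in>cube n. conductance (w x) (w (flip i x)) * (lin n u x - lin n u (flip i x))\<^sup>2)
      \<le> 2 * ((\<Sum>x\<in>cube n. w x) * (u i)\<^sup>2)" if i: "i < n" for i
  proof -
    have "(\<Sum>x\<in>cube n. conductance (w x) (w (flip i x)) * (lin n u x - lin n u (flip i x))\<^sup>2)
      = (\<Sum>x\<in>cube n. conductance (w x) (w (flip i x)) * (4 * (u i)\<^sup>2))"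
      using i by (intro sum.cong refl) (auto simp: lin_flip power_mult_distrib cube_sq)
    also have "\<dots> \<le> (\<Sum>x\<in>cube n. (w x + w (flip i x)) / 4 * (4 * (u i)\<^sup>2))"
      using assms by (intro sum_mono mult_right_mono conductance_le_quarter) (auto simp: flip_cube)
    also have "\<dots> = ((\<Sum>x\<in>cube n. w x) + (\<Sum>x\<in>cube n. w (flip i x))) * (u i)\<^sup>2"
      by (simp add: sum_distrib_right sum.distrib[symmetric] distrib_right add_divide_distrib)
    finally show ?thesis
      unfolding sum_flip by simp
  qed
  then have "dirichlet n w (lin n u) \<le> 1/2 * (\<Sum>i<n. 2 * ((\<Sum>x\<in>cube n. w x) * (u i)\<^sup>2))"
    unfolding dirichlet_def by (intro mult_left_mono sum_mono) auto
  also have "\<dots> = (\<Sum>x\<in>cube n. w x) * (\<Sum>i<n. (u i)\<^sup>2)"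
    by (simp add: sum_distrib_left)
  finally show ?thesis .
qed

section \<open>The Poincare inequality for product weights\<close>

text \<open>The first \<open>k\<close> spins are free and the others are frozen as in
  \<open>\<sigma>\<close>, so that an induction can release one spin at a time.\<close>

definition subcube :: "nat \<Rightarrow> nat \<Rightarrow> real Matrix.vec \<Rightarrow> real Matrix.vec set" where
  "subcube n k \<sigma> = {x \<in> cube n. \<forall>j<n. k \<le> j \<longrightarrow> x $ j = \<sigma> $ j}"

lemma subcube_0: "\<sigma> \<in> cube n \<Longrightarrow> subcube n 0 \<sigma> = {\<sigma>}"
  by (auto simp: subcube_def cube_def intro!: eq_vecI)

lemma subcube_top: "subcube n n \<sigma> = cube n"
  by (auto simp: subcube_def)

lemma subcube_sub: "subcube n k \<sigma> \<subseteq> cube n"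
  by (auto simp: subcube_def)

lemma finite_subcube: "finite (subcube n k \<sigma>)"
  using finite_subset[OF subcube_sub finite_cube] .

lemma subcube_Suc:
  assumes "\<sigma> \<in> cube n" "k < n"
  shows "subcube n (Suc k) \<sigma> = subcube n k \<sigma> \<union> subcube n k (flip k \<sigma>)"
    and "subcube n k \<sigma> \<inter> subcube n k (flip k \<sigma>) = {}"
proof -
  show "subcube n (Suc k) \<sigma> = subcube n k \<sigma> \<union> subcube n k (flip k \<sigma>)"
  proof (intro equalityI subsetI)
    fix x assume x: "x \<in> subcube n (Suc k) \<sigma>"
    then have xc: "x \<in> cube n" and xj: "\<And>j. j < n \<Longrightarrow> Suc k \<le> j \<Longrightarrow> x $ j = \<sigma> $ j"
      by (auto simp: subcube_def)
    have "x $ k = \<sigma> $ k \<or> x $ k = - \<sigma> $ k"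
      using cube_cases[OF xc assms(2)] cube_cases[OF assms] by auto
    moreover have "j = k \<or> Suc k \<le> j" if "k \<le> j" for j
      using that by auto
    ultimately show "x \<in> subcube n k \<sigma> \<union> subcube n k (flip k \<sigma>)"
      using xc xj assms by (fastforce simp: subcube_def flip_index)
  next
    fix x assume "x \<in> subcube n k \<sigma> \<union> subcube n k (flip k \<sigma>)"
    then show "x \<in> subcube n (Suc k) \<sigma>"
      using assms by (auto simp: subcube_def flip_index)
  qed
  show "subcube n k \<sigma> \<inter> subcube n k (flip k \<sigma>) = {}"
    using assms cube_cases[OF assms] by (auto simp: subcube_def flip_index)
qed

lemma subcube_flip_bij:
  assumes "\<sigma> \<in> cube n" "k < n"
  shows "bij_betw (flip k) (subcube n k \<sigma>) (subcube n k (flip k \<sigma>))"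
  using assms
  by (intro bij_betwI[where g = "flip k"]) (auto simp: flip_flip subcube_def flip_cube flip_index)

text \<open>The variance between two blocks is again governed by a conductance, now of the block
  masses. This is what makes the induction step below close with constant one.\<close>

lemma two_block_variance:
  fixes N1 N2 E1 E2 :: real
  assumes "0 < N1" "0 < N2"
  defines "c \<equiv> (N1 * E1 + N2 * E2) / (N1 + N2)"
  shows "N1 * (E1 - c)\<^sup>2 + N2 * (E2 - c)\<^sup>2 = conductance N1 N2 * (E1 - E2)\<^sup>2"
proof -
  have 1: "E1 - c = N2 / (N1 + N2) * (E1 - E2)" and 2: "E2 - c = - (N1 / (N1 + N2) * (E1 - E2))"
    using assms by (auto simp: c_def field_simps)
  have 3: "1 - N2 / (N1 + N2) = N1 / (N1 + N2)"
    using assms by (simp add: field_simps)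
  show ?thesis
    unfolding 1 2 conductance_eq_linear[OF assms(1,2)] 3 power_mult_distrib power2_minus
    by (simp only: distrib_left mult_ac)
qed

text \<open>Tensorization. Releasing spin \<open>k\<close> joins two halves that
  \<open>flip k\<close> exchanges. For a product weight the flip multiplies the weight by a
  constant, so the difference of the two means is an average of the edge differences
  \<open>g x - g (flip k x)\<close>, and Cauchy-Schwarz bounds its square.\<close>

lemma wvar_subcube_le:
  fixes n :: nat and h :: "nat \<Rightarrow> real" and g :: "real Matrix.vec \<Rightarrow> real"
  defines "w \<equiv> \<lambda>x. exp (lin n h x)"
  defines "F \<equiv> \<lambda>i x. conductance (w x) (w (flip i x)) * (g x - g (flip i x))\<^sup>2"
  assumes "k \<le> n" "\<sigma> \<in> cube n"
  shows "wvar (subcube n k \<sigma>) w g \<le> 1/2 * (\<Sum>i<k. \<Sum>x\<in>subcube n k \<sigma>. F i x)"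
  using assms(3,4)
proof (induction k arbitrary: \<sigma>)
  case 0
  then show ?case
    by (simp add: subcube_0 wvar_def wmean_def w_def)
next
  case (Suc k)
  let ?A = "subcube n k \<sigma>" and ?B = "subcube n k (flip k \<sigma>)"
  have k: "k < n" and \<sigma>: "\<sigma> \<in> cube n" and f\<sigma>: "flip k \<sigma> \<in> cube n"
    using Suc by (auto simp: flip_cube)
  have un: "subcube n (Suc k) \<sigma> = ?A \<union> ?B" "?A \<inter> ?B = {}"
    using subcube_Suc[OF \<sigma> k] by auto
  have ne: "?A \<noteq> {}" "?B \<noteq> {}"
    using \<sigma> f\<sigma> by (auto simp: subcube_def)
  have fin: "finite ?A" "finite ?B" by (auto simp: finite_subcube)
  define N1 N2 E1 E2 where "N1 = sum w ?A" and "N2 = sum w ?B"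
    and "E1 = wmean ?A w g" and "E2 = wmean ?B w g"
  have wpos: "0 < w x" for x by (simp add: w_def)
  have N: "0 < N1" "0 < N2"
    unfolding N1_def N2_def using fin ne wpos by (auto intro!: sum_pos)
  \<comment> \<open>The product structure enters here: the ratio of weights across the flip is the
    same for all points of the half.\<close>
  define \<rho> where "\<rho> = exp (- 2 * h k * \<sigma> $ k)"
  have \<rho>: "w (flip k x) = \<rho> * w x" if "x \<in> ?A" for x
  proof -
    have "x \<in> cube n" "x $ k = \<sigma> $ k" using that k by (auto simp: subcube_def)
    then show ?thesis using k by (simp add: w_def \<rho>_def lin_flip exp_add[symmetric])
  qed
  have toB: "(\<Sum>x\<in>?B. G x) = (\<Sum>x\<in>?A. G (flip k x))" for G :: "_ \<Rightarrow> real"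
    by (rule sum.reindex_bij_betw[OF subcube_flip_bij[OF \<sigma> k], symmetric])
  have N2: "N2 = \<rho> * N1"
    unfolding N2_def N1_def toB sum_distrib_left by (intro sum.cong refl \<rho>)
  have E2: "E2 = (\<Sum>x\<in>?A. w x * g (flip k x)) / N1"
  proof -
    have "(\<Sum>x\<in>?A. w (flip k x) * g (flip k x)) = \<rho> * (\<Sum>x\<in>?A. w x * g (flip k x))"
      unfolding sum_distrib_left by (intro sum.cong refl) (simp add: \<rho>)
    then show ?thesis
      using N by (simp add: E2_def wmean_def N2_def[symmetric] N2) (simp add: toB \<rho>_def)
  qed
  have diff: "E1 - E2 = (\<Sum>x\<in>?A. w x * (g x - g (flip k x))) / N1"
    unfolding E2 E1_def wmean_def N1_def by (simp add: right_diff_distrib sum_subtractf diff_divide_distrib)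
  have sq: "N1 * (E1 - E2)\<^sup>2 \<le> (\<Sum>x\<in>?A. w x * (g x - g (flip k x))\<^sup>2)"
  proof -
    have "(\<Sum>x\<in>?A. w x * (1 * (g x - g (flip k x))))\<^sup>2
        \<le> (\<Sum>x\<in>?A. w x * 1\<^sup>2) * (\<Sum>x\<in>?A. w x * (g x - g (flip k x))\<^sup>2)"
      by (rule weighted_cauchy_schwarz) (simp add: wpos less_imp_le)
    then have "(N1 * (E1 - E2))\<^sup>2 \<le> N1 * (\<Sum>x\<in>?A. w x * (g x - g (flip k x))\<^sup>2)"
      unfolding diff using N by (simp add: N1_def)
    then have "N1 * (N1 * (E1 - E2)\<^sup>2) \<le> N1 * (\<Sum>x\<in>?A. w x * (g x - g (flip k x))\<^sup>2)"
      by (simp add: power2_eq_square algebra_simps)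
    then show ?thesis using N by (simp only: mult_le_cancel_left_pos)
  qed
  have Fk: "F k x = conductance 1 \<rho> * (w x * (g x - g (flip k x))\<^sup>2)" if "x \<in> ?A" for x
    using conductance_scale[of "w x" 1 \<rho>] by (simp add: F_def \<rho>[OF that] mult_ac)
  have cross: "conductance N1 N2 * (E1 - E2)\<^sup>2 \<le> (\<Sum>x\<in>?A. F k x)"
  proof -
    have "conductance N1 N2 * (E1 - E2)\<^sup>2 = conductance 1 \<rho> * (N1 * (E1 - E2)\<^sup>2)"
      using conductance_scale[of N1 1 \<rho>] by (simp add: N2 mult_ac)
    also have "\<dots> \<le> conductance 1 \<rho> * (\<Sum>x\<in>?A. w x * (g x - g (flip k x))\<^sup>2)"
      by (intro mult_left_mono sq conductance_nonneg) (auto simp: \<rho>_def)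
    also have "\<dots> = (\<Sum>x\<in>?A. F k x)"
      unfolding sum_distrib_left by (intro sum.cong refl) (simp add: Fk)
    finally show ?thesis .
  qed
  \<comment> \<open>Each edge in direction \<open>k\<close> is seen from both halves, which absorbs
    the factor \<open>1/2\<close> in the claim.\<close>
  have FB: "(\<Sum>x\<in>?B. F k x) = (\<Sum>x\<in>?A. F k x)"
    unfolding toB F_def by (simp add: flip_flip conductance_commute power2_commute)
  define c where "c = (N1 * E1 + N2 * E2) / (N1 + N2)"
  have pos: "0 < sum w (?A \<union> ?B)"
    using fin ne wpos by (intro sum_pos) auto
  have "wvar (?A \<union> ?B) w g \<le> (\<Sum>x\<in>?A \<union> ?B. w x * (g x - c)\<^sup>2)"
    by (rule wvar_le_sum_sq[OF pos])
  also have "\<dots> = (\<Sum>x\<in>?A. w x * (g x - c)\<^sup>2) + (\<Sum>x\<in>?B. w x * (g x - c)\<^sup>2)"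
    using fin un by (intro sum.union_disjoint) auto
  also have "\<dots> = wvar ?A w g + wvar ?B w g + (N1 * (E1 - c)\<^sup>2 + N2 * (E2 - c)\<^sup>2)"
    using N by (simp add: sum_sq_shift N1_def N2_def E1_def E2_def)
  also have "\<dots> = wvar ?A w g + wvar ?B w g + conductance N1 N2 * (E1 - E2)\<^sup>2"
    unfolding c_def using two_block_variance[OF N] by simp
  also have "\<dots> \<le> 1/2 * (\<Sum>i<k. \<Sum>x\<in>?A. F i x) + 1/2 * (\<Sum>i<k. \<Sum>x\<in>?B. F i x) + (\<Sum>x\<in>?A. F k x)"
    using Suc.IH[OF _ \<sigma>] Suc.IH[OF _ f\<sigma>] cross k by (intro add_mono) auto
  also have "\<dots> = 1/2 * (\<Sum>i<Suc k. \<Sum>x\<in>?A \<union> ?B. F i x)"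
    using fin un FB by (simp add: sum.union_disjoint sum.distrib algebra_simps)
  finally show ?case unfolding un(1) .
qed

lemma product_poincare: "wvar (cube n) (\<lambda>x. exp (lin n h x)) g \<le> dirichlet n (\<lambda>x. exp (lin n h x)) g"
proof -
  obtain \<sigma> where "\<sigma> \<in> cube n" using cube_nonempty by blast
  from wvar_subcube_le[OF order.refl this] show ?thesis
    unfolding subcube_top dirichlet_def .
qed

section \<open>Positive semidefinite matrices\<close>

definition bil :: "nat \<Rightarrow> (nat \<Rightarrow> nat \<Rightarrow> real) \<Rightarrow> (nat \<Rightarrow> real) \<Rightarrow> (nat \<Rightarrow> real) \<Rightarrow> real" where
  "bil n W y z = (\<Sum>i<n. \<Sum>j<n. W i j * y i * z j)"

definition psd :: "nat \<Rightarrow> (nat \<Rightarrow> nat \<Rightarrow> real) \<Rightarrow> bool" where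
  "psd n W \<longleftrightarrow> (\<forall>i<n. \<forall>j<n. W i j = W j i) \<and> (\<forall>y. 0 \<le> bil n W y y)"

lemma psd_sym: "psd n W \<Longrightarrow> i < n \<Longrightarrow> j < n \<Longrightarrow> W i j = W j i"
  by (auto simp: psd_def)

lemma bil_commute: "psd n W \<Longrightarrow> bil n W y z = bil n W z y"
  unfolding bil_def by (subst sum.swap) (auto intro!: sum.cong simp: psd_sym)

lemma bil_unit_right:
  assumes "k < n"
  shows "bil n W y (\<lambda>j. of_bool (j = k)) = (\<Sum>i<n. W i k * y i)"
proof -
  have "(\<Sum>j<n. W i j * y i * of_bool (j = k)) = W i k * y i" for i
    using assms by (subst sum.remove[of _ k]) auto
  then show ?thesis by (simp add: bil_def)
qed

lemma bil_units:
  assumes "i < n" "k < n"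
  shows "bil n W (\<lambda>j. of_bool (j = i)) (\<lambda>j. of_bool (j = k)) = W i k"
  using assms by (subst bil_unit_right) (auto simp: sum.remove[of _ i])

lemma psd_cauchy_schwarz:
  assumes W: "psd n W"
  shows "(bil n W y z)\<^sup>2 \<le> bil n W y y * bil n W z z"
proof -
  let ?a = "bil n W z z" and ?b = "bil n W y z" and ?c = "bil n W y y"
  have *: "0 \<le> ?c + 2 * t * ?b + t\<^sup>2 * ?a" for t
  proof -
    have "bil n W (\<lambda>i. y i + t * z i) (\<lambda>i. y i + t * z i) = ?c + t * ?b + t * bil n W z y + t\<^sup>2 * ?a"
      by (simp add: bil_def algebra_simps sum.distrib sum_distrib_left power2_eq_square)
    moreover have "0 \<le> bil n W (\<lambda>i. y i + t * z i) (\<lambda>i. y i + t * z i)"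
      using W by (simp only: psd_def)
    ultimately show ?thesis using bil_commute[OF W, of z y] by simp
  qed
  show ?thesis
  proof (cases "?a = 0")
    case True
    have "?b = 0"
    proof (rule ccontr)
      assume "?b \<noteq> 0"
      \<comment> \<open>With \<open>?a = 0\<close> the quadratic is affine in \<open>t\<close>; at
        this \<open>t\<close> it takes the value \<open>-1\<close>.\<close>
      then have "2 * (- (?c + 1) / (2 * ?b)) * ?b = - (?c + 1)" by simp
      with *[of "- (?c + 1) / (2 * ?b)"] show False unfolding True mult_zero_right by linarith
    qed
    then show ?thesis using True by simp
  next
    case False
    then have "0 < ?a" using W by (simp add: psd_def order_less_le)
    moreover have "0 \<le> ?c - ?b\<^sup>2 / ?a"
      using *[of "- ?b / ?a"] False by (simp add: power2_eq_square)
    ultimately show ?thesis by (simp add: field_simps)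
  qed
qed

text \<open>Elimination without eigenvalues: in step \<open>k\<close> the rank-one matrix that
  clears row and column \<open>k\<close> is subtracted, and Cauchy-Schwarz for the quadratic form
  keeps the remainder positive semidefinite.\<close>

lemma psd_factor:
  assumes W: "psd n W"
  shows "\<exists>u. \<forall>i<n. \<forall>j<n. W i j = (\<Sum>k<n. u k i * u k j)"
proof -
  have "\<exists>u. psd n (\<lambda>i j. W i j - (\<Sum>l<k. u l i * u l j)) \<and>
      (\<forall>i<n. \<forall>j<n. i < k \<longrightarrow> W i j - (\<Sum>l<k. u l i * u l j) = 0)" if "k \<le> n" for k
    using that
  proof (induction k)
    case 0
    then show ?case using W by simp
  next
    case (Suc k)
    then obtain u :: "nat \<Rightarrow> nat \<Rightarrow> real" where u: "psd n (\<lambda>i j. W i j - (\<Sum>l<k. u l i * u l j))"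
      "\<And>i j. i < n \<Longrightarrow> j < n \<Longrightarrow> i < k \<Longrightarrow> W i j - (\<Sum>l<k. u l i * u l j) = 0" by auto
    define R where "R = (\<lambda>i j. W i j - (\<Sum>l<k. u l i * u l j))"
    have R: "psd n R" and R0: "\<And>i j. i < n \<Longrightarrow> j < n \<Longrightarrow> i < k \<Longrightarrow> R i j = 0"
      using u by (auto simp: R_def)
    have k: "k < n" using Suc by simp
    define r where "r = R k k"
    have CS: "(\<Sum>i<n. R i k * y i)\<^sup>2 \<le> bil n R y y * r" for y
      using psd_cauchy_schwarz[OF R, of y "\<lambda>j. of_bool (j = k)"]
      by (simp only: bil_units[OF k k] bil_unit_right[OF k] r_def)
    have r: "0 \<le> r"
      using R bil_units[OF k k, of R] by (metis psd_def r_def)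
    have Rk: "R i k = 0" if "r = 0" "i < n" for i
      using psd_cauchy_schwarz[OF R, of "\<lambda>j. of_bool (j = i)" "\<lambda>j. of_bool (j = k)"] that k
      by (simp add: bil_units r_def)
    \<comment> \<open>For a vanishing pivot, division by zero makes \<open>z\<close> zero. That is
      the right choice, since column \<open>k\<close> of the remainder vanishes by
      \<open>Rk\<close>.\<close>
    define z where "z = (\<lambda>i. R i k / sqrt r)"
    define u' where "u' = u(k := z)"
    have u': "W i j - (\<Sum>l<Suc k. u' l i * u' l j) = R i j - z i * z j" for i j
      by (simp add: u'_def R_def)
    have sym: "R i j - z i * z j = R j i - z j * z i" if "i < n" "j < n" for i j
      using psd_sym[OF R that] by simp
    have nonneg: "0 \<le> bil n (\<lambda>i j. R i j - z i * z j) y y" for y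
    proof -
      have "bil n (\<lambda>i j. R i j - z i * z j) y y = bil n R y y - (\<Sum>i<n. z i * y i) * (\<Sum>j<n. z j * y j)"
        by (simp add: bil_def left_diff_distrib right_diff_distrib sum_subtractf sum_product mult_ac)
      also have "(\<Sum>i<n. z i * y i) = (\<Sum>i<n. R i k * y i) / sqrt r"
        by (simp add: z_def sum_divide_distrib)
      also have "bil n R y y - \<dots> * \<dots> = bil n R y y - (\<Sum>i<n. R i k * y i)\<^sup>2 / r"
        using r by (simp add: power2_eq_square)
      also have "0 \<le> \<dots>"
      proof (cases "r = 0")
        case True
        then show ?thesis using R by (simp add: psd_def)
      next
        case False
        then show ?thesis using CS[of y] r by (simp add: field_simps)
      qed
      finally show ?thesis .
    qed
    have zero: "R i j - z i * z j = 0" if "i < n" "j < n" "i < Suc k" for i j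
    proof (cases "i = k")
      case True
      then show ?thesis
        using r Rk[OF _ that(2)] psd_sym[OF R that(1,2)] by (cases "r = 0") (auto simp: z_def r_def)
    next
      case False
      then show ?thesis using that R0 k by (simp add: z_def)
    qed
    show ?case
      unfolding psd_def by (rule exI[of _ u']) (use sym nonneg zero in \<open>simp add: u' del: sum.lessThan_Suc\<close>)
  qed
  from this[OF order.refl] show ?thesis by fastforce
qed

section \<open>Averages over random signs\<close>

text \<open>Sign vectors are encoded as subsets of \<open>{..<m}\<close>, so that averages are sums
  over a power set and inductions pair \<open>e\<close> with \<open>insert m e\<close>.\<close>

definition sg :: "nat set \<Rightarrow> nat \<Rightarrow> real" where
  "sg e k = (if k \<in> e then 1 else -1)"

lemma sum_Pow_Suc:
  fixes F :: "nat set \<Rightarrow> real"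
  shows "(\<Sum>e\<in>Pow {..<Suc m}. F e) = (\<Sum>e\<in>Pow {..<m}. F e + F (insert m e))"
proof -
  have "(\<Sum>e\<in>Pow {..<Suc m}. F e) = (\<Sum>e\<in>Pow {..<m}. F e) + (\<Sum>e\<in>insert m ` Pow {..<m}. F e)"
    unfolding lessThan_Suc Pow_insert by (rule sum.union_disjoint) auto
  also have "(\<Sum>e\<in>insert m ` Pow {..<m}. F e) = (\<Sum>e\<in>Pow {..<m}. F (insert m e))"
    by (rule sum.reindex_cong[where l = "insert m"]) (auto simp: inj_on_def)
  finally show ?thesis by (simp add: sum.distrib)
qed

lemma sg_insert_sum: "(\<Sum>k<m. sg (insert m e) k * X k) = (\<Sum>k<m. sg e k * X k)"
  by (intro sum.cong refl) (simp add: sg_def)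

text \<open>Orthogonality of independent signs: in each pair \<open>e\<close>,
  \<open>insert m e\<close> the mixed terms with \<open>X m\<close> cancel.\<close>

lemma sum_sg_sq: "(\<Sum>e\<in>Pow {..<m}. (\<Sum>k<m. sg e k * X k)\<^sup>2) = 2 ^ m * (\<Sum>k<m. (X k)\<^sup>2)"
proof (induction m)
  case (Suc m)
  have "(\<Sum>e\<in>Pow {..<Suc m}. (\<Sum>k<Suc m. sg e k * X k)\<^sup>2)
      = (\<Sum>e\<in>Pow {..<m}. 2 * (\<Sum>k<m. sg e k * X k)\<^sup>2 + 2 * (X m)\<^sup>2)"
    unfolding sum_Pow_Suc
  proof (rule sum.cong[OF refl])
    fix e assume "e \<in> Pow {..<m}"
    then have "m \<notin> e" by auto
    then show "(\<Sum>k<Suc m. sg e k * X k)\<^sup>2 + (\<Sum>k<Suc m. sg (insert m e) k * X k)\<^sup>2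
        = 2 * (\<Sum>k<m. sg e k * X k)\<^sup>2 + 2 * (X m)\<^sup>2"
      by (simp add: sg_insert_sum) (simp add: sg_def power2_eq_square algebra_simps)
  qed
  also have "\<dots> = 2 ^ Suc m * (\<Sum>k<Suc m. (X k)\<^sup>2)"
    by (simp only: sum.distrib sum_distrib_left[symmetric] Suc) (simp add: card_Pow algebra_simps)
  finally show ?case .
qed simp

lemma sum_sg_exp: "(\<Sum>e\<in>Pow {..<m}. exp (\<Sum>k<m. sg e k * b k)) = 2 ^ m * (\<Prod>k<m. cosh (b k :: real))"
proof (induction m)
  case (Suc m)
  have "(\<Sum>e\<in>Pow {..<Suc m}. exp (\<Sum>k<Suc m. sg e k * b k))
      = (\<Sum>e\<in>Pow {..<m}. exp (\<Sum>k<m. sg e k * b k) * (2 * cosh (b m)))"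
    unfolding sum_Pow_Suc
  proof (rule sum.cong[OF refl])
    fix e assume "e \<in> Pow {..<m}"
    then have "m \<notin> e" by auto
    then show "exp (\<Sum>k<Suc m. sg e k * b k) + exp (\<Sum>k<Suc m. sg (insert m e) k * b k)
        = exp (\<Sum>k<m. sg e k * b k) * (2 * cosh (b m))"
      by (simp add: sg_insert_sum exp_add cosh_def exp_minus) (simp add: sg_def exp_minus algebra_simps)
  qed
  also have "\<dots> = 2 ^ Suc m * (\<Prod>k<Suc m. cosh (b k))"
    by (simp add: sum_distrib_right[symmetric] Suc)
  finally show ?case .
qed simp

lemma abs_exp_minus_linear_le:
  fixes y :: real
  assumes "\<bar>y\<bar> \<le> 1"
  shows "\<bar>exp y - 1 - y\<bar> \<le> y\<^sup>2"
proof -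
  have "exp y \<le> 1 + y + y\<^sup>2"
  proof (cases "0 \<le> y")
    case True
    then show ?thesis using assms exp_bound[of y] by auto
  next
    case False
    \<comment> \<open>The product equals \<open>1 - y ^ 3\<close>, and \<open>y\<close> is
      negative.\<close>
    have "1 \<le> (1 + y + y\<^sup>2) * (1 - y)"
      using False by (simp add: algebra_simps power2_eq_square mult_le_0_iff zero_le_mult_iff)
    also have "\<dots> \<le> (1 + y + y\<^sup>2) * exp (- y)"
      using exp_ge_add_one_self[of "- y"] zero_le_power2[of "y + 1 / 2"]
      by (intro mult_left_mono) (auto simp: power2_eq_square algebra_simps)
    finally have "1 * exp y \<le> (1 + y + y\<^sup>2) * exp (- y) * exp y"
      by (rule mult_right_mono) simp
    then show ?thesis by (simp add: mult.assoc exp_add[symmetric])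
  qed
  then show ?thesis using exp_ge_add_one_self[of y] by linarith
qed

text \<open>One step of removing interaction: a weight that is an average of exponential tilts of \<open>w\<close>
  in the random direction \<open>\<Sum>k. \<plusminus>b\<^sub>k\<close> loses only a factor \<open>1 + O(\<delta>\<^sup>2)\<close> of variance.\<close>

lemma variance_step:
  fixes b :: "nat \<Rightarrow> 'a \<Rightarrow> real" and w g :: "'a \<Rightarrow> real"
  assumes S: "finite S" "S \<noteq> {}" and w: "\<And>x. x \<in> S \<Longrightarrow> 0 < w x"
    and \<delta>: "0 < \<delta>" "\<delta> \<le> 1" "\<delta> * B \<le> 1" and L: "0 \<le> L"
    and B: "\<And>x e. x \<in> S \<Longrightarrow> \<bar>\<Sum>k<m. sg e k * b k x\<bar> \<le> B"
    and cov: "(\<Sum>k<m. (\<Sum>x\<in>S. w x * (b k x * (g x - wmean S w g)))\<^sup>2) \<le> L * (\<Sum>x\<in>S. w x) * wvar S w g"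
  defines "we \<equiv> \<lambda>e x. w x * exp (\<delta> * (\<Sum>k<m. sg e k * b k x))"
  shows "wvar S (\<lambda>x. \<Sum>e\<in>Pow {..<m}. (1/2) ^ m * we e x) g
    \<le> (1 + \<delta>\<^sup>2 * (exp (2 * (\<delta> * B)) * ((1 + \<delta>) * L + 2 * \<delta> * B ^ 4)))
       * (\<Sum>e\<in>Pow {..<m}. (1/2) ^ m * wvar S (we e) g)"
proof -
  define \<mu> V N where "\<mu> = wmean S w g" and "V = wvar S w g" and "N = (\<Sum>x\<in>S. w x)"
  define l where "l = (\<lambda>e x. \<Sum>k<m. sg e k * b k x)"
  define E where "E = Pow {..<m}"
  define p :: real where "p = (1/2) ^ m"
  have p: "0 < p" "(\<Sum>e\<in>E. p) = 1"
    by (auto simp: p_def E_def card_Pow power_one_over)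
  have B0: "0 \<le> B" using B S(2) by (meson abs_ge_zero ex_in_conv order_trans)
  have N: "0 < N" unfolding N_def using S w by (intro sum_pos) auto
  have V: "0 \<le> V" unfolding V_def using w by (intro wvar_nonneg) (auto intro: less_imp_le)
  have lB: "\<bar>\<delta> * l e x\<bar> \<le> \<delta> * B" if "x \<in> S" for e x
    using B[OF that] \<delta> by (simp add: abs_mult l_def)
  have wepos: "0 < we e x" if "x \<in> S" for e x using w[OF that] by (simp add: we_def)
  have Nepos: "0 < (\<Sum>x\<in>S. we e x)" for e using S wepos by (intro sum_pos) auto
  \<comment> \<open>Crude pointwise comparison of tilted and untilted weights. It costs a factor
    \<open>exp (\<delta> * B)\<close>, but only inside a term that already carries
    \<open>\<delta>\<^sup>2\<close>.\<close>
  have we_ge: "w x \<le> exp (\<delta> * B) * we e x" if "x \<in> S" for e x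
  proof -
    have "1 \<le> exp (\<delta> * B + \<delta> * l e x)" using lB[OF that, of e] by (simp add: abs_le_iff)
    then have "w x * 1 \<le> w x * exp (\<delta> * B + \<delta> * l e x)" using w[OF that] by (intro mult_left_mono) auto
    then show ?thesis by (simp add: we_def l_def exp_add mult_ac)
  qed
  have Ne: "N \<le> exp (\<delta> * B) * (\<Sum>x\<in>S. we e x)" for e
    unfolding N_def sum_distrib_left by (intro sum_mono we_ge)
  have Ve: "V \<le> exp (\<delta> * B) * wvar S (we e) g" for e
  proof -
    have "V \<le> (\<Sum>x\<in>S. w x * (g x - wmean S (we e) g)\<^sup>2)"
      unfolding V_def by (rule wvar_le_sum_sq[OF N[unfolded N_def]])
    also have "\<dots> \<le> (\<Sum>x\<in>S. exp (\<delta> * B) * we e x * (g x - wmean S (we e) g)\<^sup>2)"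
      by (intro sum_mono mult_right_mono we_ge) auto
    also have "\<dots> = exp (\<delta> * B) * wvar S (we e) g"
      by (simp add: wvar_def sum_distrib_left mult_ac)
    finally show ?thesis .
  qed
  define X where "X = (\<lambda>e. \<Sum>x\<in>S. w x * (l e x * (g x - \<mu>)))"
  \<comment> \<open>The tilt moves the mean of \<open>g\<close> by a first-order part
    \<open>\<delta> * X e\<close> plus the contribution \<open>Y\<close> of the Taylor remainder of
    \<open>exp\<close>. Only the first must be bounded sharply.\<close>
  have shift: "(\<Sum>x\<in>S. we e x) * (wmean S (we e) g - \<mu>)\<^sup>2
      \<le> exp (\<delta> * B) / N * ((1 + \<delta>) * \<delta>\<^sup>2 * (X e)\<^sup>2 + 2 * \<delta> ^ 3 * B ^ 4 * N * V)" for e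
  proof -
    define Ne' r where "Ne' = (\<Sum>x\<in>S. we e x)" and "r = (\<lambda>x. exp (\<delta> * l e x) - 1 - \<delta> * l e x)"
    define Y where "Y = (\<Sum>x\<in>S. w x * (r x * (g x - \<mu>)))"
    have N': "0 < Ne'" using Nepos by (simp add: Ne'_def)
    have "Ne' * (wmean S (we e) g - \<mu>) = (\<Sum>x\<in>S. we e x * (g x - \<mu>))"
      using N' by (simp add: wmean_def Ne'_def right_diff_distrib sum_subtractf sum_distrib_right[symmetric])
    also have "\<dots> = (\<Sum>x\<in>S. w x * (g x - \<mu>) + \<delta> * (w x * (l e x * (g x - \<mu>))) + w x * (r x * (g x - \<mu>)))"
      by (intro sum.cong refl) (simp add: we_def l_def r_def algebra_simps)
    also have "\<dots> = \<delta> * X e + Y"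
      using sum_centered_zero[of w S g] N
      by (simp add: sum.distrib X_def Y_def \<mu>_def N_def sum_distrib_left)
    finally have eq: "Ne' * (wmean S (we e) g - \<mu>) = \<delta> * X e + Y" .
    \<comment> \<open>Young's inequality with weight \<open>\<delta>\<close>: the main term keeps a
      factor tending to one, while the large factor \<open>1 + 1 / \<delta>\<close> falls on
      \<open>Y\<^sup>2\<close>, which is of order \<open>\<delta> ^ 4\<close>.\<close>
    have "(\<delta> * X e + Y)\<^sup>2 \<le> (1 + \<delta>) * (\<delta> * X e)\<^sup>2 + (1 + 1 / \<delta>) * Y\<^sup>2"
    proof -
      have "0 \<le> (sqrt \<delta> * (\<delta> * X e) - Y / sqrt \<delta>)\<^sup>2" by simp
      also have "\<dots> = \<delta> * (\<delta> * X e)\<^sup>2 + Y\<^sup>2 / \<delta> - 2 * (\<delta> * X e) * Y"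
        using \<delta> by (simp add: power2_diff power_mult_distrib power_divide)
      finally show ?thesis by (simp add: power2_sum algebra_simps)
    qed
    also have "\<dots> \<le> (1 + \<delta>) * (\<delta> * X e)\<^sup>2 + (1 + 1 / \<delta>) * ((\<delta> * B) ^ 4 * N * V)"
    proof (intro add_left_mono mult_left_mono)
      have "Y\<^sup>2 \<le> (\<Sum>x\<in>S. w x * (r x)\<^sup>2) * V"
        unfolding Y_def V_def wvar_def \<mu>_def
        by (rule weighted_cauchy_schwarz) (use w in \<open>auto intro: less_imp_le\<close>)
      also have "\<dots> \<le> ((\<delta> * B) ^ 4 * N) * V"
      proof (intro mult_right_mono V)
        have "(r x)\<^sup>2 \<le> (\<delta> * B) ^ 4" if "x \<in> S" for x
        proof -
          have "\<bar>r x\<bar> \<le> (\<delta> * l e x)\<^sup>2"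
            unfolding r_def using lB[OF that, of e] \<delta> by (intro abs_exp_minus_linear_le) auto
          also have "\<dots> \<le> (\<delta> * B)\<^sup>2" using lB[OF that, of e] abs_le_square_iff[of "\<delta> * l e x" "\<delta> * B"] by simp
          finally have "\<bar>r x\<bar>\<^sup>2 \<le> ((\<delta> * B)\<^sup>2)\<^sup>2" by (rule power_mono) simp
          then show ?thesis by (simp add: power_mult[symmetric])
        qed
        then have "(\<Sum>x\<in>S. w x * (r x)\<^sup>2) \<le> (\<Sum>x\<in>S. w x * (\<delta> * B) ^ 4)"
          using w by (intro sum_mono mult_left_mono) (auto intro: less_imp_le)
        then show "(\<Sum>x\<in>S. w x * (r x)\<^sup>2) \<le> (\<delta> * B) ^ 4 * N"
          by (simp add: N_def sum_distrib_right[symmetric] mult.commute)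
      qed
      finally show "Y\<^sup>2 \<le> (\<delta> * B) ^ 4 * N * V" .
    qed (use \<delta> in auto)
    also have "\<dots> \<le> (1 + \<delta>) * \<delta>\<^sup>2 * (X e)\<^sup>2 + 2 * \<delta> ^ 3 * B ^ 4 * N * V"
    proof -
      have "(1 + 1 / \<delta>) * (\<delta> * B) ^ 4 = (1 + \<delta>) * (\<delta> ^ 3 * B ^ 4)"
        using \<delta> by (simp add: field_simps power_mult_distrib eval_nat_numeral)
      also have "\<dots> \<le> 2 * (\<delta> ^ 3 * B ^ 4)" using \<delta> B0 by (intro mult_right_mono) auto
      finally have "(1 + 1 / \<delta>) * (\<delta> * B) ^ 4 * (N * V) \<le> 2 * (\<delta> ^ 3 * B ^ 4) * (N * V)"
        using N V by (intro mult_right_mono) auto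
      then show ?thesis by (simp add: power_mult_distrib mult_ac)
    qed
    finally have main: "(Ne' * (wmean S (we e) g - \<mu>))\<^sup>2 \<le> (1 + \<delta>) * \<delta>\<^sup>2 * (X e)\<^sup>2 + 2 * \<delta> ^ 3 * B ^ 4 * N * V"
      unfolding eq .
    have "Ne' * (wmean S (we e) g - \<mu>)\<^sup>2 = (Ne' * (wmean S (we e) g - \<mu>))\<^sup>2 * (1 / Ne')"
      using N' by (simp add: power2_eq_square)
    also have "\<dots> \<le> (Ne' * (wmean S (we e) g - \<mu>))\<^sup>2 * (exp (\<delta> * B) / N)"
      using Ne[of e] N N' by (intro mult_left_mono) (auto simp: field_simps Ne'_def)
    also have "\<dots> \<le> ((1 + \<delta>) * \<delta>\<^sup>2 * (X e)\<^sup>2 + 2 * \<delta> ^ 3 * B ^ 4 * N * V) * (exp (\<delta> * B) / N)"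
      using main N by (intro mult_right_mono) auto
    finally show ?thesis by (simp add: Ne'_def mult.commute)
  qed
  \<comment> \<open>Averaging over signs turns the square of a signed sum of covariances into the
    sum of their squares, which \<open>cov\<close> bounds.\<close>
  have X2: "(\<Sum>e\<in>E. p * (X e)\<^sup>2) \<le> L * N * V"
  proof -
    have "X e = (\<Sum>k<m. sg e k * (\<Sum>x\<in>S. w x * (b k x * (g x - \<mu>))))" for e
      unfolding X_def l_def sum_distrib_left sum_distrib_right
      by (subst sum.swap) (simp add: mult_ac)
    then have "(\<Sum>e\<in>E. (X e)\<^sup>2) = 2 ^ m * (\<Sum>k<m. (\<Sum>x\<in>S. w x * (b k x * (g x - \<mu>)))\<^sup>2)"
      unfolding E_def by (simp add: sum_sg_sq)
    then have "(\<Sum>e\<in>E. p * (X e)\<^sup>2) = (\<Sum>k<m. (\<Sum>x\<in>S. w x * (b k x * (g x - \<mu>)))\<^sup>2)"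
      by (simp only: sum_distrib_left[symmetric]) (simp add: p_def power_one_over)
    then show ?thesis using cov by (simp add: \<mu>_def N_def V_def)
  qed
  define K where "K = (1 + \<delta>) * L + 2 * \<delta> * B ^ 4"
  have K: "0 \<le> K" using \<delta> L B0 by (simp add: K_def)
  have "wvar S (\<lambda>x. \<Sum>e\<in>E. p * we e x) g
      \<le> (\<Sum>e\<in>E. p * wvar S (we e) g) + (\<Sum>e\<in>E. p * ((\<Sum>x\<in>S. we e x) * (wmean S (we e) g - \<mu>)\<^sup>2))"
  proof (rule wvar_mixture)
    show "0 < (\<Sum>x\<in>S. \<Sum>e\<in>E. p * we e x)"
      using S wepos p by (intro sum_pos) (auto simp: E_def intro!: mult_pos_pos)
  qed (use S wepos p in \<open>auto simp: E_def\<close>)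
  also have "(\<Sum>e\<in>E. p * ((\<Sum>x\<in>S. we e x) * (wmean S (we e) g - \<mu>)\<^sup>2))
      \<le> (\<Sum>e\<in>E. p * (exp (\<delta> * B) / N * ((1 + \<delta>) * \<delta>\<^sup>2 * (X e)\<^sup>2 + 2 * \<delta> ^ 3 * B ^ 4 * N * V)))"
    using p by (intro sum_mono mult_left_mono shift) auto
  also have "\<dots> = exp (\<delta> * B) / N * ((1 + \<delta>) * \<delta>\<^sup>2 * (\<Sum>e\<in>E. p * (X e)\<^sup>2) + 2 * \<delta> ^ 3 * B ^ 4 * N * V * (\<Sum>e\<in>E. p))"
    by (simp only: sum_distrib_left sum_distrib_right sum.distrib[symmetric])
      (intro sum.cong refl, simp add: algebra_simps)
  also have "\<dots> \<le> exp (\<delta> * B) / N * ((1 + \<delta>) * \<delta>\<^sup>2 * (L * N * V) + 2 * \<delta> ^ 3 * B ^ 4 * N * V * (\<Sum>e\<in>E. p))"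
    using X2 \<delta> N by (intro mult_left_mono add_mono order.refl) auto
  also have "\<dots> = \<delta>\<^sup>2 * (exp (\<delta> * B) * K) * V"
    using N p(2) by (simp add: K_def field_simps power2_eq_square power3_eq_cube)
  also have "V \<le> exp (\<delta> * B) * (\<Sum>e\<in>E. p * wvar S (we e) g)"
  proof -
    have "V = (\<Sum>e\<in>E. p * V)" using p(2) by (simp add: sum_distrib_right[symmetric] del: sum_constant)
    also have "\<dots> \<le> (\<Sum>e\<in>E. p * (exp (\<delta> * B) * wvar S (we e) g))"
      using p by (intro sum_mono mult_left_mono Ve) auto
    finally show ?thesis by (simp add: sum_distrib_left mult_ac)
  qed
  finally have "wvar S (\<lambda>x. \<Sum>e\<in>E. p * we e x) g \<le> (\<Sum>e\<in>E. p * wvar S (we e) g)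
     + \<delta>\<^sup>2 * (exp (\<delta> * B) * K) * (exp (\<delta> * B) * (\<Sum>e\<in>E. p * wvar S (we e) g))"
    using K by (simp add: mult_left_mono)
  also have "\<dots> = (1 + \<delta>\<^sup>2 * (exp (2 * (\<delta> * B)) * K)) * (\<Sum>e\<in>E. p * wvar S (we e) g)"
  proof -
    have "exp (2 * (\<delta> * B)) = exp (\<delta> * B) * exp (\<delta> * B)" by (simp add: exp_add[symmetric])
    then show ?thesis by (simp add: algebra_simps)
  qed
  finally show ?thesis by (simp add: E_def p_def K_def)
qed

section \<open>The Poincare inequality for high-temperature Ising weights\<close>

text \<open>The dual form of the bound \<open>s\<close> on the operator norm of the covariance matrix, which is the Poincare
  inequality for linear functions.\<close>

lemma sum_sq_cov_le:
  assumes w: "\<And>x. x \<in> cube n \<Longrightarrow> 0 < w x" and s: "0 \<le> s"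
    and poincare: "\<And>f. wvar (cube n) w f \<le> s * dirichlet n w f"
  shows "(\<Sum>i<n. (\<Sum>x\<in>cube n. w x * (x $ i * (g x - wmean (cube n) w g)))\<^sup>2)
     \<le> s * (\<Sum>x\<in>cube n. w x) * wvar (cube n) w g"
proof -
  define \<mu> N V where "\<mu> = wmean (cube n) w g" and "N = (\<Sum>x\<in>cube n. w x)" and "V = wvar (cube n) w g"
  define c where "c = (\<lambda>i. \<Sum>x\<in>cube n. w x * (x $ i * (g x - \<mu>)))"
  define C where "C = (\<Sum>i<n. (c i)\<^sup>2)"
  have N: "0 < N" unfolding N_def using w finite_cube cube_nonempty by (intro sum_pos) auto
  have V: "0 \<le> V" unfolding V_def using w by (intro wvar_nonneg) (auto intro: less_imp_le)
  have C0: "0 \<le> C" unfolding C_def by (intro sum_nonneg) auto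
  \<comment> \<open>Duality: the squared length of the covariance vector \<open>c\<close> is the
    covariance of \<open>g\<close> with the linear function \<open>lin n c\<close>. Cauchy-Schwarz
    and the Poincare inequality for that function give \<open>C\<^sup>2 \<le> s * N * C * V\<close>,
    and one factor \<open>C\<close> cancels.\<close>
  have "C = (\<Sum>x\<in>cube n. w x * (lin n c x * (g x - \<mu>)))"
  proof -
    have "C = (\<Sum>i<n. c i * (\<Sum>x\<in>cube n. w x * (x $ i * (g x - \<mu>))))"
      by (simp add: C_def c_def power2_eq_square)
    then show ?thesis
      unfolding lin_def sum_distrib_left sum_distrib_right by (subst (asm) sum.swap) (simp add: mult_ac)
  qed
  also have "\<dots> = (\<Sum>x\<in>cube n. w x * ((lin n c x - wmean (cube n) w (lin n c)) * (g x - \<mu>)))"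
    using sum_centered_zero[of w "cube n" g] N
    by (simp add: left_diff_distrib right_diff_distrib sum_subtractf sum_distrib_left[symmetric] N_def \<mu>_def
        mult.left_commute[of _ "wmean (cube n) w (lin n c)"])
  finally have "C\<^sup>2 \<le> wvar (cube n) w (lin n c) * V"
    unfolding V_def wvar_def \<mu>_def
    by (simp only:) (rule weighted_cauchy_schwarz, use w in \<open>auto intro: less_imp_le\<close>)
  also have "\<dots> \<le> (s * (N * C)) * V"
    unfolding N_def C_def using s V
    by (intro mult_right_mono order_trans[OF poincare] mult_left_mono dirichlet_lin_le w)
  finally have "C * C \<le> C * (s * N * V)" by (simp add: power2_eq_square mult_ac)
  then have "C \<le> s * N * V"
    using C0 s N V by (cases "C = 0") auto
  then show ?thesis by (simp add: C_def c_def N_def V_def \<mu>_def)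
qed

text \<open>Averaging over random signs multiplies the weight by another \<open>\<Prod>k. cosh (\<delta> * lin n (u k) x)\<close>, so
  \<open>variance_step\<close> turns the Poincare constant \<open>s\<close> into \<open>s * (1 + \<delta>\<^sup>2 * q' * s)\<close>. With \<open>\<delta>\<^sup>2 = 1 / j\<close> and
  \<open>j \<rightarrow> \<infinity>\<close> the weight tends to \<open>exp (1/2 * \<Sum>k. (lin n (u k) x)\<^sup>2)\<close>.\<close>

lemma poincare_cosh_product:
  fixes n :: nat and u :: "nat \<Rightarrow> nat \<Rightarrow> real"
  defines "B \<equiv> (\<Sum>k<n. \<Sum>i<n. \<bar>u k i\<bar>)"
  assumes \<delta>: "0 < \<delta>" "\<delta> \<le> 1" "\<delta> * B \<le> 1" and q: "0 \<le> q"
    and le: "\<And>c. (\<Sum>k<n. (\<Sum>i<n. u k i * c i)\<^sup>2) \<le> q * (\<Sum>i<n. (c i)\<^sup>2)"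
    and q': "exp (2 * (\<delta> * B)) * ((1 + \<delta>) * q + 2 * \<delta> * B ^ 4) \<le> q'"
    and j: "real j * (\<delta>\<^sup>2 * q') < 1"
  shows "wvar (cube n) (\<lambda>x. (\<Prod>k<n. cosh (\<delta> * lin n (u k) x)) ^ j * exp (lin n h x)) g
    \<le> 1 / (1 - real j * (\<delta>\<^sup>2 * q')) *
      dirichlet n (\<lambda>x. (\<Prod>k<n. cosh (\<delta> * lin n (u k) x)) ^ j * exp (lin n h x)) g"
  using j
proof (induction j arbitrary: h g)
  case 0
  then show ?case using product_poincare[of n h g] by simp
next
  case (Suc j)
  have B0: "0 \<le> B" unfolding B_def by (intro sum_nonneg) auto
  have q'0: "0 \<le> q'"
    by (rule order_trans[OF _ q']) (use \<delta> q B0 in auto)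
  define \<theta> where "\<theta> = \<delta>\<^sup>2 * q'"
  have \<theta>: "0 \<le> \<theta>" using q'0 by (simp add: \<theta>_def)
  have j1: "real j * \<theta> + \<theta> < 1" using Suc.prems by (simp add: \<theta>_def algebra_simps)
  define s where "s = 1 / (1 - real j * \<theta>)"
  have jt: "0 < 1 - real j * \<theta>" using j1 \<theta> by linarith
  have s: "1 \<le> s" using jt \<theta> by (simp add: s_def)
  define W where "W = (\<lambda>h x. (\<Prod>k<n. cosh (\<delta> * lin n (u k) x)) ^ j * exp (lin n h x))"
  \<comment> \<open>A tilt by \<open>\<Sum>k. \<plusminus>\<delta> * lin n (u k)\<close> only
    changes the external field. Every component of the mixture thus has the same form as the weight
    of the induction hypothesis, which holds for all fields.\<close>
  define he where "he = (\<lambda>e i. h i + \<delta> * (\<Sum>k<n. sg e k * u k i))"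
  let ?E = "Pow {..<n}"
  have IH: "wvar (cube n) (W h) g \<le> s * dirichlet n (W h) g" for h g
    unfolding W_def s_def \<theta>_def by (rule Suc.IH) (use jt in \<open>simp add: \<theta>_def\<close>)
  have Wpos: "0 < W h x" for h x by (simp add: W_def prod_pos)
  have lin_he: "lin n (he e) x = lin n h x + \<delta> * (\<Sum>k<n. sg e k * lin n (u k) x)" for e x
    unfolding lin_def he_def distrib_right sum.distrib sum_distrib_left sum_distrib_right
    by (subst (2) sum.swap) (simp add: mult_ac)
  have We: "W (he e) x = W h x * exp (\<delta> * (\<Sum>k<n. sg e k * lin n (u k) x))" for e x
    by (simp add: W_def lin_he exp_add)
  have mix: "(\<Prod>k<n. cosh (\<delta> * lin n (u k) x)) ^ Suc j * exp (lin n h x) = (\<Sum>e\<in>?E. (1/2) ^ n * W (he e) x)" for x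
  proof -
    have "(\<Sum>e\<in>?E. (1/2) ^ n * W (he e) x) = (1/2) ^ n * W h x * (\<Sum>e\<in>?E. exp (\<Sum>k<n. sg e k * (\<delta> * lin n (u k) x)))"
      unfolding We sum_distrib_left by (simp add: mult_ac sum_distrib_left)
    also have "\<dots> = W h x * (\<Prod>k<n. cosh (\<delta> * lin n (u k) x))"
      unfolding sum_sg_exp by (simp add: power_one_over)
    finally show ?thesis by (simp add: W_def)
  qed
  have step: "wvar (cube n) (\<lambda>x. \<Sum>e\<in>?E. (1/2) ^ n * (W h x * exp (\<delta> * (\<Sum>k<n. sg e k * lin n (u k) x)))) g
    \<le> (1 + \<delta>\<^sup>2 * (exp (2 * (\<delta> * B)) * ((1 + \<delta>) * (q * s) + 2 * \<delta> * B ^ 4)))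
       * (\<Sum>e\<in>?E. (1/2) ^ n * wvar (cube n) (\<lambda>x. W h x * exp (\<delta> * (\<Sum>k<n. sg e k * lin n (u k) x))) g)"
  proof (rule variance_step[OF finite_cube cube_nonempty])
    show "\<bar>\<Sum>k<n. sg e k * lin n (u k) x\<bar> \<le> B" if "x \<in> cube n" for x e
    proof -
      have "\<bar>\<Sum>k<n. sg e k * lin n (u k) x\<bar> \<le> (\<Sum>k<n. \<bar>sg e k * lin n (u k) x\<bar>)" by (rule sum_abs)
      also have "\<dots> \<le> (\<Sum>k<n. \<Sum>i<n. \<bar>u k i\<bar>)"
      proof (rule sum_mono)
        fix k
        have "\<bar>sg e k * lin n (u k) x\<bar> = \<bar>lin n (u k) x\<bar>" by (simp add: sg_def abs_mult)
        also have "\<dots> \<le> (\<Sum>i<n. \<bar>u k i * x $ i\<bar>)" unfolding lin_def by (rule sum_abs)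
        also have "\<dots> = (\<Sum>i<n. \<bar>u k i\<bar>)" using that by (simp add: abs_mult cube_abs)
        finally show "\<bar>sg e k * lin n (u k) x\<bar> \<le> (\<Sum>i<n. \<bar>u k i\<bar>)" .
      qed
      finally show ?thesis by (simp add: B_def)
    qed
    let ?\<mu> = "wmean (cube n) (W h) g"
    have "(\<Sum>k<n. (\<Sum>x\<in>cube n. W h x * (lin n (u k) x * (g x - ?\<mu>)))\<^sup>2)
        = (\<Sum>k<n. (\<Sum>i<n. u k i * (\<Sum>x\<in>cube n. W h x * (x $ i * (g x - ?\<mu>))))\<^sup>2)"
      unfolding lin_def sum_distrib_left sum_distrib_right
      by (subst sum.swap) (simp add: mult_ac)
    also have "\<dots> \<le> q * (\<Sum>i<n. (\<Sum>x\<in>cube n. W h x * (x $ i * (g x - ?\<mu>)))\<^sup>2)"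
      by (rule le)
    also have "\<dots> \<le> q * (s * (\<Sum>x\<in>cube n. W h x) * wvar (cube n) (W h) g)"
      using s q Wpos IH by (intro mult_left_mono sum_sq_cov_le) auto
    finally show "(\<Sum>k<n. (\<Sum>x\<in>cube n. W h x * (lin n (u k) x * (g x - ?\<mu>)))\<^sup>2)
        \<le> q * s * (\<Sum>x\<in>cube n. W h x) * wvar (cube n) (W h) g"
      by (simp add: mult_ac)
    show "0 \<le> q * s" using q s by simp
  qed (use \<delta> Wpos in auto)
  \<comment> \<open>Since \<open>1 \<le> s\<close>, the Taylor error may also be multiplied by
    \<open>s\<close>; this gives a recursion in \<open>s\<close> alone.\<close>
  have fac: "1 + \<delta>\<^sup>2 * (exp (2 * (\<delta> * B)) * ((1 + \<delta>) * (q * s) + 2 * \<delta> * B ^ 4)) \<le> 1 + \<theta> * s"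
  proof -
    have "2 * \<delta> * B ^ 4 * 1 \<le> 2 * \<delta> * B ^ 4 * s" using s \<delta> B0 by (intro mult_left_mono) auto
    then have "(1 + \<delta>) * (q * s) + 2 * \<delta> * B ^ 4 \<le> ((1 + \<delta>) * q + 2 * \<delta> * B ^ 4) * s"
      by (simp add: algebra_simps)
    then have "exp (2 * (\<delta> * B)) * ((1 + \<delta>) * (q * s) + 2 * \<delta> * B ^ 4)
        \<le> exp (2 * (\<delta> * B)) * ((1 + \<delta>) * q + 2 * \<delta> * B ^ 4) * s"
      by (simp add: mult.assoc)
    also have "\<dots> \<le> q' * s" using q' s by (intro mult_right_mono) auto
    finally show ?thesis using \<delta> by (simp add: \<theta>_def mult.assoc)
  qed
  have "wvar (cube n) (\<lambda>x. \<Sum>e\<in>?E. (1/2) ^ n * W (he e) x) g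
      \<le> (1 + \<theta> * s) * (\<Sum>e\<in>?E. (1/2) ^ n * wvar (cube n) (W (he e)) g)"
    unfolding We
    by (rule order_trans[OF step mult_right_mono[OF fac]])
      (intro sum_nonneg mult_nonneg_nonneg wvar_nonneg; use Wpos in \<open>auto intro: less_imp_le\<close>)
  also have "\<dots> \<le> (1 + \<theta> * s) * (\<Sum>e\<in>?E. (1/2) ^ n * (s * dirichlet n (W (he e)) g))"
    using \<theta> s by (intro mult_left_mono sum_mono IH) auto
  also have "\<dots> = (1 + \<theta> * s) * s * (\<Sum>e\<in>?E. (1/2) ^ n * dirichlet n (W (he e)) g)"
    by (simp add: sum_distrib_left mult_ac)
  also have "\<dots> \<le> (1 + \<theta> * s) * s * dirichlet n (\<lambda>x. \<Sum>e\<in>?E. (1/2) ^ n * W (he e) x) g"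
    using \<theta> s Wpos by (intro mult_left_mono dirichlet_mixture) auto
  also have "\<dots> \<le> 1 / (1 - real (Suc j) * \<theta>) * dirichlet n (\<lambda>x. \<Sum>e\<in>?E. (1/2) ^ n * W (he e) x) g"
  proof (rule mult_right_mono)
    let ?a = "1 - real j * \<theta>"
    have a: "\<theta> < ?a" using j1 by linarith
    \<comment> \<open>In terms of the inverse constant \<open>b = 1 / s\<close> one step subtracts
      at most \<open>\<theta>\<close>:
      \<open>(b + \<theta>) / b\<^sup>2 \<le> 1 / (b - \<theta>)\<close>, because
      \<open>b\<^sup>2 - \<theta>\<^sup>2 \<le> b\<^sup>2\<close>.\<close>
    have "(1 + \<theta> * s) * s = (?a + \<theta>) / (?a * ?a)"
      using jt by (simp add: s_def field_simps)
    also have "\<dots> \<le> 1 / (?a - \<theta>)"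
    proof -
      have "(b + \<theta>) / (b * b) \<le> 1 / (b - \<theta>)" if "0 < b" "\<theta> < b" for b
        using that by (simp add: divide_le_eq le_divide_eq) (simp add: field_simps)
      from this[OF jt a] show ?thesis .
    qed
    finally show "(1 + \<theta> * s) * s \<le> 1 / (1 - real (Suc j) * \<theta>)"
      by (simp add: algebra_simps)
    show "0 \<le> dirichlet n (\<lambda>x. \<Sum>e\<in>?E. (1/2) ^ n * W (he e) x) g"
      using Wpos by (intro dirichlet_nonneg sum_nonneg) (auto intro: less_imp_le)
  qed
  finally show ?case unfolding mix \<theta>_def .
qed

text \<open>A central limit theorem for signs: the left side is the moment generating function of a
  normalized sum of \<open>N\<close> signs.\<close>

lemma tendsto_cosh_power:
  "(\<lambda>N::nat. cosh (a / sqrt (real N)) ^ N) \<longlonglongrightarrow> exp (a\<^sup>2 / 2)"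
proof -
  have "(\<lambda>N::nat. real N * ln (cosh (a / sqrt (real N)))) \<longlonglongrightarrow> a\<^sup>2 / 2"
    unfolding cosh_def
  proof (cases a "0::real" rule: linorder_cases)
    case less
    then show "(\<lambda>N::nat. real N * ln ((exp (a / sqrt (real N)) + exp (- (a / sqrt (real N)))) /\<^sub>R 2)) \<longlonglongrightarrow> a\<^sup>2 / 2"
      by simp (real_asymp simp: power2_eq_square)
  next
    case greater
    then show "(\<lambda>N::nat. real N * ln ((exp (a / sqrt (real N)) + exp (- (a / sqrt (real N)))) /\<^sub>R 2)) \<longlonglongrightarrow> a\<^sup>2 / 2"
      by simp (real_asymp simp: power2_eq_square)
  qed simp
  then have "(\<lambda>N::nat. exp (real N * ln (cosh (a / sqrt (real N))))) \<longlonglongrightarrow> exp (a\<^sup>2 / 2)"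
    by (rule tendsto_exp)
  then show ?thesis
    by (simp add: exp_of_nat_mult)
qed

lemma tendsto_conductance:
  assumes "(a \<longlongrightarrow> A) F" "(b \<longlongrightarrow> B) F" "0 < A" "0 < B"
  shows "((\<lambda>N. conductance (a N) (b N)) \<longlongrightarrow> conductance A B) F"
  unfolding conductance_def using assms by (intro tendsto_intros) auto

lemma ising_poincare:
  fixes n :: nat and h :: "nat \<Rightarrow> real"
  assumes W: "psd n W" and q: "0 \<le> q" "q < 1"
    and Wq: "\<And>c. bil n W c c \<le> q * (\<Sum>i<n. (c i)\<^sup>2)"
  defines "w \<equiv> \<lambda>x. exp (1/2 * bil n W (($) x) (($) x) + lin n h x)"
  shows "wvar (cube n) w g \<le> 2 / (1 - q) * dirichlet n w g"
proof -
  obtain u where u: "\<And>i j. i < n \<Longrightarrow> j < n \<Longrightarrow> W i j = (\<Sum>k<n. u k i * u k j)"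
    using psd_factor[OF W] by blast
  have bil: "bil n W c c = (\<Sum>k<n. (\<Sum>i<n. u k i * c i)\<^sup>2)" for c
  proof -
    have "bil n W c c = (\<Sum>i<n. \<Sum>j<n. \<Sum>k<n. u k i * u k j * c i * c j)"
      unfolding bil_def by (intro sum.cong refl) (simp add: u sum_distrib_right)
    also have "\<dots> = (\<Sum>i<n. \<Sum>k<n. \<Sum>j<n. u k i * u k j * c i * c j)"
      by (intro sum.cong refl sum.swap)
    also have "\<dots> = (\<Sum>k<n. \<Sum>i<n. \<Sum>j<n. u k i * u k j * c i * c j)"
      by (rule sum.swap)
    also have "\<dots> = (\<Sum>k<n. (\<Sum>i<n. u k i * c i)\<^sup>2)"
      by (simp add: power2_eq_square sum_product mult_ac)
    finally show ?thesis .
  qed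
  define B where "B = (\<Sum>k<n. \<Sum>i<n. \<bar>u k i\<bar>)"
  \<comment> \<open>Any value strictly between \<open>q\<close> and \<open>1\<close> leaves room for
    the vanishing error terms. The midpoint gives \<open>1 / (1 - q') = 2 / (1 - q)\<close>, because
    \<open>N\<close> steps of size \<open>1 / sqrt N\<close> use up exactly
    \<open>q'\<close>.\<close>
  define q' where "q' = (1 + q) / 2"
  define \<delta> where "\<delta> = (\<lambda>N::nat. 1 / sqrt (real N))"
  define wN where "wN = (\<lambda>N x. (\<Prod>k<n. cosh (\<delta> N * lin n (u k) x)) ^ N * exp (lin n h x))"
  have \<delta>0: "\<delta> \<longlonglongrightarrow> 0" unfolding \<delta>_def by real_asymp
  have lim: "(\<lambda>N. wN N x) \<longlonglongrightarrow> w x" for x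
  proof -
    have "(\<lambda>N. (\<Prod>k<n. cosh (lin n (u k) x / sqrt (real N)) ^ N) * exp (lin n h x))
        \<longlonglongrightarrow> (\<Prod>k<n. exp ((lin n (u k) x)\<^sup>2 / 2)) * exp (lin n h x)"
      by (intro tendsto_mult tendsto_prod tendsto_cosh_power tendsto_const)
    moreover have "(\<Prod>k<n. exp ((lin n (u k) x)\<^sup>2 / 2)) * exp (lin n h x) = w x"
      by (simp add: w_def bil exp_add exp_sum lin_def sum_divide_distrib)
    ultimately show ?thesis by (simp add: wN_def \<delta>_def prod_power_distrib)
  qed
  have wpos: "0 < w x" for x by (simp add: w_def)
  have Zpos: "0 < (\<Sum>x\<in>cube n. w x)" using wpos finite_cube cube_nonempty by (intro sum_pos) auto
  have mean: "(\<lambda>N. wmean (cube n) (wN N) g) \<longlonglongrightarrow> wmean (cube n) w g"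
    unfolding wmean_def using Zpos by (intro tendsto_intros lim) auto
  have var: "(\<lambda>N. wvar (cube n) (wN N) g) \<longlonglongrightarrow> wvar (cube n) w g"
    unfolding wvar_def by (intro tendsto_intros lim mean)
  have dir: "(\<lambda>N. 2 / (1 - q) * dirichlet n (wN N) g) \<longlonglongrightarrow> 2 / (1 - q) * dirichlet n w g"
    unfolding dirichlet_def by (intro tendsto_intros lim tendsto_conductance wpos)
  have "\<forall>\<^sub>F N in sequentially. 0 < N" by (rule eventually_gt_at_top)
  moreover have "\<forall>\<^sub>F N in sequentially. \<delta> N < 1"
    using \<delta>0 by (rule order_tendstoD) simp
  moreover have "\<forall>\<^sub>F N in sequentially. \<delta> N * B < 1"
    by (rule order_tendstoD(2)[of _ "0 * B"]) (intro tendsto_intros \<delta>0, simp)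
  moreover have "\<forall>\<^sub>F N in sequentially. exp (2 * (\<delta> N * B)) * ((1 + \<delta> N) * q + 2 * \<delta> N * B ^ 4) < q'"
    by (rule order_tendstoD(2)[of _ "exp (2 * (0 * B)) * ((1 + 0) * q + 2 * 0 * B ^ 4)"])
      (intro tendsto_intros \<delta>0, use q in \<open>simp add: q'_def\<close>)
  ultimately have "\<forall>\<^sub>F N in sequentially. wvar (cube n) (wN N) g \<le> 2 / (1 - q) * dirichlet n (wN N) g"
  proof eventually_elim
    case (elim N)
    have Nq: "real N * ((\<delta> N)\<^sup>2 * q') = q'" using elim(1) by (simp add: \<delta>_def power_divide)
    have "2 / (1 - q) = 1 / (1 - q')" using q by (simp add: q'_def field_simps)
    then show ?case
      using poincare_cosh_product[where \<delta> = "\<delta> N" and n = n and u = u and q = q and q' = q' and j = N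
          and h = h and g = g] elim q Nq Wq unfolding bil
      by (simp add: wN_def B_def[symmetric]) (simp add: \<delta>_def q'_def)
  qed
  then show ?thesis by (rule tendsto_le[OF _ dir var, rotated]) simp
qed

section \<open>A lower bound for the variance of the magnetization\<close>

lemma one_minus_tanh: "1 - tanh h = exp (- 2 * h) * (1 + tanh (h::real))"
proof -
  have "1 + exp (- 2 * h) \<noteq> 0" using exp_gt_zero[of "- 2 * h"] by linarith
  then show ?thesis by (simp add: tanh_real_altdef field_simps)
qed

lemma tanh_bounds: "\<bar>tanh (h::real)\<bar> \<le> 1"
  using tanh_real_bounds[of h] by (auto simp: abs_le_iff)

lemma sech_sq_bounds:
  fixes h :: real
  shows "exp (- 2 * \<bar>h\<bar>) \<le> 1 - (tanh h)\<^sup>2" "0 \<le> 1 - (tanh h)\<^sup>2" "1 - (tanh h)\<^sup>2 \<le> 1"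
proof -
  have "exp (- 2 * y) \<le> 1 - (tanh y)\<^sup>2" if "0 \<le> y" for y :: real
  proof -
    have t: "0 \<le> tanh y" using that by simp
    have "1 - (tanh y)\<^sup>2 = (1 - tanh y) * (1 + tanh y)" by (simp add: power2_eq_square algebra_simps)
    also have "\<dots> = exp (- 2 * y) * ((1 + tanh y) * (1 + tanh y))" by (subst one_minus_tanh) simp
    also have "\<dots> \<ge> exp (- 2 * y) * (1 * 1)" using t by (intro mult_left_mono mult_mono) auto
    finally show ?thesis by simp
  qed
  from this[of "\<bar>h\<bar>"] show 1: "exp (- 2 * \<bar>h\<bar>) \<le> 1 - (tanh h)\<^sup>2"
    by (cases "0 \<le> h") auto
  show "0 \<le> 1 - (tanh h)\<^sup>2" by (rule order_trans[OF _ 1]) simp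
qed simp

lemma tanh_lipschitz: "\<bar>tanh b - tanh a\<bar> \<le> \<bar>b - a\<bar>" for a b :: real
proof -
  have "norm (tanh b - tanh a) \<le> 1 * norm (b - a)"
  proof (rule field_differentiable_bound[of UNIV])
    fix z :: real
    show "(tanh has_field_derivative 1 - (tanh z)\<^sup>2) (at z within UNIV)"
      by (auto intro!: derivative_eq_intros)
    show "norm (1 - (tanh z)\<^sup>2) \<le> 1" using sech_sq_bounds[of z] by simp
  qed auto
  then show ?thesis by simp
qed

lemma tanh_taylor: "\<bar>tanh b - tanh a - (b - a) * (1 - (tanh a)\<^sup>2)\<bar> \<le> 2 * (b - a)\<^sup>2" for a b :: real
proof -
  define F where "F = (\<lambda>z. tanh z - (z - a) * (1 - (tanh a)\<^sup>2))"
  have "norm (F b - F a) \<le> (2 * \<bar>b - a\<bar>) * norm (b - a)"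
  proof (rule field_differentiable_bound[of "closed_segment a b"])
    fix z assume z: "z \<in> closed_segment a b"
    show "(F has_field_derivative (1 - (tanh z)\<^sup>2) - (1 - (tanh a)\<^sup>2)) (at z within closed_segment a b)"
      unfolding F_def by (auto intro!: derivative_eq_intros)
    have "\<bar>(1 - (tanh z)\<^sup>2) - (1 - (tanh a)\<^sup>2)\<bar> = \<bar>tanh z + tanh a\<bar> * \<bar>tanh z - tanh a\<bar>"
      unfolding abs_mult[symmetric] by (simp add: power2_eq_square algebra_simps abs_minus_commute)
    also have "\<dots> \<le> 2 * \<bar>z - a\<bar>"
      using tanh_bounds[of z] tanh_bounds[of a] by (intro mult_mono tanh_lipschitz) auto
    also have "\<dots> \<le> 2 * \<bar>b - a\<bar>"
      using z by (auto simp: closed_segment_eq_real_ivl split: if_splits)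
    finally show "norm ((1 - (tanh z)\<^sup>2) - (1 - (tanh a)\<^sup>2)) \<le> 2 * \<bar>b - a\<bar>" by simp
  qed auto
  then show ?thesis by (simp add: F_def power2_eq_square abs_mult_self_eq mult.assoc abs_mult[symmetric])
qed

section \<open>Quadratic forms under spin flips, and the operator norm\<close>

lemma bil_update:
  assumes W: "psd n W" and i: "i < n"
  shows "bil n W (\<lambda>j. y j + c * of_bool (j = i)) (\<lambda>j. y j + c * of_bool (j = i))
    = bil n W y y + 2 * c * (\<Sum>j<n. W i j * y j) + c\<^sup>2 * W i i"
proof -
  let ?e = "\<lambda>j. of_bool (j = i)"
  have "bil n W (\<lambda>j. y j + c * ?e j) (\<lambda>j. y j + c * ?e j)
      = bil n W y y + c * bil n W y ?e + c * bil n W ?e y + c\<^sup>2 * bil n W ?e ?e"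
    by (simp only: bil_def algebra_simps sum.distrib sum_distrib_left power2_eq_square)
  moreover have "bil n W y ?e = (\<Sum>j<n. W i j * y j)"
    unfolding bil_unit_right[OF i] using psd_sym[OF W] i by (intro sum.cong) auto
  ultimately show ?thesis using bil_commute[OF W, of y ?e] by (simp add: bil_units[OF i i])
qed

lemma bil_cong:
  "(\<And>i. i < n \<Longrightarrow> y i = y' i) \<Longrightarrow> (\<And>i. i < n \<Longrightarrow> z i = z' i) \<Longrightarrow> bil n W y z = bil n W y' z'"
  by (simp add: bil_def)

lemma bil_flip:
  assumes W: "psd n W" and x: "x \<in> cube n" and i: "i < n"
  shows "bil n W (($) (flip i x)) (($) (flip i x))
    = bil n W (($) x) (($) x) - 4 * x $ i * ((\<Sum>j<n. W i j * x $ j) - W i i * x $ i)"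
proof -
  have "bil n W (($) (flip i x)) (($) (flip i x))
      = bil n W (\<lambda>j. x $ j + (- 2 * x $ i) * of_bool (j = i)) (\<lambda>j. x $ j + (- 2 * x $ i) * of_bool (j = i))"
    by (rule bil_cong) (auto simp: flip_index[OF x])
  then show ?thesis
    unfolding bil_update[OF W i] by (simp add: power2_eq_square algebra_simps)
qed

text \<open>The operator norm without spectral theory: for \<open>y = W z\<close> the squared length
  of \<open>y\<close> is \<open>bil n W y z\<close>, and Cauchy-Schwarz for the form bounds its
  square by \<open>bil n W y y * bil n W z z\<close>.\<close>

lemma psd_contraction:
  assumes W: "psd n W" and W1: "\<And>c. bil n W c c \<le> (\<Sum>i<n. (c i)\<^sup>2)"
  shows "(\<Sum>i<n. (\<Sum>j<n. W i j * z j)\<^sup>2) \<le> (\<Sum>i<n. (z i)\<^sup>2)"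
proof -
  define y where "y = (\<lambda>i. \<Sum>j<n. W i j * z j)"
  let ?Y = "\<Sum>i<n. (y i)\<^sup>2" and ?Z = "\<Sum>i<n. (z i)\<^sup>2"
  have nn: "0 \<le> ?Y" "0 \<le> ?Z" by (auto intro: sum_nonneg)
  have "?Y = bil n W y z"
    by (simp add: bil_def y_def power2_eq_square sum_distrib_left mult_ac)
  then have "?Y\<^sup>2 \<le> bil n W y y * bil n W z z" using psd_cauchy_schwarz[OF W, of y z] by simp
  also have "\<dots> \<le> ?Y * ?Z"
    using W nn by (intro mult_mono W1) (auto simp: psd_def)
  finally have "?Y * ?Y \<le> ?Y * ?Z" by (simp add: power2_eq_square)
  then have "?Y \<le> ?Z" using nn by (cases "?Y = 0") auto
  then show ?thesis by (simp add: y_def)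
qed

lemma psd_row_sq_le_1:
  assumes W: "psd n W" and W1: "\<And>c. bil n W c c \<le> (\<Sum>i<n. (c i)\<^sup>2)" and k: "k < n"
  shows "(\<Sum>i<n. (W i k)\<^sup>2) \<le> 1" and "\<bar>W k k\<bar> \<le> 1"
proof -
  have unit: "(\<Sum>i<n. (of_bool (i = k) :: real)\<^sup>2) = 1"
    using k by (simp add: sum.remove[of _ k])
  have "(\<Sum>j<n. W i j * of_bool (j = k)) = W i k" for i
    using k by (subst sum.remove[of _ k]) auto
  then show 1: "(\<Sum>i<n. (W i k)\<^sup>2) \<le> 1"
    using psd_contraction[OF W W1, of "\<lambda>j. of_bool (j = k)"] unit by simp
  have "(W k k)\<^sup>2 \<le> (\<Sum>i<n. (W i k)\<^sup>2)"
    using k by (intro member_le_sum[of k "{..<n}" "\<lambda>i. (W i k)\<^sup>2"]) auto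
  with 1 have "(W k k)\<^sup>2 \<le> 1" by linarith
  then show "\<bar>W k k\<bar> \<le> 1" by (simp add: abs_square_le_1)
qed

text \<open>Any test function of mean zero certifies a lower bound for the variance of
  \<open>f\<close>, by its correlation with \<open>f\<close>.\<close>

lemma wvar_lower_bound:
  assumes w: "\<And>x. x \<in> S \<Longrightarrow> 0 \<le> w x" and N: "0 < (\<Sum>x\<in>S. w x)"
    and g0: "(\<Sum>x\<in>S. w x * g x) = 0"
  shows "(\<Sum>x\<in>S. w x * (f x * g x))\<^sup>2 \<le> wvar S w f * (\<Sum>x\<in>S. w x * (g x)\<^sup>2)"
proof -
  have "(\<Sum>x\<in>S. w x * ((f x - wmean S w f) * g x)) = (\<Sum>x\<in>S. w x * (f x * g x)) - wmean S w f * (\<Sum>x\<in>S. w x * g x)"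
    by (simp add: algebra_simps sum_subtractf sum_distrib_left)
  then show ?thesis
    using weighted_cauchy_schwarz[where S = S and w = w and f = "\<lambda>x. f x - wmean S w f" and g = g] w g0
    by (simp add: wvar_def)
qed

section \<open>Correlations of spins centred by their conditional means\<close>

locale tilted_ising =
  fixes n :: nat and W :: "nat \<Rightarrow> nat \<Rightarrow> real" and a :: "nat \<Rightarrow> real"
  assumes W: "psd n W"
begin

definition wt :: "real Matrix.vec \<Rightarrow> real" where
  "wt x = exp (1/2 * bil n W (($) x) (($) x) + lin n a x)"

text \<open>The diagonal contribution is removed because \<open>(x $ i)\<^sup>2 = 1\<close> makes it
  constant in the weight; the local field at \<open>i\<close> then does not depend on the spin at
  \<open>i\<close>.\<close>

definition fld :: "nat \<Rightarrow> real Matrix.vec \<Rightarrow> real" where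
  "fld i x = (\<Sum>j<n. W i j * x $ j) - W i i * x $ i + a i"

abbreviation th :: "nat \<Rightarrow> real Matrix.vec \<Rightarrow> real" where
  "th i x \<equiv> tanh (fld i x)"

lemma wt_pos: "0 < wt x"
  by (simp add: wt_def)

lemma wt_flip:
  assumes "x \<in> cube n" "i < n"
  shows "wt (flip i x) = wt x * exp (- 2 * x $ i * fld i x)"
  unfolding wt_def bil_flip[OF W assms] lin_flip[OF assms] exp_add[symmetric]
  by (simp add: fld_def algebra_simps)

lemma fld_flip:
  assumes "x \<in> cube n" "i < n" "j < n"
  shows "fld j (flip i x) = (if i = j then fld j x else fld j x - 2 * W j i * x $ i)"
proof -
  have "(\<Sum>k<n. W j k * flip i x $ k) = (\<Sum>k<n. W j k * x $ k) - 2 * W j i * x $ i"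
    using lin_flip[OF assms(1,2), of "W j"] by (simp add: lin_def)
  then show ?thesis
    using assms by (auto simp: fld_def flip_index algebra_simps)
qed

text \<open>The site-\<open>i\<close> conditional mean of \<open>x\<^sub>i\<close> is \<open>tanh\<close> of the local field.\<close>

lemma sum_centered_spin:
  assumes i: "i < n" and inv: "\<And>x. x \<in> cube n \<Longrightarrow> \<phi> (flip i x) = \<phi> x"
  shows "(\<Sum>x\<in>cube n. wt x * ((x $ i - th i x) * \<phi> x)) = 0"
proof -
  let ?F = "\<lambda>x. wt x * ((x $ i - th i x) * \<phi> x)"
  have "?F x + ?F (flip i x) = 0" if x: "x \<in> cube n" for x
  proof -
    have "x $ i - th i x = exp (- 2 * x $ i * fld i x) * (x $ i + th i x)"
    proof -
      have "- 1 - tanh y = exp (2 * y) * (tanh y - 1)" for y :: real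
        using one_minus_tanh[of "- y"] by (simp add: algebra_simps)
      then show ?thesis
        using cube_cases[OF x i] one_minus_tanh[of "fld i x"] by auto
    qed
    then have "?F x = wt x * (exp (- 2 * x $ i * fld i x) * (x $ i + th i x) * \<phi> x)" by simp
    moreover have "?F (flip i x) = - (wt x * (exp (- 2 * x $ i * fld i x) * (x $ i + th i x) * \<phi> x))"
      using x i by (simp add: wt_flip fld_flip flip_index inv algebra_simps)
    ultimately show ?thesis by simp
  qed
  then have "(\<Sum>x\<in>cube n. ?F x + ?F (flip i x)) = 0" by simp
  then show ?thesis by (simp add: sum.distrib sum_flip[of ?F])
qed

lemma sum_spin_centered_spin:
  assumes i: "i < n" and j: "j < n"
  shows "(\<Sum>x\<in>cube n. wt x * ((x $ i - th i x) * x $ j))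
    = (if i = j then \<Sum>x\<in>cube n. wt x * (1 - (th i x)\<^sup>2) else 0)"
proof (cases "i = j")
  case True
  have "(\<Sum>x\<in>cube n. wt x * ((x $ i - th i x) * x $ i))
      = (\<Sum>x\<in>cube n. wt x * (1 - (th i x)\<^sup>2) - wt x * ((x $ i - th i x) * th i x))"
    using i by (intro sum.cong refl) (simp add: algebra_simps power2_eq_square cube_mult_self)
  then show ?thesis
    using True sum_centered_spin[OF i, of "th i"] i by (simp add: sum_subtractf fld_flip)
next
  case False
  then show ?thesis using sum_centered_spin[OF i, of "\<lambda>x. x $ j"] i j by (simp add: flip_index)
qed

text \<open>As a function of the spin at \<open>i\<close>, \<open>x $ j - th j x\<close> is affine,
  \<open>\<alpha> x - \<beta> x * x $ i\<close>, with coefficients unchanged by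
  \<open>flip i\<close>. The first part drops out by \<open>sum_centered_spin\<close>; the second
  leaves the conditional variance of the spin at \<open>i\<close>.\<close>

lemma sum_centered_spin_pair:
  assumes i: "i < n" and j: "j < n" and "i \<noteq> j"
  shows "(\<Sum>x\<in>cube n. wt x * ((x $ i - th i x) * (x $ j - th j x)))
    = - (\<Sum>x\<in>cube n. wt x * (x $ i * (th j x - th j (flip i x)) / 2 * (1 - (th i x)\<^sup>2)))"
proof -
  define \<alpha> where "\<alpha> = (\<lambda>x. x $ j - (th j x + th j (flip i x)) / 2)"
  define \<beta> where "\<beta> = (\<lambda>x. x $ i * (th j x - th j (flip i x)) / 2)"
  have \<alpha>: "\<alpha> (flip i x) = \<alpha> x" if "x \<in> cube n" for x
    using that i j assms(3) by (simp add: \<alpha>_def flip_flip flip_index)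
  have \<beta>: "\<beta> (flip i x) * th i (flip i x) = \<beta> x * th i x" if "x \<in> cube n" for x
    using that i j assms(3) by (simp add: \<beta>_def flip_flip flip_index fld_flip algebra_simps)
  have "wt x * ((x $ i - th i x) * (x $ j - th j x)) =
      wt x * ((x $ i - th i x) * \<alpha> x) + wt x * ((x $ i - th i x) * (\<beta> x * th i x)) - wt x * (\<beta> x * (1 - (th i x)\<^sup>2))"
    if x: "x \<in> cube n" for x
  proof -
    have "x $ j - th j x = \<alpha> x - \<beta> x * x $ i"
      using cube_cases[OF x i] by (auto simp: \<alpha>_def \<beta>_def field_simps)
    moreover have "(x $ i - th i x) * (\<beta> x * x $ i) = \<beta> x * (1 - th i x * x $ i)"
      using cube_mult_self[OF x i] by (simp add: algebra_simps)
    ultimately have "(x $ i - th i x) * (x $ j - th j x) = (x $ i - th i x) * \<alpha> x - \<beta> x * (1 - th i x * x $ i)"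
      by (simp add: right_diff_distrib)
    then show ?thesis by (simp only:) (simp add: algebra_simps power2_eq_square)
  qed
  then have "(\<Sum>x\<in>cube n. wt x * ((x $ i - th i x) * (x $ j - th j x))) =
      (\<Sum>x\<in>cube n. wt x * ((x $ i - th i x) * \<alpha> x) + wt x * ((x $ i - th i x) * (\<beta> x * th i x)) - wt x * (\<beta> x * (1 - (th i x)\<^sup>2)))"
    by (rule sum.cong[OF refl])
  also have "\<dots> = - (\<Sum>x\<in>cube n. wt x * (\<beta> x * (1 - (th i x)\<^sup>2)))"
    using sum_centered_spin[OF i, of \<alpha>, OF \<alpha>] sum_centered_spin[OF i, of "\<lambda>x. \<beta> x * th i x", OF \<beta>]
    by (simp add: sum.distrib sum_subtractf)
  finally show ?thesis by (simp add: \<beta>_def)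
qed

text \<open>Flipping site \<open>i\<close> moves the field at \<open>j\<close> by
  \<open>2 * W i j\<close> up to sign, so the halved response is \<open>W i j\<close> times the
  derivative of \<open>tanh\<close> to first order, with the error of
  \<open>tanh_taylor\<close>.\<close>

lemma spin_response:
  assumes x: "x \<in> cube n" and i: "i < n" and j: "j < n" and "i \<noteq> j"
  shows "\<bar>x $ i * (th j x - th j (flip i x)) / 2 - W i j * (1 - (th j x)\<^sup>2)\<bar> \<le> 4 * (W i j)\<^sup>2"
proof -
  let ?d = "- 2 * W j i * x $ i"
  have f: "fld j (flip i x) - fld j x = ?d" using fld_flip[OF x i j] assms(4) by simp
  have Wij: "W j i = W i j" using psd_sym[OF W i j] by simp
  have xi: "\<bar>x $ i\<bar> = 1" "x $ i * x $ i = 1" using cube_abs[OF x i] cube_mult_self[OF x i] by auto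
  have "x $ i * (th j x - th j (flip i x)) / 2 - W i j * (1 - (th j x)\<^sup>2)
      = - (x $ i) / 2 * (th j (flip i x) - th j x - ?d * (1 - (th j x)\<^sup>2))"
  proof -
    have "- (x $ i) / 2 * (A - C - ?d * D) = x $ i * (C - A) / 2 - (x $ i * x $ i) * W i j * D" for A C D
      by (simp add: Wij field_simps)
    then show ?thesis using xi(2) by simp
  qed
  then have "\<bar>x $ i * (th j x - th j (flip i x)) / 2 - W i j * (1 - (th j x)\<^sup>2)\<bar>
      = 1/2 * \<bar>th j (flip i x) - th j x - ?d * (1 - (th j x)\<^sup>2)\<bar>"
    by (simp only: abs_mult) (simp add: xi(1))
  also have "\<dots> \<le> 1/2 * (2 * ?d\<^sup>2)"
    using tanh_taylor[of "fld j (flip i x)" "fld j x"] unfolding f by (intro mult_left_mono) auto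
  also have "\<dots> = 4 * (W i j)\<^sup>2"
    using xi by (simp add: power_mult_distrib Wij power2_eq_square)
  finally show ?thesis .
qed

text \<open>Cauchy-Schwarz against the test function \<open>\<Sum>i. v i * (x $ i - th i x)\<close>, whose second moment is
  bounded because \<open>W\<close> is positive semidefinite with rows of norm at most \<open>1\<close>.\<close>

lemma wvar_magnetization_ge:
  assumes n: "0 < n" and W1: "\<And>c. bil n W c c \<le> (\<Sum>i<n. (c i)\<^sup>2)"
    and v: "\<And>i. i < n \<Longrightarrow> \<bar>v i\<bar> = 1 / sqrt (real n)"
    and a: "\<And>i. i < n \<Longrightarrow> \<bar>a i\<bar> \<le> K"
  shows "exp (- 4 * (2 + K)) / 6 * (\<Sum>x\<in>cube n. wt x) \<le> wvar (cube n) wt (lin n v)"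
proof -
  define N where "N = (\<Sum>x\<in>cube n. wt x)"
  define s where "s = (\<lambda>i x. 1 - (th i x)\<^sup>2)"
  define c where "c = exp (- 2 * (2 + K))"
  define g where "g = (\<lambda>x. \<Sum>i<n. v i * (x $ i - th i x))"
  have N: "0 < N" unfolding N_def using wt_pos finite_cube cube_nonempty by (intro sum_pos) auto
  have v2: "(v i)\<^sup>2 = 1 / real n" if "i < n" for i
    using v[OF that] by (metis power2_abs power_divide power_one real_sqrt_pow2 of_nat_0_le_iff)
  have s: "0 \<le> s i x" "s i x \<le> 1" "exp (- 2 * \<bar>fld i x\<bar>) \<le> s i x" for i x
    using sech_sq_bounds[of "fld i x"] by (auto simp: s_def)
  have Wkk: "\<bar>W k k\<bar> \<le> 1" and Wcol: "(\<Sum>i<n. (W i k)\<^sup>2) \<le> 1" if "k < n" for k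
    using psd_row_sq_le_1[OF W W1 that] by auto
  \<comment> \<open>Most conditional variances are bounded below in every configuration, since the
    local fields are bounded on average.\<close>
  have slow: "c \<le> (\<Sum>i<n. (v i)\<^sup>2 * s i x)" if x: "x \<in> cube n" for x
  proof -
    \<comment> \<open>The bound \<open>(1 + y\<^sup>2) / 2\<close> for \<open>\<bar>y\<bar>\<close>
      replaces the sum of absolute values by a sum of squares that \<open>psd_contraction\<close>
      controls. Diagonal and external field add \<open>1\<close> and \<open>K\<close>, hence the
      average \<open>2 + K\<close>.\<close>
    have "(\<Sum>i<n. \<bar>fld i x\<bar>) \<le> (\<Sum>i<n. (1 + (\<Sum>j<n. W i j * x $ j)\<^sup>2) / 2 + 1 + K)"
    proof (rule sum_mono)
      fix i assume "i \<in> {..<n}"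
      then have i: "i < n" by simp
      define y where "y = (\<Sum>j<n. W i j * x $ j)"
      have "2 * \<bar>y\<bar> \<le> 1 + y\<^sup>2" using zero_le_power2[of "1 - \<bar>y\<bar>"] by (simp add: power2_diff)
      moreover have "\<bar>fld i x\<bar> \<le> \<bar>y\<bar> + \<bar>W i i * x $ i\<bar> + \<bar>a i\<bar>" by (simp add: fld_def y_def)
      moreover have "\<bar>W i i * x $ i\<bar> \<le> 1" using Wkk[OF i] cube_abs[OF x i] by (simp add: abs_mult)
      moreover have "f \<le> (1 + q) / 2 + 1 + K" if "2 * p \<le> 1 + q" "f \<le> p + b + c" "b \<le> 1" "c \<le> K" for f p q b c :: real
        using that by (simp add: field_simps)
      ultimately have "\<bar>fld i x\<bar> \<le> (1 + y\<^sup>2) / 2 + 1 + K" using a[OF i] by blast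
      then show "\<bar>fld i x\<bar> \<le> (1 + (\<Sum>j<n. W i j * x $ j)\<^sup>2) / 2 + 1 + K" by (simp add: y_def)
    qed
    also have "\<dots> = n * (3 / 2 + K) + (\<Sum>i<n. (\<Sum>j<n. W i j * x $ j)\<^sup>2) / 2"
      by (simp add: sum.distrib sum_divide_distrib[symmetric] field_simps)
    also have "\<dots> \<le> n * (3 / 2 + K) + (\<Sum>i<n. (x $ i)\<^sup>2) / 2"
      using psd_contraction[OF W W1, of "($) x"] by simp
    also have "(\<Sum>i<n. (x $ i)\<^sup>2) = n" using x by (simp add: cube_sq)
    finally have F: "(\<Sum>i<n. \<bar>fld i x\<bar>) \<le> n * (2 + K)" by (simp add: algebra_simps)
    \<comment> \<open>Jensen in tangent form: \<open>exp (- 2 * f)\<close> lies above its tangent at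
      \<open>f = 2 + K\<close>, where its value is \<open>c\<close>.\<close>
    have "c * n \<le> (\<Sum>i<n. c * (1 + 2 * (2 + K) - 2 * \<bar>fld i x\<bar>))"
    proof -
      have "n \<le> n * (1 + 2 * (2 + K)) - 2 * (\<Sum>i<n. \<bar>fld i x\<bar>)" using F by (simp add: algebra_simps)
      then have "c * n \<le> c * (n * (1 + 2 * (2 + K)) - 2 * (\<Sum>i<n. \<bar>fld i x\<bar>))"
        by (intro mult_left_mono) (auto simp: c_def)
      then show ?thesis by (simp add: sum_subtractf sum_distrib_left[symmetric])
    qed
    also have "\<dots> \<le> (\<Sum>i<n. s i x)"
    proof (rule sum_mono)
      fix i
      have "c * (1 + 2 * (2 + K) - 2 * \<bar>fld i x\<bar>) \<le> c * exp (2 * (2 + K) - 2 * \<bar>fld i x\<bar>)"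
        using exp_ge_add_one_self[of "2 * (2 + K) - 2 * \<bar>fld i x\<bar>"]
        by (intro mult_left_mono) (auto simp: c_def algebra_simps)
      also have "\<dots> = exp (- 2 * \<bar>fld i x\<bar>)" by (simp add: c_def exp_add[symmetric])
      finally show "c * (1 + 2 * (2 + K) - 2 * \<bar>fld i x\<bar>) \<le> s i x" using s(3)[of i x] by linarith
    qed
    finally show ?thesis using n by (simp add: v2 sum_divide_distrib[symmetric] le_divide_eq)
  qed
  have g0: "(\<Sum>x\<in>cube n. wt x * g x) = 0"
  proof -
    have "(\<Sum>x\<in>cube n. wt x * g x) = (\<Sum>i<n. v i * (\<Sum>x\<in>cube n. wt x * ((x $ i - th i x) * 1)))"
      unfolding g_def sum_distrib_left by (subst sum.swap) (simp add: mult_ac)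
    also have "\<dots> = 0" using sum_centered_spin[of _ "\<lambda>x. 1"] by (intro sum.neutral) auto
    finally show ?thesis .
  qed
  \<comment> \<open>Correlations of centred spins with spins vanish off the diagonal, so only the
    conditional variances remain.\<close>
  have cov: "c * N \<le> (\<Sum>x\<in>cube n. wt x * (lin n v x * g x))"
  proof -
    have "wt x * (lin n v x * g x) = (\<Sum>i<n. \<Sum>j<n. v i * v j * (wt x * ((x $ i - th i x) * x $ j)))" for x
    proof -
      have "lin n v x * g x = (\<Sum>i<n. \<Sum>j<n. v i * (x $ i - th i x) * (v j * x $ j))"
        unfolding lin_def g_def sum_product[symmetric] by (rule mult.commute)
      then show ?thesis unfolding sum_distrib_left by (simp add: mult_ac sum_distrib_left)
    qed
    then have "(\<Sum>x\<in>cube n. wt x * (lin n v x * g x))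
        = (\<Sum>i<n. \<Sum>j<n. \<Sum>x\<in>cube n. v i * v j * (wt x * ((x $ i - th i x) * x $ j)))"
      by simp (subst sum.swap, intro sum.cong refl sum.swap)
    also have "\<dots> = (\<Sum>i<n. \<Sum>j<n. v i * v j * (if i = j then \<Sum>x\<in>cube n. wt x * s i x else 0))"
      unfolding s_def using sum_spin_centered_spin by (intro sum.cong refl) (simp add: sum_distrib_left[symmetric])
    also have "\<dots> = (\<Sum>i<n. (v i)\<^sup>2 * (\<Sum>x\<in>cube n. wt x * s i x))"
      by (simp add: if_distrib power2_eq_square cong: if_cong)
    also have "\<dots> = (\<Sum>x\<in>cube n. wt x * (\<Sum>i<n. (v i)\<^sup>2 * s i x))"
      unfolding sum_distrib_left by (subst sum.swap) (simp add: mult_ac)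
    also have "\<dots> \<ge> (\<Sum>x\<in>cube n. wt x * c)"
      using slow wt_pos by (intro sum_mono mult_left_mono) (auto intro: less_imp_le)
    finally show ?thesis by (simp add: N_def sum_distrib_left mult.commute)
  qed
  have g2: "(\<Sum>x\<in>cube n. wt x * (g x)\<^sup>2) \<le> 6 * N"
  proof -
    define \<beta> where "\<beta> = (\<lambda>i j x. x $ i * (th j x - th j (flip i x)) / 2)"
    define D where "D = (\<lambda>i j x. if i = j then s i x else - (\<beta> i j x * s i x))"
    have pair: "(\<Sum>x\<in>cube n. wt x * ((x $ i - th i x) * (x $ j - th j x))) = (\<Sum>x\<in>cube n. wt x * D i j x)"
      if "i < n" "j < n" for i j
    proof (cases "i = j")
      case True
      have "(\<Sum>x\<in>cube n. wt x * ((x $ i - th i x) * (x $ i - th i x)))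
        = (\<Sum>x\<in>cube n. wt x * ((x $ i - th i x) * x $ i)) - (\<Sum>x\<in>cube n. wt x * ((x $ i - th i x) * th i x))"
        by (simp add: sum_subtractf[symmetric] algebra_simps)
      then show ?thesis
        using True sum_spin_centered_spin[of i i] sum_centered_spin[of i "th i"] that by (simp add: D_def s_def fld_flip)
    next
      case False
      then show ?thesis using sum_centered_spin_pair[OF that False] by (simp add: D_def \<beta>_def s_def sum_negf)
    qed
    have "wt x * (g x)\<^sup>2 = (\<Sum>i<n. \<Sum>j<n. v i * v j * (wt x * ((x $ i - th i x) * (x $ j - th j x))))" for x
    proof -
      have "(g x)\<^sup>2 = (\<Sum>i<n. \<Sum>j<n. v i * (x $ i - th i x) * (v j * (x $ j - th j x)))"
        unfolding g_def sum_product[symmetric] by (simp add: power2_eq_square)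
      then show ?thesis unfolding sum_distrib_left by (simp add: mult_ac sum_distrib_left)
    qed
    then have "(\<Sum>x\<in>cube n. wt x * (g x)\<^sup>2)
        = (\<Sum>i<n. \<Sum>j<n. \<Sum>x\<in>cube n. v i * v j * (wt x * ((x $ i - th i x) * (x $ j - th j x))))"
      by simp (subst sum.swap, intro sum.cong refl sum.swap)
    also have "\<dots> = (\<Sum>i<n. \<Sum>j<n. \<Sum>x\<in>cube n. v i * v j * (wt x * D i j x))"
      unfolding sum_distrib_left[symmetric] using pair by (intro sum.cong refl) simp
    also have "\<dots> = (\<Sum>x\<in>cube n. wt x * (\<Sum>i<n. \<Sum>j<n. v i * v j * D i j x))"
    proof -
      have "(\<Sum>i<n. \<Sum>j<n. \<Sum>x\<in>cube n. v i * v j * (wt x * D i j x))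
          = (\<Sum>i<n. \<Sum>x\<in>cube n. \<Sum>j<n. v i * v j * (wt x * D i j x))"
        by (intro sum.cong refl sum.swap)
      also have "\<dots> = (\<Sum>x\<in>cube n. \<Sum>i<n. \<Sum>j<n. v i * v j * (wt x * D i j x))"
        by (rule sum.swap)
      finally show ?thesis by (simp add: sum_distrib_left mult_ac)
    qed
    also have "\<dots> \<le> (\<Sum>x\<in>cube n. wt x * 6)"
    proof (intro sum_mono mult_left_mono)
      fix x assume x: "x \<in> cube n"
      \<comment> \<open>Replacing the response by its linear part makes the off-diagonal sum minus a
        value of the quadratic form, which is at most zero. The diagonal correction and the entries
        of \<open>D\<close> cost \<open>2\<close> in total, the Taylor errors \<open>4\<close> by
        the column bounds on \<open>W\<close>; this is the \<open>6\<close> above.\<close>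
      have "v i * v j * D i j x \<le> of_bool (i = j) * (2 / n) - W i j * (v i * s i x) * (v j * s j x) + 4 / n * (W i j)\<^sup>2"
        if ij: "i < n" "j < n" for i j
      proof (cases "i = j")
        case True
        have "s i x + W i i * (s i x * s i x) \<le> 1 + 1 * (1 * 1)"
          using s[of i x] Wkk[OF ij(1)] by (intro add_mono mult_mono) auto
        then have "(s i x + W i i * (s i x * s i x)) / n \<le> 2 / n" by (intro divide_right_mono) auto
        then have bnd: "s i x / n + W i i * (s i x * s i x) / n \<le> 2 / n" by (simp only: add_divide_distrib)
        have vv: "v i * v i = 1 / n" using v2[OF ij(1)] by (simp add: power2_eq_square)
        have "W i j * (v i * s i x) * (v j * s j x) = W i i * (s i x * s i x) * (v i * v i)"
          using True by simp
        then have "W i j * (v i * s i x) * (v j * s j x) = W i i * (s i x * s i x) / n"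
          unfolding vv by simp
        moreover have "v i * v j * D i j x = s i x / n" using True vv by (simp add: D_def)
        moreover have "of_bool (i = j) * (2 / real n) = 2 / real n" using True by simp
        moreover have "0 \<le> 4 / real n * (W i j)\<^sup>2" by simp
        ultimately show ?thesis using bnd by linarith
      next
        case False
        have "v i * v j * D i j x + W i j * (v i * s i x) * (v j * s j x)
            = - (v i * v j * s i x) * (\<beta> i j x - W i j * s j x)"
          using False by (simp add: D_def algebra_simps)
        also have "\<dots> \<le> \<bar>v i * v j * s i x\<bar> * \<bar>\<beta> i j x - W i j * s j x\<bar>"
          using abs_ge_self[of "- (v i * v j * s i x) * (\<beta> i j x - W i j * s j x)"] by (simp add: abs_mult)
        also have "\<dots> \<le> 1 / n * (4 * (W i j)\<^sup>2)"
        proof (rule mult_mono)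
          have "\<bar>v i * v j * s i x\<bar> = 1 / n * s i x"
            using v ij s[of i x] by (simp add: abs_mult real_sqrt_mult_self)
          also have "\<dots> \<le> 1 / n * 1" using s[of i x] by (intro mult_left_mono) auto
          finally show "\<bar>v i * v j * s i x\<bar> \<le> 1 / n" by simp
          show "\<bar>\<beta> i j x - W i j * s j x\<bar> \<le> 4 * (W i j)\<^sup>2"
            unfolding \<beta>_def s_def by (rule spin_response[OF x ij False])
        qed auto
        finally show ?thesis using False by simp
      qed
      then have "(\<Sum>i<n. \<Sum>j<n. v i * v j * D i j x)
          \<le> (\<Sum>i<n. \<Sum>j<n. of_bool (i = j) * (2 / n) - W i j * (v i * s i x) * (v j * s j x) + 4 / n * (W i j)\<^sup>2)"
        by (intro sum_mono) auto
      also have "\<dots> = (\<Sum>i<n. \<Sum>j<n. of_bool (i = j) * (2 / n)) - bil n W (\<lambda>i. v i * s i x) (\<lambda>i. v i * s i x)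
          + 4 / n * (\<Sum>i<n. \<Sum>j<n. (W i j)\<^sup>2)"
        by (simp add: sum.distrib sum_subtractf bil_def sum_distrib_left)
      also have "\<dots> \<le> 2 - 0 + 4 / n * n"
      proof (intro add_mono diff_mono mult_left_mono)
        have "(\<Sum>j<n. of_bool (i = j) * (2 / real n)) = 2 / n" if "i < n" for i
          using that by (subst sum.remove[of _ i]) auto
        then show "(\<Sum>i<n. \<Sum>j<n. of_bool (i = j) * (2 / real n)) \<le> 2" by simp
        show "0 \<le> bil n W (\<lambda>i. v i * s i x) (\<lambda>i. v i * s i x)" using W by (simp add: psd_def)
        have "(\<Sum>i<n. \<Sum>j<n. (W i j)\<^sup>2) = (\<Sum>j<n. \<Sum>i<n. (W i j)\<^sup>2)" by (rule sum.swap)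
        also have "\<dots> \<le> (\<Sum>j<n. 1)" using Wcol by (intro sum_mono) auto
        finally show "(\<Sum>i<n. \<Sum>j<n. (W i j)\<^sup>2) \<le> n" by simp
      qed auto
      finally show "(\<Sum>i<n. \<Sum>j<n. v i * v j * D i j x) \<le> 6" using n by simp
    qed (use wt_pos in \<open>auto intro: less_imp_le\<close>)
    finally show ?thesis by (simp add: N_def sum_distrib_left mult.commute)
  qed
  have V0: "0 \<le> wvar (cube n) wt (lin n v)" using wt_pos by (intro wvar_nonneg) (auto intro: less_imp_le)
  have "(c * N)\<^sup>2 \<le> (\<Sum>x\<in>cube n. wt x * (lin n v x * g x))\<^sup>2"
    using cov N by (intro power_mono) (auto simp: c_def)
  also have "\<dots> \<le> wvar (cube n) wt (lin n v) * (\<Sum>x\<in>cube n. wt x * (g x)\<^sup>2)"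
    by (rule wvar_lower_bound) (use wt_pos N g0 in \<open>auto simp: N_def intro: less_imp_le\<close>)
  also have "\<dots> \<le> wvar (cube n) wt (lin n v) * (6 * N)" using g2 V0 by (intro mult_left_mono)
  finally have "N * (c\<^sup>2 * N) \<le> N * (6 * wvar (cube n) wt (lin n v))" by (simp add: power2_eq_square mult_ac)
  then have "c\<^sup>2 * N \<le> 6 * wvar (cube n) wt (lin n v)" using N by (simp only: mult_le_cancel_left_pos)
  moreover have "c\<^sup>2 = exp (- 4 * (2 + K))" by (simp add: c_def exp_double[symmetric])
  ultimately show ?thesis by (simp add: N_def)
qed

end

section \<open>Tilting along the outlier direction\<close>

lemma card_cube_le: "card (cube n) \<le> 2 ^ n"
proof -
  let ?L = "{xs::real list. set xs \<subseteq> {-1, 1} \<and> length xs = n}"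
  have "cube n \<subseteq> vec_of_list ` ?L"
  proof
    fix x assume x: "x \<in> cube n"
    have "list_of_vec x \<in> ?L"
      using x by (auto simp: cube_def set_list_of_vec vec_set_def)
    moreover have "x = vec_of_list (list_of_vec x)" by (simp add: vec_list)
    ultimately show "x \<in> vec_of_list ` ?L" by blast
  qed
  moreover have fin: "finite ?L" by (intro finite_lists_length_eq) auto
  ultimately have "card (cube n) \<le> card ?L"
    by (meson card_image_le card_mono finite_imageI le_trans)
  also have "\<dots> = 2 ^ n" by (subst card_lists_length_eq) (auto simp: numeral_2_eq_2)
  finally show ?thesis .
qed

lemma cube_neg_bij: "bij_betw uminus (cube n) (cube n)"
  by (rule bij_betwI[where g = uminus]) (auto simp: cube_def)

text \<open>The threshold for \<open>lam\<close> is the inverse of the variance bound \<open>wvar_magnetization_ge\<close> for external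
  fields of size \<open>K = 3\<close>; beyond that size convexity of the free energy takes over.\<close>

locale outlier =
  fixes n :: nat and W :: "nat \<Rightarrow> nat \<Rightarrow> real" and v :: "nat \<Rightarrow> real" and lam q :: real
  assumes n: "0 < n" and W: "psd n W" and q: "0 \<le> q" "q < 1"
    and Wq: "\<And>c. bil n W c c \<le> q * (\<Sum>i<n. (c i)\<^sup>2)"
    and v: "\<And>i. i < n \<Longrightarrow> \<bar>v i\<bar> = 1 / sqrt (real n)"
    and lam: "6 * exp 20 \<le> lam"
begin

abbreviation "M \<equiv> lin n v"

definition w :: "real \<Rightarrow> real Matrix.vec \<Rightarrow> real" where
  "w r x = exp (1/2 * bil n W (($) x) (($) x) + r * M x)"

definition Z :: "real \<Rightarrow> real" where "Z r = (\<Sum>x\<in>cube n. w r x)"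

abbreviation "avg r g \<equiv> wmean (cube n) (w r) g"
abbreviation "var r g \<equiv> wvar (cube n) (w r) g"

lemma lam_pos: "0 < lam"
  by (rule less_le_trans[OF _ lam]) simp

lemma W1: "bil n W c c \<le> (\<Sum>i<n. (c i)\<^sup>2)"
proof -
  have "q * (\<Sum>i<n. (c i)\<^sup>2) \<le> 1 * (\<Sum>i<n. (c i)\<^sup>2)" using q by (intro mult_right_mono sum_nonneg) auto
  then show ?thesis using Wq[of c] by simp
qed

lemma v_sq:
  assumes "i < n"
  shows "(v i)\<^sup>2 = 1 / real n"
proof -
  have "\<bar>v i\<bar>\<^sup>2 = 1 / real n"
    unfolding v[OF assms] by (simp add: power_divide)
  then show ?thesis by simp
qed

lemma w_pos: "0 < w r x"
  by (simp add: w_def)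

lemma Z_pos: "0 < Z r"
  unfolding Z_def using w_pos finite_cube cube_nonempty by (intro sum_pos) auto

lemma var_nonneg: "0 \<le> var r g"
  using w_pos by (intro wvar_nonneg) (auto intro: less_imp_le)

lemma w_tilted: "w r = tilted_ising.wt n W (\<lambda>i. r * v i)"
proof -
  interpret tilted_ising n W "\<lambda>i. r * v i" by unfold_locales (rule W)
  show ?thesis by (simp add: fun_eq_iff w_def wt_def lin_def sum_distrib_left mult_ac)
qed

lemma M_sq_le: "x \<in> cube n \<Longrightarrow> (M x)\<^sup>2 \<le> n"
proof -
  assume x: "x \<in> cube n"
  have "(M x)\<^sup>2 \<le> (\<Sum>i<n. (v i)\<^sup>2) * (\<Sum>i<n. (x $ i)\<^sup>2)"
    unfolding lin_def by (rule Cauchy_Schwarz_ineq_sum)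
  also have "\<dots> = n" using x n by (simp add: v_sq cube_sq)
  finally show ?thesis .
qed

lemma abs_M_le: "x \<in> cube n \<Longrightarrow> \<bar>M x\<bar> \<le> sqrt n"
  using real_sqrt_le_mono[OF M_sq_le] by simp

lemma poincare: "var r g \<le> 2 / (1 - q) * dirichlet n (w r) g"
proof -
  have "w r = (\<lambda>x. exp (1/2 * bil n W (($) x) (($) x) + lin n (\<lambda>i. r * v i) x))"
    by (simp add: fun_eq_iff w_def lin_def sum_distrib_left mult_ac)
  then show ?thesis using ising_poincare[OF W q Wq, where h = "\<lambda>i. r * v i" and g = g] by (simp only:)
qed

lemma w_deriv: "((\<lambda>r. w r x) has_real_derivative w r x * M x) (at r)"
  unfolding w_def by (auto intro!: derivative_eq_intros)

lemma sum_w_deriv: "((\<lambda>r. \<Sum>x\<in>cube n. w r x * g x) has_real_derivative (\<Sum>x\<in>cube n. w r x * M x * g x)) (at r)"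
  by (auto intro!: derivative_eq_intros w_deriv)

lemma Z_deriv: "(Z has_real_derivative Z r * avg r M) (at r)"
proof -
  have "Z r * avg r M = (\<Sum>x\<in>cube n. w r x * M x)"
    using Z_pos[of r] by (simp add: wmean_def Z_def)
  then show ?thesis using sum_w_deriv[of "\<lambda>_. 1" r] by (simp add: Z_def[abs_def])
qed

definition avg' :: "real \<Rightarrow> (real Matrix.vec \<Rightarrow> real) \<Rightarrow> real" where
  "avg' r g = (\<Sum>x\<in>cube n. w r x * ((M x - avg r M) * (g x - avg r g))) / Z r"

lemma avg_deriv: "((\<lambda>r. avg r g) has_real_derivative avg' r g) (at r)"
proof -
  let ?S = "\<lambda>g. \<Sum>x\<in>cube n. w r x * g x"
  have "((\<lambda>r. (\<Sum>x\<in>cube n. w r x * g x) / Z r) has_real_derivative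
      ((\<Sum>x\<in>cube n. w r x * M x * g x) * Z r - ?S g * (Z r * avg r M)) / (Z r * Z r)) (at r)"
    by (rule DERIV_divide[OF sum_w_deriv Z_deriv]) (use Z_pos[of r] in simp)
  moreover have "((\<Sum>x\<in>cube n. w r x * M x * g x) * Z r - ?S g * (Z r * avg r M)) / (Z r * Z r) = avg' r g"
  proof -
    have g: "?S g = Z r * avg r g" using Z_pos[of r] by (simp add: wmean_def Z_def)
    have m: "?S M = Z r * avg r M" using Z_pos[of r] by (simp add: wmean_def Z_def)
    have "(\<Sum>x\<in>cube n. w r x * ((M x - avg r M) * (g x - avg r g)))
        = (\<Sum>x\<in>cube n. w r x * M x * g x - avg r g * (w r x * M x) - avg r M * (w r x * g x) + avg r M * avg r g * w r x)"
      by (intro sum.cong refl) (simp add: algebra_simps)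
    also have "\<dots> = (\<Sum>x\<in>cube n. w r x * M x * g x) - avg r g * ?S M - avg r M * ?S g + avg r M * avg r g * Z r"
      by (simp add: sum.distrib sum_subtractf sum_distrib_left Z_def)
    finally have cov: "(\<Sum>x\<in>cube n. w r x * ((M x - avg r M) * (g x - avg r g)))
        = (\<Sum>x\<in>cube n. w r x * M x * g x) - Z r * (avg r g * avg r M)"
      unfolding g m by simp
    show ?thesis using Z_pos[of r] unfolding avg'_def cov g m by (simp add: field_simps)
  qed
  ultimately show ?thesis by (simp add: wmean_def Z_def)
qed

lemma avg'_M: "avg' r M = var r M / Z r"
  by (simp add: avg'_def wvar_def power2_eq_square)

text \<open>The derivative of \<open>avg\<close> is a covariance with \<open>M\<close>, and
  \<open>M\<^sup>2 \<le> n\<close>. After integration over \<open>r\<close> this is the slow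
  variation of the conditional mean.\<close>

lemma avg'_sq_le: "Z r * (avg' r g)\<^sup>2 \<le> n * var r g"
proof -
  have "(\<Sum>x\<in>cube n. w r x * ((M x - avg r M) * (g x - avg r g)))\<^sup>2 \<le> var r M * var r g"
    unfolding wvar_def by (rule weighted_cauchy_schwarz) (use w_pos in \<open>auto intro: less_imp_le\<close>)
  also have "\<dots> \<le> (n * Z r) * var r g"
  proof (rule mult_right_mono[OF _ var_nonneg])
    have "var r M \<le> (\<Sum>x\<in>cube n. w r x * (M x - 0)\<^sup>2)"
      by (rule wvar_le_sum_sq) (use Z_pos[of r] in \<open>simp add: Z_def\<close>)
    also have "\<dots> \<le> (\<Sum>x\<in>cube n. w r x * n)"
      using w_pos M_sq_le by (intro sum_mono mult_left_mono) (auto intro: less_imp_le)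
    finally show "var r M \<le> n * Z r" by (simp add: Z_def sum_distrib_left mult.commute)
  qed
  finally have "(Z r * avg' r g)\<^sup>2 \<le> (n * Z r) * var r g"
    using Z_pos[of r] by (simp add: avg'_def)
  then have "Z r * (Z r * (avg' r g)\<^sup>2) \<le> Z r * (n * var r g)"
    by (simp add: power2_eq_square mult_ac)
  then show ?thesis using Z_pos[of r] by (simp only: mult_le_cancel_left_pos)
qed

lemma avg_M_0: "avg 0 M = 0"
proof -
  have "(\<Sum>x\<in>cube n. w 0 x * M x) = (\<Sum>x\<in>cube n. w 0 (- x) * M (- x))"
    by (rule sum.reindex_bij_betw[OF cube_neg_bij, symmetric])
  also have "\<dots> = - (\<Sum>x\<in>cube n. w 0 x * M x)"
    unfolding sum_negf[symmetric]
    by (intro sum.cong refl) (simp add: w_def bil_def lin_def cube_dim sum_negf)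
  finally show ?thesis by (simp add: wmean_def)
qed

lemma avg_M_mono: "r \<le> s \<Longrightarrow> avg r M \<le> avg s M"
proof (rule DERIV_nonneg_imp_nondecreasing[of r s "\<lambda>r. avg r M"])
  fix t
  have "0 \<le> avg' t M" unfolding avg'_M by (rule divide_nonneg_pos[OF var_nonneg Z_pos])
  then show "\<exists>y. ((\<lambda>r. avg r M) has_real_derivative y) (at t) \<and> 0 \<le> y"
    using avg_deriv by blast
qed

lemma avg_M_ge_linear:
  assumes "0 \<le> r" "r \<le> 3 * sqrt n"
  shows "exp (- 20) / 6 * r \<le> avg r M"
proof -
  have "avg 0 M - exp (- 20) / 6 * 0 \<le> avg r M - exp (- 20) / 6 * r"
  proof (rule DERIV_nonneg_imp_nondecreasing[OF assms(1)])
    fix s assume s: "0 \<le> s" "s \<le> r"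
    interpret tilted_ising n W "\<lambda>i. s * v i" by unfold_locales (rule W)
    have sv: "\<bar>s * v i\<bar> \<le> 3" if "i < n" for i
    proof -
      have "s * \<bar>v i\<bar> \<le> 3 * sqrt n * \<bar>v i\<bar>" using s assms by (intro mult_right_mono) auto
      then show ?thesis using n s v[OF that] by (simp add: abs_mult)
    qed
    \<comment> \<open>External fields up to \<open>3\<close> give the exponent \<open>- 20\<close>,
      the source of \<open>6 * exp 20\<close> in the threshold.\<close>
    have "exp (- 4 * (2 + 3)) / 6 * (\<Sum>x\<in>cube n. wt x) \<le> wvar (cube n) wt M"
      by (rule wvar_magnetization_ge[OF n W1 v sv])
    then have "exp (- 20) / 6 \<le> avg' s M"
      using Z_pos[of s] by (simp add: w_tilted[symmetric] Z_def avg'_M field_simps)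
    then show "\<exists>y. ((\<lambda>r. avg r M - exp (- 20) / 6 * r) has_real_derivative y) (at s) \<and> 0 \<le> y"
      using DERIV_diff[OF avg_deriv[of M s] DERIV_cmult_Id[of "exp (- 20) / 6"]] by (intro exI conjI) auto
  qed
  then show ?thesis by (simp add: avg_M_0)
qed

text \<open>\<open>ln Z\<close> is convex, so its slope at \<open>r\<close> is at least that of the
  chord from \<open>0\<close>. The configuration aligned with \<open>v\<close> gives
  \<open>ln (Z r) \<ge> r * sqrt n\<close>, while counting gives
  \<open>ln (Z 0) \<le> 6/5 * n\<close>, at most two fifths of \<open>r * sqrt n\<close> in this
  range.\<close>

lemma avg_M_ge_const:
  assumes "3 * sqrt n \<le> r"
  shows "sqrt n / 2 \<le> avg r M"
proof -
  have r: "0 < r" by (rule less_le_trans[OF _ assms]) (use n in simp)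
  have deriv: "((\<lambda>r. ln (Z r)) has_real_derivative avg s M) (at s)" for s
  proof -
    have "inverse (Z s) * (Z s * avg s M) = avg s M" using Z_pos[of s] by simp
    then show ?thesis using DERIV_chain2[OF DERIV_ln[OF Z_pos] Z_deriv, of s] by (simp only:)
  qed
  obtain z where z: "0 < z" "z < r" "ln (Z r) - ln (Z 0) = (r - 0) * avg z M"
    using MVT2[OF r, of "\<lambda>r. ln (Z r)" "\<lambda>r. avg r M", OF deriv] by blast
  then have up: "ln (Z r) - ln (Z 0) \<le> r * avg r M"
    using r avg_M_mono[of z r] by simp
  have lo: "r * sqrt n \<le> ln (Z r)"
  proof -
    define x where "x = Matrix.vec n (\<lambda>i. sqrt n * v i)"
    have "sqrt n * v i = 1 \<or> sqrt n * v i = -1" if "i < n" for i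
    proof -
      have "\<bar>sqrt n * v i\<bar> = 1" using v[OF that] n by (simp add: abs_mult)
      then show ?thesis by linarith
    qed
    then have x: "x \<in> cube n" by (auto simp: cube_def x_def)
    have "M x = (\<Sum>i<n. sqrt n * (v i)\<^sup>2)"
      by (simp add: lin_def x_def power2_eq_square mult_ac)
    also have "\<dots> = sqrt n" using n by (simp add: v_sq)
    finally have Mx: "M x = sqrt n" .
    have "exp (r * sqrt n) \<le> w r x" using W by (simp add: w_def Mx psd_def)
    also have "\<dots> \<le> Z r"
      unfolding Z_def using x finite_cube w_pos by (intro member_le_sum) (auto intro: less_imp_le)
    finally show ?thesis using Z_pos[of r] by (simp add: ln_ge_iff)
  qed
  have hi: "ln (Z 0) \<le> 6 / 5 * n"
  proof -
    have "Z 0 \<le> (\<Sum>x\<in>cube n. exp (n / 2))"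
      unfolding Z_def
    proof (rule sum_mono)
      fix x assume "x \<in> cube n"
      then show "w 0 x \<le> exp (n / 2)" using W1[of "($) x"] by (simp add: w_def cube_sq)
    qed
    also have "\<dots> = card (cube n) * exp (n / 2)" by simp
    also have "\<dots> \<le> 2 ^ n * exp (n / 2)"
      using of_nat_mono[OF card_cube_le[of n], where 'a = real] by (intro mult_right_mono) auto
    finally have "ln (Z 0) \<le> ln (2 ^ n * exp (n / 2))" by (subst ln_le_cancel_iff[OF Z_pos]) auto
    also have "\<dots> = n * ln 2 + n / 2" by (simp add: ln_mult ln_realpow)
    also have "\<dots> \<le> n * (7 / 10) + n / 2" using ln2_le_25_over_36 by (intro add_mono mult_left_mono) auto
    finally show ?thesis by (simp add: field_simps)
  qed
  have "6 / 5 * n \<le> 2 / 5 * (r * sqrt n)"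
    using mult_right_mono[OF assms, of "sqrt n"] by (simp add: mult.assoc)
  then have "r * (sqrt n / 2) \<le> r * sqrt n - 6 / 5 * n" using r n by simp
  also have "\<dots> \<le> r * avg r M" using up lo hi by simp
  finally show ?thesis using r by simp
qed

text \<open>\<open>avg r M - r / lam\<close> is the logarithmic derivative of
  \<open>\<gamma> * Z\<close>, so this is its monotonicity. Small \<open>r\<close> use the slope
  \<open>exp (- 20) / 6 \<ge> 1 / lam\<close>; for the others \<open>r / lam\<close> stays below
  \<open>sqrt n / 2\<close>.\<close>

lemma avg_M_ge:
  assumes "0 \<le> r" "r \<le> lam * sqrt n / 2"
  shows "r / lam \<le> avg r M"
proof (cases "r \<le> 3 * sqrt n")
  case True
  have "1 / lam \<le> 1 / (6 * exp 20)" by (rule divide_left_mono[OF lam]) (use lam_pos in simp_all)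
  also have "\<dots> = exp (- 20) / 6" by (simp add: exp_minus field_simps)
  finally have "1 / lam * r \<le> exp (- 20) / 6 * r" by (rule mult_right_mono) (rule assms(1))
  then show ?thesis using avg_M_ge_linear[OF assms(1) True] by (simp only: times_divide_eq_left mult_1)
next
  case False
  then have "sqrt n / 2 \<le> avg r M" by (intro avg_M_ge_const) simp
  moreover have "r / lam \<le> lam * sqrt n / 2 / lam" using assms(2) lam_pos by (intro divide_right_mono) auto
  then have "r / lam \<le> sqrt n / 2" using lam_pos by simp
  ultimately show ?thesis by linarith
qed

end

lemma (in outlier) flipped: "outlier n W (\<lambda>i. - v i) lam q"
  using outlier.intro[OF n W q Wq _ lam, of "\<lambda>i. - v i"] v by simp

section \<open>A one-dimensional Hardy-type inequality\<close>

text \<open>A density that increases on \<open>[0, 2a]\<close> cannot leave the mass of a slowly varying \<open>A\<^sup>2\<close>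
  concentrated on \<open>[0, a]\<close>: integrate the derivative of \<open>A\<^sup>2\<close> times the density times the tent
  function with peak at \<open>a\<close>.\<close>

lemma tent_inequality:
  fixes A A' om om' :: "real \<Rightarrow> real"
  assumes a: "0 < a" and \<tau>: "0 < \<tau>"
    and dA: "\<And>r. (A has_real_derivative A' r) (at r)"
    and dom: "\<And>r. (om has_real_derivative om' r) (at r)"
    and cA': "continuous_on UNIV A'"
    and om: "\<And>r. 0 \<le> om r" and om': "\<And>r. 0 \<le> r \<Longrightarrow> r \<le> 2 * a \<Longrightarrow> 0 \<le> om' r"
  shows "integral {0..a} (\<lambda>r. om r * (A r)\<^sup>2) \<le> integral {a..2*a} (\<lambda>r. om r * (A r)\<^sup>2)
    + a * integral {0..2*a} (\<lambda>r. om r * (\<tau> * (A r)\<^sup>2 + (A' r)\<^sup>2 / \<tau>))"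
proof -
  define F where "F = (\<lambda>r. om r * (A r)\<^sup>2)"
  define G where "G = (\<lambda>r. om r * (\<tau> * (A r)\<^sup>2 + (A' r)\<^sup>2 / \<tau>))"
  define H where "H = (\<lambda>r. om' r * (A r)\<^sup>2 + om r * (2 * A r * A' r))"
  have cA: "continuous_on X A" and com: "continuous_on X om" for X
    by (intro continuous_at_imp_continuous_on ballI DERIV_isCont[OF dA] DERIV_isCont[OF dom])+
  have cA'2: "continuous_on X A'" for X using cA' continuous_on_subset by blast
  have cF: "continuous_on X F" and cG: "continuous_on X G" for X
    unfolding F_def G_def using \<tau> by (auto intro!: continuous_intros cA com cA'2)
  have iF: "F integrable_on {s..t}" and iG: "G integrable_on {s..t}" for s t
    by (auto intro!: integrable_continuous_real cF cG)
  have dF: "(F has_real_derivative H r) (at r)" for r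
    unfolding F_def H_def by (auto intro!: derivative_eq_intros dA dom)
  have G0: "0 \<le> G r" for r unfolding G_def using om \<tau> by auto
  \<comment> \<open>The term of \<open>H\<close> containing \<open>A'\<close> has no sign and is
    absorbed into \<open>G\<close>. The term containing \<open>om'\<close> has a favourable sign on
    both sides of the tent.\<close>
  have young: "- (c * (om r * (2 * A r * A' r))) \<le> a * G r" if "0 \<le> c" "c \<le> a" for c r
  proof -
    have "0 \<le> (sqrt \<tau> * A r + A' r / sqrt \<tau>)\<^sup>2" by simp
    also have "\<dots> = \<tau> * (A r)\<^sup>2 + (A' r)\<^sup>2 / \<tau> + 2 * A r * A' r"
      using \<tau> by (simp add: power2_sum power_mult_distrib power_divide)
    finally have "om r * - (2 * A r * A' r) \<le> G r"
      unfolding G_def using om by (intro mult_left_mono) auto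
    then have "c * (om r * - (2 * A r * A' r)) \<le> c * G r" using that by (intro mult_left_mono) auto
    also have "\<dots> \<le> a * G r" using that G0 by (intro mult_right_mono) auto
    finally show ?thesis by simp
  qed
  have ftc: "(f' has_integral (f t - f s)) {s..t}"
    if "s \<le> t" "\<And>r. (f has_real_derivative f' r) (at r)" for f f' :: "real \<Rightarrow> real" and s t
    using that by (intro fundamental_theorem_of_calculus)
      (simp_all add: has_real_derivative_iff_has_vector_derivative has_vector_derivative_at_within)
  \<comment> \<open>The rising side \<open>r\<close> on \<open>[0, a]\<close> and the falling side
    \<open>2 * a - r\<close> on \<open>[a, 2 * a]\<close> share the boundary value
    \<open>a * F a\<close>, which links the two integrals.\<close>
  have d1: "((\<lambda>r. r * F r) has_real_derivative (F r + r * H r)) (at r)" for r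
    using DERIV_mult[OF DERIV_ident dF, of r] by (simp add: add.commute mult.commute)
  have "((\<lambda>r. F r + r * H r) has_integral (a * F a - 0 * F 0)) {0..a}"
    using ftc[OF _ d1, of 0 a] a by simp
  then have h1: "((\<lambda>r. F r + r * H r + a * G r) has_integral (a * F a + a * integral {0..a} G)) {0..a}"
    using has_integral_add[OF _ has_integral_mult_right[OF integrable_integral[OF iG]], of _ "a * F a" 0 a a] by simp
  have 1: "integral {0..a} F \<le> a * F a + a * integral {0..a} G"
  proof (rule has_integral_le[OF integrable_integral[OF iF] h1])
    fix r assume r: "r \<in> {0..a}"
    then have "0 \<le> r * (om' r * (A r)\<^sup>2)" using om' a by auto
    then show "F r \<le> F r + r * H r + a * G r" using young[of r r] r by (simp add: H_def algebra_simps)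
  qed
  have "((\<lambda>r. r - 2 * a) has_real_derivative 1) (at r)" for r
    by (auto intro!: derivative_eq_intros)
  from DERIV_mult[OF this dF]
  have d2: "((\<lambda>r. (r - 2 * a) * F r) has_real_derivative (F r - (2 * a - r) * H r)) (at r)" for r
    by (rule DERIV_cong) (simp add: algebra_simps)
  have h2: "((\<lambda>r. F r - (2 * a - r) * H r) has_integral a * F a) {a..2*a}"
    using ftc[OF _ d2, of a "2 * a"] a by (simp add: algebra_simps)
  have h3: "((\<lambda>r. F r + a * G r) has_integral (integral {a..2*a} F + a * integral {a..2*a} G)) {a..2*a}"
    by (intro has_integral_add has_integral_mult_right integrable_integral iF iG)
  have 2: "a * F a \<le> integral {a..2*a} F + a * integral {a..2*a} G"
  proof (rule has_integral_le[OF h2 h3])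
    fix r assume r: "r \<in> {a..2*a}"
    then have "0 \<le> (2 * a - r) * (om' r * (A r)\<^sup>2)" using om' a by auto
    then show "F r - (2 * a - r) * H r \<le> F r + a * G r"
      using young[of "2 * a - r" r] r by (simp add: H_def algebra_simps)
  qed
  have "integral {0..a} G + integral {a..2*a} G = integral {0..2*a} G"
    using a by (intro Henstock_Kurzweil_Integration.integral_combine iG) auto
  then have "a * integral {0..2*a} G = a * integral {0..a} G + a * integral {a..2*a} G"
    unfolding distrib_left[symmetric] by simp
  then show ?thesis using 1 2 unfolding F_def[symmetric] G_def[symmetric] by linarith
qed

section \<open>Gaussian decoupling of the outlier\<close>

lemma integrable_continuous_bound:
  fixes f g :: "real \<Rightarrow> real"
  assumes "continuous_on UNIV f" "integrable lborel g" "\<And>r. \<bar>f r\<bar> \<le> g r"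
  shows "integrable lborel f"
proof (rule Bochner_Integration.integrable_bound[OF assms(2)])
  show "f \<in> borel_measurable lborel"
    using borel_measurable_continuous_onI[OF assms(1)] by simp
  show "AE r in lborel. norm (f r) \<le> norm (g r)"
    using order_trans[OF assms(3) abs_ge_self] by (intro AE_I2) simp
qed

text \<open>The bound \<open>\<bar>r - m\<bar> \<le> (r - m)\<^sup>2 / (2 * s) + s / 2\<close>
  reduces the absolute moment to the variance.\<close>

lemma integral_normal_density_abs_le:
  assumes s: "0 < s"
  shows "integrable lborel (\<lambda>r. normal_density m s r * \<bar>r\<bar>)"
    and "(\<integral>r. normal_density m s r * \<bar>r\<bar> \<partial>lborel) \<le> \<bar>m\<bar> + s"
proof -
  let ?d = "normal_density m s"
  have sq: "has_bochner_integral lborel (\<lambda>r. ?d r * (r - m)\<^sup>2) (s\<^sup>2)"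
    using normal_moment_even[OF s, of m 1] by (simp add: power2_eq_square)
  have one: "has_bochner_integral lborel ?d 1"
    by (simp add: has_bochner_integral_iff s)
  have dom: "has_bochner_integral lborel (\<lambda>r. ?d r * (r - m)\<^sup>2 / (2 * s) + ?d r * (s / 2 + \<bar>m\<bar>)) (s\<^sup>2 / (2 * s) + 1 * (s / 2 + \<bar>m\<bar>))"
    by (intro has_bochner_integral_add has_bochner_integral_divide sq has_bochner_integral_mult_left one)
  have le: "?d r * \<bar>r\<bar> \<le> ?d r * (r - m)\<^sup>2 / (2 * s) + ?d r * (s / 2 + \<bar>m\<bar>)" for r
  proof -
    have "0 \<le> (\<bar>r - m\<bar> - s)\<^sup>2" by simp
    also have "\<dots> = (r - m)\<^sup>2 + s\<^sup>2 - 2 * s * \<bar>r - m\<bar>" by (simp add: power2_diff)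
    finally have "\<bar>r - m\<bar> \<le> (r - m)\<^sup>2 / (2 * s) + s / 2"
      using s by (simp add: field_simps power2_eq_square)
    then have "\<bar>r\<bar> \<le> (r - m)\<^sup>2 / (2 * s) + (s / 2 + \<bar>m\<bar>)" by linarith
    then have "?d r * \<bar>r\<bar> \<le> ?d r * ((r - m)\<^sup>2 / (2 * s) + (s / 2 + \<bar>m\<bar>))"
      by (intro mult_left_mono) auto
    then show ?thesis by (simp add: distrib_left)
  qed
  show int: "integrable lborel (\<lambda>r. ?d r * \<bar>r\<bar>)"
    by (rule Bochner_Integration.integrable_bound[OF integrable.intros[OF dom]], simp)
      (use order_trans[OF le abs_ge_self] in \<open>intro AE_I2, simp add: abs_mult\<close>)
  have "(\<integral>r. ?d r * \<bar>r\<bar> \<partial>lborel) \<le> s\<^sup>2 / (2 * s) + 1 * (s / 2 + \<bar>m\<bar>)"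
    using integral_mono[OF int integrable.intros[OF dom] le] has_bochner_integral_integral_eq[OF dom] by simp
  then show "(\<integral>r. ?d r * \<bar>r\<bar> \<partial>lborel) \<le> \<bar>m\<bar> + s" using s by (simp add: power2_eq_square)
qed

context outlier
begin

definition \<gamma> :: "real \<Rightarrow> real" where "\<gamma> = normal_density 0 (sqrt lam)"

definition Wt :: "real Matrix.vec \<Rightarrow> real" where
  "Wt x = exp (1/2 * bil n W (($) x) (($) x) + lam / 2 * (M x)\<^sup>2)"

lemma Wt_pos: "0 < Wt x"
  by (simp add: Wt_def)

lemma \<gamma>_pos: "0 < \<gamma> r"
  by (simp add: \<gamma>_def normal_density_pos lam_pos)

text \<open>Completing the square. The joint weight of \<open>r\<close> and \<open>x\<close> can be
  read both ways: given \<open>r\<close> it is the tilted weight, given \<open>x\<close> it is a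
  normal density around \<open>lam * M x\<close>.\<close>

lemma \<gamma>_w: "\<gamma> r * w r x = Wt x * normal_density (lam * M x) (sqrt lam) r"
proof -
  have "- r\<^sup>2 / (2 * lam) + r * m = lam / 2 * m\<^sup>2 + - (r - lam * m)\<^sup>2 / (2 * lam)" for m
    using lam_pos by (simp add: field_simps power2_eq_square)
  then have "exp (- r\<^sup>2 / (2 * lam)) * exp (r * M x) = exp (lam / 2 * (M x)\<^sup>2) * exp (- (r - lam * M x)\<^sup>2 / (2 * lam))"
    unfolding exp_add[symmetric] by simp
  then show ?thesis
    using lam_pos by (simp add: \<gamma>_def normal_density_def w_def Wt_def exp_add mult_ac)
qed

lemma integrable_\<gamma>_w: "integrable lborel (\<lambda>r. \<gamma> r * w r x)"
  unfolding \<gamma>_w using lam_pos by simp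

lemma integral_\<gamma>_w: "(\<integral>r. \<gamma> r * w r x \<partial>lborel) = Wt x"
  unfolding \<gamma>_w using lam_pos by simp

lemma integrable_\<gamma>_sum: "integrable lborel (\<lambda>r. \<gamma> r * (\<Sum>x\<in>cube n. w r x * g x))"
proof -
  have "integrable lborel (\<lambda>r. \<Sum>x\<in>cube n. \<gamma> r * w r x * g x)"
    by (intro Bochner_Integration.integrable_sum integrable_mult_left integrable_\<gamma>_w)
  then show ?thesis by (simp add: sum_distrib_left mult.assoc)
qed

lemma integral_\<gamma>_sum: "(\<integral>r. \<gamma> r * (\<Sum>x\<in>cube n. w r x * g x) \<partial>lborel) = (\<Sum>x\<in>cube n. Wt x * g x)"
proof -
  have "(\<integral>r. \<gamma> r * (\<Sum>x\<in>cube n. w r x * g x) \<partial>lborel) = (\<integral>r. (\<Sum>x\<in>cube n. \<gamma> r * w r x * g x) \<partial>lborel)"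
    by (simp add: sum_distrib_left mult.assoc)
  also have "\<dots> = (\<Sum>x\<in>cube n. \<integral>r. \<gamma> r * w r x * g x \<partial>lborel)"
    by (intro Bochner_Integration.integral_sum integrable_mult_left integrable_\<gamma>_w)
  also have "\<dots> = (\<Sum>x\<in>cube n. Wt x * g x)"
    by (intro sum.cong refl, subst integral_mult_left_zero) (simp add: integral_\<gamma>_w)
  finally show ?thesis .
qed

lemma cont_w: "continuous_on X (\<lambda>r. w r x)"
  unfolding w_def by (intro continuous_intros)

lemma cont_Z: "continuous_on X Z"
  unfolding Z_def[abs_def] by (intro continuous_intros cont_w)

lemma cont_\<gamma>: "continuous_on X \<gamma>"
  unfolding \<gamma>_def normal_density_def[abs_def] using lam_pos by (intro continuous_intros) auto

lemma cont_avg: "continuous_on X (\<lambda>r. avg r g)"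
  unfolding wmean_def Z_def[symmetric] using Z_pos by (intro continuous_intros cont_w cont_Z) (auto simp: less_imp_neq[symmetric])

lemma cont_avg': "continuous_on X (\<lambda>r. avg' r g)"
  unfolding avg'_def using Z_pos by (intro continuous_intros cont_w cont_Z cont_avg) (auto simp: less_imp_neq[symmetric])

lemma cont_var: "continuous_on X (\<lambda>r. var r g)"
  unfolding wvar_def by (intro continuous_intros cont_w cont_avg)

lemma cont_conductance: "continuous_on X (\<lambda>r. conductance (w r x) (w r y))"
proof -
  have "w r x + w r y \<noteq> 0" for r using w_pos[of r x] w_pos[of r y] by linarith
  then show ?thesis unfolding conductance_def by (intro continuous_intros cont_w) auto
qed

lemma conductance_le_left:
  assumes "0 < a" "0 < b" shows "conductance a b \<le> a"
  using assms by (simp add: conductance_def divide_le_eq algebra_simps)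

lemma integrable_\<gamma>_conductance: "integrable lborel (\<lambda>r. \<gamma> r * conductance (w r x) (w r y))"
proof (rule integrable_continuous_bound[OF _ integrable_\<gamma>_w[of x]])
  show "continuous_on UNIV (\<lambda>r. \<gamma> r * conductance (w r x) (w r y))"
    by (intro continuous_intros cont_\<gamma> cont_conductance)
  show "\<bar>\<gamma> r * conductance (w r x) (w r y)\<bar> \<le> \<gamma> r * w r x" for r
    using conductance_le_left[OF w_pos w_pos, of r x r y] conductance_nonneg[of "w r x" "w r y"] w_pos[of r x] w_pos[of r y] \<gamma>_pos[of r]
    by (simp add: abs_mult)
qed

text \<open>The continuous counterpart of \<open>conductance_avg\<close>, with
  \<open>\<theta>\<close> optimal for the integrated weights.\<close>

lemma integral_\<gamma>_conductance_le:
  "(\<integral>r. \<gamma> r * conductance (w r x) (w r y) \<partial>lborel) \<le> conductance (Wt x) (Wt y)"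
proof -
  define \<theta> where "\<theta> = Wt y / (Wt x + Wt y)"
  have "(\<integral>r. \<gamma> r * conductance (w r x) (w r y) \<partial>lborel)
      \<le> (\<integral>r. \<theta>\<^sup>2 * (\<gamma> r * w r x) + (1 - \<theta>)\<^sup>2 * (\<gamma> r * w r y) \<partial>lborel)"
  proof (rule integral_mono)
    fix r
    have "\<gamma> r * conductance (w r x) (w r y) \<le> \<gamma> r * (\<theta>\<^sup>2 * w r x + (1 - \<theta>)\<^sup>2 * w r y)"
      using \<gamma>_pos[of r] by (intro mult_left_mono conductance_le_linear w_pos) auto
    then show "\<gamma> r * conductance (w r x) (w r y) \<le> \<theta>\<^sup>2 * (\<gamma> r * w r x) + (1 - \<theta>)\<^sup>2 * (\<gamma> r * w r y)"
      by (simp add: algebra_simps)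
  qed (auto intro!: integrable_\<gamma>_conductance Bochner_Integration.integrable_add integrable_mult_right integrable_\<gamma>_w)
  also have "\<dots> = \<theta>\<^sup>2 * Wt x + (1 - \<theta>)\<^sup>2 * Wt y"
    by (subst Bochner_Integration.integral_add) (auto intro!: integrable_mult_right integrable_\<gamma>_w simp: integral_\<gamma>_w)
  also have "\<dots> = conductance (Wt x) (Wt y)"
    unfolding \<theta>_def by (rule conductance_eq_linear[symmetric]) (rule Wt_pos)+
  finally show ?thesis .
qed

lemma integrable_\<gamma>_dirichlet: "integrable lborel (\<lambda>r. \<gamma> r * dirichlet n (w r) g)"
  and integral_\<gamma>_dirichlet_le: "(\<integral>r. \<gamma> r * dirichlet n (w r) g \<partial>lborel) \<le> dirichlet n Wt g"
proof -
  have eq: "\<gamma> r * dirichlet n (w r) g = (\<Sum>i<n. \<Sum>x\<in>cube n. \<gamma> r * conductance (w r x) (w r (flip i x)) * (1/2 * (g x - g (flip i x))\<^sup>2))" for r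
    by (simp add: dirichlet_def sum_distrib_left mult_ac)
  show "integrable lborel (\<lambda>r. \<gamma> r * dirichlet n (w r) g)"
    unfolding eq by (intro Bochner_Integration.integrable_sum integrable_mult_left integrable_\<gamma>_conductance)
  have "(\<integral>r. \<gamma> r * dirichlet n (w r) g \<partial>lborel)
      = (\<Sum>i<n. \<Sum>x\<in>cube n. (\<integral>r. \<gamma> r * conductance (w r x) (w r (flip i x)) \<partial>lborel) * (1/2 * (g x - g (flip i x))\<^sup>2))"
    unfolding eq
    by (subst Bochner_Integration.integral_sum, intro Bochner_Integration.integrable_sum integrable_mult_left integrable_\<gamma>_conductance,
        intro sum.cong refl,
        subst Bochner_Integration.integral_sum, intro integrable_mult_left integrable_\<gamma>_conductance,
        intro sum.cong refl, rule integral_mult_left_zero)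
  also have "\<dots> \<le> (\<Sum>i<n. \<Sum>x\<in>cube n. conductance (Wt x) (Wt (flip i x)) * (1/2 * (g x - g (flip i x))\<^sup>2))"
    by (intro sum_mono mult_right_mono integral_\<gamma>_conductance_le) auto
  also have "\<dots> = dirichlet n Wt g"
    by (simp add: dirichlet_def sum_distrib_left mult_ac)
  finally show "(\<integral>r. \<gamma> r * dirichlet n (w r) g \<partial>lborel) \<le> dirichlet n Wt g" .
qed

lemma var_le: "var r g \<le> (\<Sum>x\<in>cube n. w r x * (g x)\<^sup>2)"
  using wvar_le_sum_sq[of "w r" "cube n" g 0] Z_pos[of r] by (simp add: Z_def)

lemma integrable_\<gamma>_var: "integrable lborel (\<lambda>r. \<gamma> r * var r g)"
proof (rule integrable_continuous_bound[OF _ integrable_\<gamma>_sum[of "\<lambda>x. (g x)\<^sup>2"]])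
  show "continuous_on UNIV (\<lambda>r. \<gamma> r * var r g)"
    by (intro continuous_intros cont_\<gamma> cont_var)
  show "\<bar>\<gamma> r * var r g\<bar> \<le> \<gamma> r * (\<Sum>x\<in>cube n. w r x * (g x)\<^sup>2)" for r
    using var_le[of r g] var_nonneg[of r g] \<gamma>_pos[of r] by (simp add: abs_mult)
qed

text \<open>Only the variance given \<open>r\<close> is controlled, since the Poincare constant is
  uniform in the tilt. The dependence of \<open>avg r g\<close> on \<open>r\<close> is left to the
  tent inequality.\<close>

lemma integral_\<gamma>_var_le: "(\<integral>r. \<gamma> r * var r g \<partial>lborel) \<le> 2 / (1 - q) * dirichlet n Wt g"
proof -
  have "(\<integral>r. \<gamma> r * var r g \<partial>lborel) \<le> (\<integral>r. 2 / (1 - q) * (\<gamma> r * dirichlet n (w r) g) \<partial>lborel)"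
  proof (intro integral_mono integrable_\<gamma>_var integrable_mult_right integrable_\<gamma>_dirichlet)
    show "\<gamma> r * var r g \<le> 2 / (1 - q) * (\<gamma> r * dirichlet n (w r) g)" for r
      using mult_left_mono[OF poincare[of r g], of "\<gamma> r"] \<gamma>_pos[of r] by (simp add: mult_ac)
  qed
  also have "\<dots> \<le> 2 / (1 - q) * dirichlet n Wt g"
    unfolding integral_mult_right_zero using q integral_\<gamma>_dirichlet_le by (intro mult_left_mono) auto
  finally show ?thesis .
qed

lemma \<gamma>_deriv: "(\<gamma> has_real_derivative - (r / lam) * \<gamma> r) (at r)"
proof -
  define c where "c = 1 / sqrt (2 * pi * lam)"
  have \<gamma>: "\<gamma> = (\<lambda>r. c * exp (- (r\<^sup>2 / (2 * lam))))"
    using lam_pos by (simp add: fun_eq_iff \<gamma>_def normal_density_def c_def)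
  have "((\<lambda>r. - (r\<^sup>2 / (2 * lam))) has_real_derivative - (2 * r / (2 * lam))) (at r)"
    using lam_pos by (auto intro!: derivative_eq_intros)
  then have "((\<lambda>r. c * exp (- (r\<^sup>2 / (2 * lam)))) has_real_derivative c * (exp (- (r\<^sup>2 / (2 * lam))) * - (2 * r / (2 * lam)))) (at r)"
    by (intro DERIV_cmult DERIV_chain2[OF DERIV_exp])
  then show ?thesis by (simp add: \<gamma> mult_ac)
qed

lemma \<gamma>_Z_deriv: "((\<lambda>r. \<gamma> r * Z r) has_real_derivative \<gamma> r * Z r * (avg r M - r / lam)) (at r)"
  by (rule derivative_eq_intros \<gamma>_deriv Z_deriv refl)+ (simp add: algebra_simps)

text \<open>The tent ends at \<open>2 * a = lam * sqrt n / 2\<close>, where the monotonicity from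
  \<open>avg_M_ge\<close> ends.\<close>

lemma half_line_tent:
  assumes \<tau>: "0 < \<tau>"
  defines "a \<equiv> lam * sqrt n / 4"
  shows "integral {0..a} (\<lambda>r. \<gamma> r * Z r * (avg r g)\<^sup>2) \<le> integral {a..2*a} (\<lambda>r. \<gamma> r * Z r * (avg r g)\<^sup>2)
    + a * integral {0..2*a} (\<lambda>r. \<gamma> r * Z r * (\<tau> * (avg r g)\<^sup>2 + (avg' r g)\<^sup>2 / \<tau>))"
proof (rule tent_inequality[OF _ \<tau> avg_deriv \<gamma>_Z_deriv cont_avg'])
  show "0 < a" using lam_pos n by (simp add: a_def)
  show "0 \<le> \<gamma> r * Z r" for r using \<gamma>_pos[of r] Z_pos[of r] by simp
  show "0 \<le> \<gamma> r * Z r * (avg r M - r / lam)" if "0 \<le> r" "r \<le> 2 * a" for r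
  proof -
    have "r / lam \<le> avg r M" using that by (intro avg_M_ge) (auto simp: a_def)
    then show ?thesis using \<gamma>_pos[of r] Z_pos[of r] by simp
  qed
qed

end

lemma integral_reflect_Icc:
  fixes f :: "real \<Rightarrow> real"
  shows "integral {s..t} (\<lambda>r. f (- r)) = integral {- t..- s} f"
  using Henstock_Kurzweil_Integration.integral_reflect_real[of t s "\<lambda>r. f (- r)"] by simp

context outlier
begin

text \<open>Replacing \<open>v\<close> by \<open>- v\<close> reflects \<open>r\<close>. A separate
  inequality is wanted because \<open>avg r g\<close> may have quite different sizes on the two half
  lines.\<close>

lemma negative_half_line_tent:
  assumes \<tau>: "0 < \<tau>"
  defines "a \<equiv> lam * sqrt n / 4"
  shows "integral {-a..0} (\<lambda>r. \<gamma> r * Z r * (avg r g)\<^sup>2) \<le> integral {-(2*a)..-a} (\<lambda>r. \<gamma> r * Z r * (avg r g)\<^sup>2)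
    + a * integral {-(2*a)..0} (\<lambda>r. \<gamma> r * Z r * (\<tau> * (avg r g)\<^sup>2 + (avg' r g)\<^sup>2 / \<tau>))"
proof -
  interpret f: outlier n W "\<lambda>i. - v i" lam q by (rule flipped)
  have M: "f.M x = - M x" for x by (simp add: lin_def sum_negf)
  have w: "f.w r = w (- r)" for r by (simp add: fun_eq_iff f.w_def w_def M)
  have Z: "f.Z r = Z (- r)" for r by (simp add: f.Z_def Z_def w)
  have avgM: "wmean (cube n) (f.w r) f.M = - avg (- r) M" for r
    by (simp add: wmean_def w M sum_negf)
  have avg': "f.avg' r g = - avg' (- r) g" for r
  proof -
    have "(\<Sum>x\<in>cube n. w (- r) x * ((- M x - - avg (- r) M) * (g x - avg (- r) g)))
        = - (\<Sum>x\<in>cube n. w (- r) x * ((M x - avg (- r) M) * (g x - avg (- r) g)))"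
      unfolding sum_negf[symmetric] by (intro sum.cong refl) (simp add: algebra_simps)
    then show ?thesis unfolding f.avg'_def avg'_def avgM unfolding w Z M by simp
  qed
  have \<gamma>: "\<gamma> (- r) = \<gamma> r" for r by (simp add: \<gamma>_def normal_density_def)
  show ?thesis
    using f.half_line_tent[OF \<tau>, of g]
      integral_reflect_Icc[of 0 a "\<lambda>r. \<gamma> r * Z r * (avg r g)\<^sup>2"]
      integral_reflect_Icc[of a "2 * a" "\<lambda>r. \<gamma> r * Z r * (avg r g)\<^sup>2"]
      integral_reflect_Icc[of 0 "2 * a" "\<lambda>r. \<gamma> r * Z r * (\<tau> * (avg r g)\<^sup>2 + (avg' r g)\<^sup>2 / \<tau>)"]
    unfolding w Z avg' \<gamma> a_def[symmetric] power2_minus by (simp only: minus_zero)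
qed

text \<open>\<open>m - \<eta>\<close> bounds the mixing mass from below and
  \<open>a * (\<tau> * m + n * \<eta> / \<tau>)\<close> is the tent error. At least half of the
  difference lies at \<open>\<bar>r\<bar> \<ge> a\<close>; Markov's inequality for
  \<open>\<bar>r\<bar>\<close>, whose mean given \<open>x\<close> is at most
  \<open>lam * \<bar>M x\<bar> + sqrt lam\<close>, transfers this to \<open>M\<close>.\<close>

lemma magnetization_lower_bound:
  fixes \<phi> :: "real Matrix.vec \<Rightarrow> real"
  assumes \<tau>: "0 < \<tau>"
  defines "a \<equiv> lam * sqrt n / 4" and "m \<equiv> (\<Sum>x\<in>cube n. Wt x * (\<phi> x)\<^sup>2)"
  defines "\<eta> \<equiv> 2 / (1 - q) * dirichlet n Wt \<phi>"
  shows "a / 2 * (m - \<eta> - a * (\<tau> * m + real n * \<eta> / \<tau>))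
    \<le> lam * (\<Sum>x\<in>cube n. Wt x * (\<phi> x)\<^sup>2 * \<bar>M x\<bar>) + sqrt lam * m"
proof -
  define F where "F = (\<lambda>r. \<gamma> r * Z r * (avg r \<phi>)\<^sup>2)"
  define G where "G = (\<lambda>r. \<gamma> r * Z r * (\<tau> * (avg r \<phi>)\<^sup>2 + (avg' r \<phi>)\<^sup>2 / \<tau>))"
  define Q where "Q = (\<lambda>r. \<gamma> r * (\<Sum>x\<in>cube n. w r x * (\<phi> x)\<^sup>2))"
  define V where "V = (\<lambda>r. \<gamma> r * var r \<phi>)"
  have a: "0 < a" using lam_pos n by (simp add: a_def)
  have \<gamma>Z: "0 < \<gamma> r * Z r" for r using \<gamma>_pos Z_pos by simp
  have intQ: "integrable lborel Q" and Qm: "(\<integral>r. Q r \<partial>lborel) = m"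
    unfolding Q_def m_def by (rule integrable_\<gamma>_sum integral_\<gamma>_sum)+
  have intV: "integrable lborel V" and V\<eta>: "(\<integral>r. V r \<partial>lborel) \<le> \<eta>"
    unfolding V_def \<eta>_def by (rule integrable_\<gamma>_var integral_\<gamma>_var_le)+
  \<comment> \<open>Given \<open>r\<close>: squared mean equals second moment minus
    variance.\<close>
  have FQV: "F r = Q r - V r" for r
    using wvar_eq[of "w r" "cube n" \<phi>] Z_pos[of r]
    by (simp add: F_def Q_def V_def Z_def[symmetric] right_diff_distrib)
  have F0: "0 \<le> F r" for r using \<gamma>Z[of r] by (simp add: F_def)
  have V0: "0 \<le> V r" for r using \<gamma>_pos[of r] var_nonneg[of r \<phi>] by (simp add: V_def)
  have intF: "integrable lborel F"
    using Bochner_Integration.integrable_diff[OF intQ intV] by (simp add: FQV[abs_def])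
  have Fm: "m - \<eta> \<le> (\<integral>r. F r \<partial>lborel)"
    using Bochner_Integration.integral_diff[OF intQ intV] V\<eta> by (simp add: FQV Qm)
  have cF: "continuous_on X F" and cG: "continuous_on X G" for X
    unfolding F_def G_def using \<tau> by (auto intro!: continuous_intros cont_\<gamma> cont_Z cont_avg cont_avg')
  have G0: "0 \<le> G r" for r using \<gamma>Z[of r] \<tau> by (simp add: G_def)
  have GQV: "G r \<le> \<tau> * Q r + n / \<tau> * V r" for r
  proof -
    have "\<gamma> r * (Z r * (avg' r \<phi>)\<^sup>2) \<le> \<gamma> r * (n * var r \<phi>)"
      using \<gamma>_pos[of r] by (intro mult_left_mono avg'_sq_le) auto
    then have "\<gamma> r * (Z r * (avg' r \<phi>)\<^sup>2) / \<tau> \<le> n * V r / \<tau>"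
      using \<tau> by (intro divide_right_mono) (auto simp: V_def mult_ac)
    moreover have "\<tau> * F r \<le> \<tau> * Q r" using V0[of r] \<tau> by (simp add: FQV)
    moreover have "G r = \<tau> * F r + \<gamma> r * (Z r * (avg' r \<phi>)\<^sup>2) / \<tau>"
      by (simp add: G_def F_def algebra_simps)
    ultimately show ?thesis by simp
  qed
  have intQV: "integrable lborel (\<lambda>r. \<tau> * Q r + n / \<tau> * V r)"
    by (intro Bochner_Integration.integrable_add integrable_mult_right intQ intV)
  have intG: "integrable lborel G"
    by (rule integrable_continuous_bound[OF cG intQV]) (use GQV G0 in simp)
  have Gle: "(\<integral>r. G r \<partial>lborel) \<le> \<tau> * m + real n * \<eta> / \<tau>"
  proof -
    have "(\<integral>r. G r \<partial>lborel) \<le> (\<integral>r. \<tau> * Q r + n / \<tau> * V r \<partial>lborel)"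
      by (intro integral_mono intG intQV GQV)
    also have "\<dots> = \<tau> * m + n / \<tau> * (\<integral>r. V r \<partial>lborel)"
      by (subst Bochner_Integration.integral_add) (auto intro!: integrable_mult_right intQ intV simp: Qm)
    also have "\<dots> \<le> \<tau> * m + n / \<tau> * \<eta>"
      using V\<eta> \<tau> by (intro add_left_mono mult_left_mono) auto
    finally show ?thesis by simp
  qed
  have set_int: "set_integrable lborel {s..t} f" if "integrable lborel f" for f :: "real \<Rightarrow> real" and s t
    unfolding set_integrable_def using integrable_mult_indicator[OF _ that, of "{s..t}"] by simp
  have HK: "integral {s..t} f = (\<integral>r. indicator {s..t} r * f r \<partial>lborel)" if "integrable lborel f" for f :: "real \<Rightarrow> real" and s t
    using set_borel_integral_eq_integral(2)[OF set_int[OF that]] by (simp add: set_lebesgue_integral_def)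
  have intI: "integrable lborel (\<lambda>r. indicator {s..t} r * f r)" if "integrable lborel f" for f :: "real \<Rightarrow> real" and s t
    using set_int[OF that, of s t] by (simp add: set_integrable_def)
  have iF: "F integrable_on {s..t}" and iG: "G integrable_on {s..t}" for s t
    by (auto intro!: integrable_continuous_real cF cG)
  \<comment> \<open>The complement of the open interval contains the endpoints of both wings. Its
    overlap with \<open>[-a, a]\<close> is harmless in the upper bound \<open>total\<close>.\<close>
  define P where "P = (\<integral>r. indicator (- {-a<..<a}) r * F r \<partial>lborel)"
  have intP: "integrable lborel (\<lambda>r. indicator (- {-a<..<a}) r * F r)"
    using integrable_mult_indicator[OF _ intF, of "- {-a<..<a}"] by simp
  have mid: "integral {-a..0} F + integral {0..a} F = integral {-a..a} F"
    using a by (intro Henstock_Kurzweil_Integration.integral_combine iF) auto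
  have Gmid: "integral {-(2*a)..0} G + integral {0..2*a} G = integral {-(2*a)..2*a} G"
    using a by (intro Henstock_Kurzweil_Integration.integral_combine iG) auto
  have tents: "integral {-a..a} F \<le> integral {a..2*a} F + integral {-(2*a)..-a} F + a * integral {-(2*a)..2*a} G"
    using half_line_tent[OF \<tau>, of \<phi>] negative_half_line_tent[OF \<tau>, of \<phi>]
    unfolding a_def[symmetric] F_def[symmetric] G_def[symmetric] mid[symmetric] Gmid[symmetric]
      distrib_left[of a "integral {-(2*a)..0} G"]
    by linarith
  have wings: "integral {a..2*a} F + integral {-(2*a)..-a} F \<le> P"
  proof -
    have "integral {a..2*a} F + integral {-(2*a)..-a} F
        = (\<integral>r. indicator {a..2*a} r * F r + indicator {-(2*a)..-a} r * F r \<partial>lborel)"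
      unfolding HK[OF intF] by (rule Bochner_Integration.integral_add[symmetric]) (rule intI[OF intF])+
    also have "\<dots> \<le> P"
      unfolding P_def
    proof (rule integral_mono[OF Bochner_Integration.integrable_add[OF intI[OF intF] intI[OF intF]] intP])
      show "indicator {a..2*a} r * F r + indicator {-(2*a)..-a} r * F r \<le> indicator (- {-a<..<a}) r * F r" for r
        using F0[of r] a by (auto simp: indicator_def)
    qed
    finally show ?thesis .
  qed
  have Gint: "integral {-(2*a)..2*a} G \<le> (\<integral>r. G r \<partial>lborel)"
    unfolding HK[OF intG] using G0 by (intro integral_mono intI intG) (auto simp: indicator_def)
  have total: "(\<integral>r. F r \<partial>lborel) \<le> integral {-a..a} F + P"
  proof -
    have "(\<integral>r. F r \<partial>lborel) \<le> (\<integral>r. indicator {-a..a} r * F r + indicator (- {-a<..<a}) r * F r \<partial>lborel)"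
    proof (rule integral_mono[OF intF Bochner_Integration.integrable_add[OF intI[OF intF] intP]])
      show "F r \<le> indicator {-a..a} r * F r + indicator (- {-a<..<a}) r * F r" for r
        using F0[of r] by (auto simp: indicator_def)
    qed
    also have "\<dots> = integral {-a..a} F + P"
      unfolding HK[OF intF] P_def by (rule Bochner_Integration.integral_add[OF intI[OF intF] intP])
    finally show ?thesis .
  qed
  have P: "m - \<eta> - a * (\<tau> * m + real n * \<eta> / \<tau>) \<le> 2 * P"
  proof -
    have "a * integral {-(2*a)..2*a} G \<le> a * (\<tau> * m + real n * \<eta> / \<tau>)"
      using Gint Gle a by (intro mult_left_mono) auto
    then show ?thesis using Fm total tents wings by linarith
  qed
  \<comment> \<open>Read through \<open>\<gamma>_w\<close>, the first absolute moment of
    \<open>r\<close> becomes a sum over \<open>x\<close> of absolute moments of normal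
    densities.\<close>
  define R where "R = (\<lambda>r. \<bar>r\<bar> * Q r)"
  have Req: "R r = (\<Sum>x\<in>cube n. (Wt x * (\<phi> x)\<^sup>2) * (normal_density (lam * M x) (sqrt lam) r * \<bar>r\<bar>))" for r
  proof -
    have "R r = (\<Sum>x\<in>cube n. \<bar>r\<bar> * (\<gamma> r * w r x) * (\<phi> x)\<^sup>2)"
      by (simp add: R_def Q_def sum_distrib_left mult_ac)
    then show ?thesis unfolding \<gamma>_w by (simp add: mult_ac)
  qed
  have sl: "0 < sqrt lam" using lam_pos by simp
  have intR: "integrable lborel R"
    unfolding Req[abs_def]
    by (intro Bochner_Integration.integrable_sum integrable_mult_right integral_normal_density_abs_le(1)[OF sl])
  have Rle: "(\<integral>r. R r \<partial>lborel) \<le> lam * (\<Sum>x\<in>cube n. Wt x * (\<phi> x)\<^sup>2 * \<bar>M x\<bar>) + sqrt lam * m"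
  proof -
    have "(\<integral>r. R r \<partial>lborel) = (\<Sum>x\<in>cube n. (Wt x * (\<phi> x)\<^sup>2) * (\<integral>r. normal_density (lam * M x) (sqrt lam) r * \<bar>r\<bar> \<partial>lborel))"
      unfolding Req
      by (subst Bochner_Integration.integral_sum, intro integrable_mult_right integral_normal_density_abs_le(1)[OF sl],
          intro sum.cong refl, rule integral_mult_right_zero)
    also have "\<dots> \<le> (\<Sum>x\<in>cube n. (Wt x * (\<phi> x)\<^sup>2) * (\<bar>lam * M x\<bar> + sqrt lam))"
      using Wt_pos by (intro sum_mono mult_left_mono integral_normal_density_abs_le(2)[OF sl])
        (simp add: less_imp_le)
    also have "\<dots> = lam * (\<Sum>x\<in>cube n. Wt x * (\<phi> x)\<^sup>2 * \<bar>M x\<bar>) + sqrt lam * m"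
      using lam_pos by (simp add: m_def abs_mult distrib_left sum.distrib sum_distrib_left mult_ac)
    finally show ?thesis .
  qed
  have "a * P \<le> (\<integral>r. R r \<partial>lborel)"
    unfolding P_def integral_mult_right_zero[symmetric]
  proof (rule integral_mono[OF integrable_mult_right[OF intP] intR])
    fix r
    show "a * (indicator (- {-a<..<a}) r * F r) \<le> R r"
    proof (cases "r \<in> {-a<..<a}")
      case True
      have "0 \<le> Q r" using FQV[of r] F0[of r] V0[of r] by linarith
      then show ?thesis using True by (simp add: R_def)
    next
      case False
      then have "a * F r \<le> \<bar>r\<bar> * Q r" using FQV[of r] F0[of r] V0[of r] a by (intro mult_mono) auto
      then show ?thesis using False by (simp add: R_def)
    qed
  qed
  moreover have "a / 2 * (m - \<eta> - a * (\<tau> * m + real n * \<eta> / \<tau>)) \<le> a / 2 * (2 * P)"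
    using P a by (intro mult_left_mono) auto
  ultimately show ?thesis using Rle by simp
qed

end

section \<open>The heat kernel\<close>

lemma kernel_pow_scale:
  "kernel_pow S (\<lambda>x y. t * L x y) k x y = t ^ k * kernel_pow S L k x y"
  by (induction k arbitrary: y) (simp_all add: sum_distrib_left mult_ac)

lemma sum_choose_Suc:
  fixes a :: "nat \<Rightarrow> real"
  shows "(\<Sum>j\<le>Suc k. real (Suc k choose j) * a j) = (\<Sum>j\<le>k. real (k choose j) * (a (Suc j) + a j))"
proof -
  have "(\<Sum>j\<le>k. real (k choose Suc j) * a (Suc j)) + a 0 = (\<Sum>j\<le>Suc k. real (k choose j) * a j)"
    by (subst sum.atMost_Suc_shift) simp
  also have "\<dots> = (\<Sum>j\<le>k. real (k choose j) * a j)" by simp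
  finally have "(\<Sum>j\<le>k. real (k choose Suc j) * a (Suc j)) + a 0 = (\<Sum>j\<le>k. real (k choose j) * a j)" .
  then show ?thesis
    by (subst sum.atMost_Suc_shift) (simp add: sum.distrib algebra_simps)
qed

text \<open>The binomial theorem for \<open>K = I + L\<close>. It serves to recognize
  \<open>exp t\<close> times the heat kernel as the exponential of \<open>t * K\<close>, whose
  series has nonnegative terms.\<close>

lemma kernel_pow_binomial:
  assumes S: "finite S" and y: "y \<in> S"
  shows "(\<Sum>j\<le>k. real (k choose j) * kernel_pow S (\<lambda>x y. K x y - of_bool (x = y)) j x y) = kernel_pow S K k x y"
  using y
proof (induction k arbitrary: y)
  case (Suc k)
  let ?L = "\<lambda>x y. K x y - of_bool (x = y)"
  have delta: "(\<Sum>z\<in>S. h z * of_bool (z = y)) = h y" for h :: "'a \<Rightarrow> real"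
    using S Suc.prems by (subst sum.remove[of _ y]) auto
  have "kernel_pow S K (Suc k) x y = (\<Sum>z\<in>S. \<Sum>j\<le>k. real (k choose j) * kernel_pow S ?L j x z * K z y)"
    using Suc.IH by (simp add: sum_distrib_right[symmetric])
  also have "\<dots> = (\<Sum>j\<le>k. \<Sum>z\<in>S. real (k choose j) * kernel_pow S ?L j x z * K z y)"
    by (rule sum.swap)
  also have "\<dots> = (\<Sum>j\<le>k. real (k choose j) * (kernel_pow S ?L (Suc j) x y + kernel_pow S ?L j x y))"
  proof (rule sum.cong[OF refl])
    fix j
    have "kernel_pow S ?L j x y = (\<Sum>z\<in>S. kernel_pow S ?L j x z * of_bool (z = y))"
      by (rule delta[symmetric])
    then have "kernel_pow S ?L (Suc j) x y + kernel_pow S ?L j x y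
        = (\<Sum>z\<in>S. kernel_pow S ?L j x z * ?L z y) + (\<Sum>z\<in>S. kernel_pow S ?L j x z * of_bool (z = y))"
      by simp
    also have "\<dots> = (\<Sum>z\<in>S. kernel_pow S ?L j x z * K z y)"
      by (simp only: sum.distrib[symmetric] distrib_left[symmetric] diff_add_cancel)
    finally show "(\<Sum>z\<in>S. real (k choose j) * kernel_pow S ?L j x z * K z y)
        = real (k choose j) * (kernel_pow S ?L (Suc j) x y + kernel_pow S ?L j x y)"
      by (simp only: sum_distrib_left mult.assoc)
  qed
  finally show ?case unfolding sum_choose_Suc by simp
qed simp

text \<open>The two-point inequality behind entropy dissipation: it passes from the pairing of a
  density with its logarithm to the Dirichlet form of its square root, using only
  \<open>ln y \<le> y - 1\<close>.\<close>

lemma ln_diff_ge: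
  fixes a b :: real
  assumes "0 < a" "0 < b"
  shows "2 * (sqrt a - sqrt b)\<^sup>2 \<le> (a - b) * (ln a - ln b)"
proof -
  have *: "2 * (s - t)\<^sup>2 \<le> (s\<^sup>2 - t\<^sup>2) * (2 * ln s - 2 * ln t)" if st: "0 < t" "t \<le> s" for s t :: real
  proof -
    have "ln (t / s) \<le> t / s - 1" using st by (intro ln_le_minus_one) auto
    then have "(s - t) / s \<le> ln s - ln t" using st by (simp add: ln_div field_simps)
    then have "2 * ((s - t) / s) \<le> 2 * ln s - 2 * ln t" by linarith
    then have "(s\<^sup>2 - t\<^sup>2) * (2 * ((s - t) / s)) \<le> (s\<^sup>2 - t\<^sup>2) * (2 * ln s - 2 * ln t)"
      using st by (intro mult_left_mono) (auto intro: power_mono)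
    moreover have "(s\<^sup>2 - t\<^sup>2) * (2 * ((s - t) / s)) = 2 * (s - t)\<^sup>2 * ((s + t) / s)"
      by (simp add: power2_eq_square field_simps)
    moreover have "2 * (s - t)\<^sup>2 * 1 \<le> 2 * (s - t)\<^sup>2 * ((s + t) / s)"
      using st by (intro mult_left_mono) auto
    ultimately show ?thesis by linarith
  qed
  have l: "2 * ln (sqrt a) = ln a" "2 * ln (sqrt b) = ln b" using assms by (simp_all add: ln_sqrt)
  show ?thesis
  proof (cases "b \<le> a")
    case True
    then show ?thesis using *[of "sqrt b" "sqrt a"] assms l by simp
  next
    case False
    then show ?thesis using *[of "sqrt a" "sqrt b"] assms l by (simp add: power2_commute algebra_simps)
  qed
qed

section \<open>The law of the chain as a power series in time\<close>

locale glauber_heat =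
  fixes n :: nat and \<pi> :: "real Matrix.vec \<Rightarrow> real" and p :: "real Matrix.vec pmf" and x0 :: "real Matrix.vec"
  assumes n: "0 < n" and \<pi>_pos: "\<And>x. 0 < \<pi> x"
    and p: "\<And>x. x \<in> cube n \<Longrightarrow> pmf p x = \<pi> x / (\<Sum>y\<in>cube n. \<pi> y)"
    and x0: "x0 \<in> cube n"
begin

definition Z where "Z = (\<Sum>y\<in>cube n. \<pi> y)"

lemma Z_pos: "0 < Z"
  unfolding Z_def using \<pi>_pos finite_cube cube_nonempty by (intro sum_pos) auto

lemma pi_le_Z: "x \<in> cube n \<Longrightarrow> \<pi> x \<le> Z"
  unfolding Z_def using \<pi>_pos finite_cube by (intro member_le_sum) (auto intro: less_imp_le)

definition rate where "rate i x = \<pi> (flip i x) / (\<pi> x + \<pi> (flip i x))"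

lemma rate_pmf:
  assumes "x \<in> cube n"
  shows "pmf p (flip i x) / (pmf p x + pmf p (flip i x)) = rate i x"
proof -
  have "a / Z / (b / Z + a / Z) = a / (b + a)" for a b
    using Z_pos by (simp add: add_divide_distrib[symmetric])
  then show ?thesis using assms by (simp add: p flip_cube rate_def Z_def[symmetric])
qed

lemma pmf_glauber:
  assumes x: "x \<in> cube n"
  shows "pmf (glauber p x) y
    = (\<Sum>i<n. rate i x * of_bool (flip i x = y) + (1 - rate i x) * of_bool (x = y)) / n"
proof -
  have dim: "dim_vec x = n" using cube_dim[OF x] .
  have r: "0 \<le> rate i x" "rate i x \<le> 1" for i
    using \<pi>_pos[of x] \<pi>_pos[of "flip i x"] by (auto simp: rate_def divide_le_eq)
  have "pmf (bernoulli_pmf (rate i x) \<bind> (\<lambda>b. return_pmf (if b then flip i x else x))) y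
      = rate i x * of_bool (flip i x = y) + (1 - rate i x) * of_bool (x = y)" for i
    unfolding pmf_bind using r[of i] by (simp add: indicator_def)
  then show ?thesis
    unfolding glauber_def dim rate_pmf[OF x] pmf_bind[of "pmf_of_set {..<n}"]
    using n by (subst integral_pmf_of_set) auto
qed

lemma glauber_action:
  assumes x: "x \<in> cube n"
  shows "(\<Sum>y\<in>cube n. pmf (glauber p x) y * F y) = F x + (\<Sum>i<n. rate i x * (F (flip i x) - F x)) / n"
proof -
  have d: "(\<Sum>y\<in>cube n. of_bool (z = y) * F y) = F z" if "z \<in> cube n" for z
    using that finite_cube by (subst sum.remove[of _ z]) (auto intro!: sum.neutral)
  have "(\<Sum>y\<in>cube n. pmf (glauber p x) y * F y)
    = (\<Sum>y\<in>cube n. \<Sum>i<n. rate i x / n * (of_bool (flip i x = y) * F y) + (1 - rate i x) / n * (of_bool (x = y) * F y))"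
    unfolding pmf_glauber[OF x] sum_divide_distrib sum_distrib_right
    by (intro sum.cong refl) (use n in \<open>simp add: field_simps\<close>)
  also have "\<dots> = (\<Sum>i<n. \<Sum>y\<in>cube n. rate i x / n * (of_bool (flip i x = y) * F y) + (1 - rate i x) / n * (of_bool (x = y) * F y))"
    by (rule sum.swap)
  also have "\<dots> = (\<Sum>i<n. rate i x / n * F (flip i x) + (1 - rate i x) / n * F x)"
    by (simp only: sum.distrib sum_distrib_left[symmetric] d[OF x] d[OF flip_cube[OF x]])
  also have "\<dots> = (\<Sum>i<n. F x / n + rate i x * (F (flip i x) - F x) / n)"
    by (intro sum.cong refl) (simp add: add_divide_distrib[symmetric] algebra_simps)
  finally show ?thesis using n by (simp add: sum.distrib sum_divide_distrib)
qed

definition L where "L x y = pmf (glauber p x) y - of_bool (x = y)"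

definition u where "u t y = heat_kernel (cube n) (glauber p) t x0 y"

text \<open>The \<open>x0\<close> row of the \<open>k\<close>-th power of the generator: up to
  factorials the Taylor coefficients of \<open>u\<close>, which can thus be differentiated term by
  term.\<close>

definition c where "c k y = kernel_pow (cube n) L k x0 y"

lemma u_eq: "u t y = (\<Sum>k. c k y / fact k * t ^ k)"
proof -
  have "(\<lambda>x y. - t * (of_bool (x = y) - pmf (glauber p x) y)) = (\<lambda>x y. t * L x y)"
    by (simp add: fun_eq_iff L_def algebra_simps)
  then show ?thesis
    unfolding u_def heat_kernel_def kernel_exp_def by (simp add: kernel_pow_scale c_def mult.commute)
qed

lemma c_0: "c 0 y = of_bool (x0 = y)"
  by (simp add: c_def)

lemma c_Suc: "c (Suc k) y = (\<Sum>z\<in>cube n. c k z * L z y)"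
  by (simp add: c_def)

lemma c_bound: "\<bar>c k y\<bar> \<le> real (card (cube n)) ^ k"
proof (induction k arbitrary: y)
  case (Suc k)
  have "\<bar>c (Suc k) y\<bar> \<le> (\<Sum>z\<in>cube n. \<bar>c k z * L z y\<bar>)" unfolding c_Suc by (rule sum_abs)
  also have "\<dots> \<le> (\<Sum>z\<in>cube n. real (card (cube n)) ^ k * 1)"
    unfolding abs_mult
  proof (intro sum_mono mult_mono Suc)
    show "\<bar>L z y\<bar> \<le> 1" for z
      using pmf_le_1[of "glauber p z" y] pmf_nonneg[of "glauber p z" y] by (cases "z = y") (auto simp: L_def abs_le_iff)
  qed auto
  also have "\<dots> = real (card (cube n)) ^ Suc k" by simp
  finally show ?case .
qed (simp add: c_0)

lemma summable_norm_u: "summable (\<lambda>k. norm (c k y / fact k * t ^ k))"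
proof (rule summable_comparison_test[OF _ summable_exp[of "real (card (cube n)) * \<bar>t\<bar>"]], intro exI allI impI)
  fix k
  show "norm (norm (c k y / fact k * t ^ k)) \<le> inverse (fact k) * (real (card (cube n)) * \<bar>t\<bar>) ^ k"
    using mult_right_mono[OF c_bound[of k y], of "\<bar>t\<bar> ^ k / fact k"]
    by (simp add: abs_mult power_abs power_mult_distrib divide_inverse mult_ac)
qed

lemma summable_u: "summable (\<lambda>k. c k y / fact k * t ^ k)"
  by (rule summable_norm_cancel[OF summable_norm_u])

lemma u_0: "u 0 y = of_bool (x0 = y)"
  unfolding u_eq powser_zero by (simp add: c_0)

definition du where "du t y = (\<Sum>z\<in>cube n. u t z * L z y)"

lemma u_deriv: "((\<lambda>t. u t y) has_real_derivative du t y) (at t)"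
proof -
  have "((\<lambda>t. \<Sum>k. c k y / fact k * t ^ k) has_real_derivative (\<Sum>k. diffs (\<lambda>k. c k y / fact k) k * t ^ k)) (at t)"
    by (rule termdiffs_strong_converges_everywhere) (rule summable_u)
  moreover have "(\<Sum>k. diffs (\<lambda>k. c k y / fact k) k * t ^ k) = (\<Sum>z\<in>cube n. u t z * L z y)"
  proof -
    have "diffs (\<lambda>k. c k y / fact k) k * t ^ k = (\<Sum>z\<in>cube n. c k z / fact k * t ^ k * L z y)" for k
      by (simp add: diffs_def c_Suc sum_distrib_left sum_distrib_right sum_divide_distrib field_simps del: of_nat_Suc)
    then have "(\<Sum>k. diffs (\<lambda>k. c k y / fact k) k * t ^ k) = (\<Sum>k. \<Sum>z\<in>cube n. c k z / fact k * t ^ k * L z y)"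
      by simp
    also have "\<dots> = (\<Sum>z\<in>cube n. \<Sum>k. c k z / fact k * t ^ k * L z y)"
      by (rule suminf_sum) (intro summable_mult2 summable_u)
    also have "\<dots> = (\<Sum>z\<in>cube n. u t z * L z y)"
      by (simp only: u_eq suminf_mult2[OF summable_u])
    finally show ?thesis .
  qed
  ultimately show ?thesis unfolding u_eq du_def by simp
qed

lemma kernel_pow_nonneg: "0 \<le> kernel_pow (cube n) (\<lambda>x y. pmf (glauber p x) y) k x y"
  by (induction k arbitrary: y) (auto intro!: sum_nonneg)

text \<open>The series of \<open>exp (t * L)\<close> has terms of both signs. Its Cauchy product
  with the series of \<open>exp t\<close> is that of \<open>exp (t * K)\<close> with
  \<open>K\<close> the transition kernel, and every term of the latter is nonnegative.\<close>

lemma u_nonneg: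
  assumes t: "0 \<le> t" and y: "y \<in> cube n"
  shows "0 \<le> u t y"
proof -
  let ?K = "kernel_pow (cube n) (\<lambda>x y. pmf (glauber p x) y)"
  have exp_summable: "summable (\<lambda>k. norm (t ^ k / fact k))"
    using summable_norm_exp[of t] by (simp add: divide_inverse mult.commute)
  have conv: "(\<Sum>i\<le>k. c i y / fact i * t ^ i * (t ^ (k - i) / fact (k - i))) = t ^ k / fact k * ?K k x0 y" for k
  proof -
    have "(\<Sum>i\<le>k. c i y / fact i * t ^ i * (t ^ (k - i) / fact (k - i)))
        = (\<Sum>i\<le>k. t ^ k / fact k * (real (k choose i) * c i y))"
    proof (rule sum.cong[OF refl])
      fix i assume "i \<in> {..k}"
      then have i: "i \<le> k" by simp
      then have "t ^ i * t ^ (k - i) = t ^ k" by (simp add: power_add[symmetric])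
      then show "c i y / fact i * t ^ i * (t ^ (k - i) / fact (k - i)) = t ^ k / fact k * (real (k choose i) * c i y)"
        using i by (simp add: binomial_fact field_simps)
    qed
    also have "\<dots> = t ^ k / fact k * (\<Sum>i\<le>k. real (k choose i) * c i y)"
      by (simp add: sum_distrib_left)
    also have "(\<Sum>i\<le>k. real (k choose i) * c i y) = ?K k x0 y"
      unfolding c_def L_def[abs_def] by (rule kernel_pow_binomial[OF finite_cube y])
    finally show ?thesis .
  qed
  have "u t y * exp t = (\<Sum>k. c k y / fact k * t ^ k) * (\<Sum>k. t ^ k / fact k)"
    by (simp add: u_eq exp_def divide_inverse mult.commute)
  also have "\<dots> = (\<Sum>k. t ^ k / fact k * ?K k x0 y)"
    using Cauchy_product[OF summable_norm_u[of y t] exp_summable] by (simp only: conv)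
  also have "0 \<le> \<dots>"
  proof (rule suminf_nonneg)
    show "summable (\<lambda>k. t ^ k / fact k * ?K k x0 y)"
      using summable_Cauchy_product[OF summable_norm_u[of y t] exp_summable] by (simp only: conv)
  qed (use t kernel_pow_nonneg in auto)
  finally show ?thesis by (simp add: zero_le_mult_iff)
qed

lemma sum_L:
  assumes z: "z \<in> cube n"
  shows "(\<Sum>y\<in>cube n. L z y * F y) = (\<Sum>i<n. rate i z * (F (flip i z) - F z)) / n"
proof -
  have "(\<Sum>y\<in>cube n. of_bool (z = y) * F y) = F z"
    using z finite_cube by (subst sum.remove[of _ z]) (auto intro!: sum.neutral)
  then show ?thesis using glauber_action[OF z, of F] by (simp add: L_def left_diff_distrib sum_subtractf)
qed

lemma sum_du: "(\<Sum>y\<in>cube n. du t y * F y) = (\<Sum>z\<in>cube n. u t z * ((\<Sum>i<n. rate i z * (F (flip i z) - F z)) / n))"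
proof -
  have "(\<Sum>y\<in>cube n. du t y * F y) = (\<Sum>y\<in>cube n. \<Sum>z\<in>cube n. u t z * L z y * F y)"
    by (simp add: du_def sum_distrib_right)
  also have "\<dots> = (\<Sum>z\<in>cube n. \<Sum>y\<in>cube n. u t z * L z y * F y)" by (rule sum.swap)
  also have "\<dots> = (\<Sum>z\<in>cube n. u t z * (\<Sum>y\<in>cube n. L z y * F y))"
    by (simp add: sum_distrib_left mult.assoc)
  finally show ?thesis by (simp add: sum_L)
qed

lemma cont_u: "continuous_on X (\<lambda>t. u t y)"
  by (intro continuous_at_imp_continuous_on ballI DERIV_isCont[OF u_deriv])

lemma sum_u: "(\<Sum>y\<in>cube n. u t y) = 1"
proof -
  have "((\<lambda>t. \<Sum>y\<in>cube n. u t y) has_real_derivative (\<Sum>y\<in>cube n. du t y)) (at t)" for t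
    by (rule DERIV_sum) (rule u_deriv)
  moreover have "(\<Sum>y\<in>cube n. du t y) = 0" for t
    using sum_du[of t "\<lambda>_. 1"] by simp
  ultimately have "\<forall>t. ((\<lambda>t. \<Sum>y\<in>cube n. u t y) has_real_derivative 0) (at t)" by simp
  then have "(\<Sum>y\<in>cube n. u t y) = (\<Sum>y\<in>cube n. u 0 y)"
    by (rule DERIV_isconst_all)
  also have "\<dots> = 1" using x0 finite_cube by (simp add: u_0 sum.remove[of _ x0])
  finally show ?thesis .
qed

section \<open>Entropy dissipation\<close>

text \<open>The entropy is regularized by \<open>\<theta> / Z\<close> so that it is differentiable at \<open>t = 0\<close>, where the law is
  a point mass.\<close>

definition G where "G \<theta> t y = u t y / \<pi> y + \<theta> / Z"

definition \<phi> where "\<phi> \<theta> t y = sqrt (G \<theta> t y)"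

text \<open>Entropy relative to the unnormalized weight. The lower bound therefore carries
  \<open>ln Z\<close>, which combines with the initial entropy to
  \<open>ln (Z / \<pi> x0)\<close>.\<close>

definition H where "H \<theta> t = (\<Sum>y\<in>cube n. \<pi> y * G \<theta> t y * ln (G \<theta> t y))"

lemma G_pos: "0 < \<theta> \<Longrightarrow> 0 \<le> t \<Longrightarrow> y \<in> cube n \<Longrightarrow> 0 < G \<theta> t y"
  unfolding G_def using u_nonneg[of t y] \<pi>_pos[of y] Z_pos by (intro add_nonneg_pos) auto

lemma sum_pi_G: "(\<Sum>y\<in>cube n. \<pi> y * G \<theta> t y) = 1 + \<theta>"
proof -
  have "\<pi> y * G \<theta> t y = u t y + \<theta> / Z * \<pi> y" for y
    using \<pi>_pos[of y] by (simp add: G_def field_simps)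
  then have "(\<Sum>y\<in>cube n. \<pi> y * G \<theta> t y) = 1 + \<theta> / Z * Z"
    by (simp only: sum.distrib sum_u sum_distrib_left[symmetric] Z_def[symmetric])
  then show ?thesis using Z_pos by simp
qed

text \<open>Summation by parts from reversibility. The shift \<open>\<theta> / Z\<close> cancels in
  differences, so the density may be replaced by \<open>G\<close>.\<close>

lemma symmetrize:
  "(\<Sum>z\<in>cube n. u t z * (\<Sum>i<n. rate i z * (F (flip i z) - F z)))
    = - (1/2 * (\<Sum>i<n. \<Sum>z\<in>cube n. conductance (\<pi> z) (\<pi> (flip i z))
        * ((G \<theta> t z - G \<theta> t (flip i z)) * (F z - F (flip i z)))))"
proof -
  have one: "(\<Sum>z\<in>cube n. u t z * (rate i z * (F (flip i z) - F z)))
     = - (1/2 * (\<Sum>z\<in>cube n. conductance (\<pi> z) (\<pi> (flip i z)) * ((G \<theta> t z - G \<theta> t (flip i z)) * (F z - F (flip i z)))))" for i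
  proof -
    define f where "f = (\<lambda>z. u t z / \<pi> z)"
    define k where "k = (\<lambda>z. conductance (\<pi> z) (\<pi> (flip i z)))"
    define X where "X = (\<lambda>z. k z * (f z * (F (flip i z) - F z)))"
    have k: "k (flip i z) = k z" for z by (simp add: k_def flip_flip conductance_commute)
    have "u t z * (rate i z * (F (flip i z) - F z)) = X z" for z
      using \<pi>_pos[of z] by (simp add: X_def k_def f_def rate_def conductance_def)
    then have "(\<Sum>z\<in>cube n. u t z * (rate i z * (F (flip i z) - F z))) = (\<Sum>z\<in>cube n. X z)" by simp
    also have "\<dots> = 1/2 * (\<Sum>z\<in>cube n. X z + X (flip i z))"
      by (simp add: sum.distrib sum_flip)
    also have "(\<Sum>z\<in>cube n. X z + X (flip i z))
        = - (\<Sum>z\<in>cube n. k z * ((G \<theta> t z - G \<theta> t (flip i z)) * (F z - F (flip i z))))"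
      unfolding sum_negf[symmetric]
    proof (rule sum.cong[OF refl])
      fix z
      have "X z + X (flip i z) = k z * ((f z - f (flip i z)) * (F (flip i z) - F z))"
        by (simp add: X_def k flip_flip algebra_simps)
      moreover have "G \<theta> t z - G \<theta> t (flip i z) = f z - f (flip i z)"
        by (simp add: G_def f_def)
      ultimately show "X z + X (flip i z) = - (k z * ((G \<theta> t z - G \<theta> t (flip i z)) * (F z - F (flip i z))))"
        by (simp only:) (simp add: algebra_simps)
    qed
    finally show ?thesis by (simp add: k_def)
  qed
  have "(\<Sum>z\<in>cube n. u t z * (\<Sum>i<n. rate i z * (F (flip i z) - F z)))
      = (\<Sum>i<n. \<Sum>z\<in>cube n. u t z * (rate i z * (F (flip i z) - F z)))"
    unfolding sum_distrib_left by (rule sum.swap)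
  then show ?thesis by (simp only: one sum_negf sum_distrib_left)
qed

lemma entropy_deriv_le:
  assumes \<theta>: "0 < \<theta>" and t: "0 \<le> t"
  shows "(\<Sum>y\<in>cube n. du t y * ln (G \<theta> t y)) \<le> - (2 / n * dirichlet n \<pi> (\<phi> \<theta> t))"
proof -
  have "(\<Sum>y\<in>cube n. du t y * ln (G \<theta> t y)) = (\<Sum>z\<in>cube n. u t z * (\<Sum>i<n. rate i z * (ln (G \<theta> t (flip i z)) - ln (G \<theta> t z)))) / n"
    unfolding sum_du by (subst sum_divide_distrib) (simp only: times_divide_eq_right)
  also have "\<dots> = - (1/2 * (\<Sum>i<n. \<Sum>z\<in>cube n. conductance (\<pi> z) (\<pi> (flip i z))
        * ((G \<theta> t z - G \<theta> t (flip i z)) * (ln (G \<theta> t z) - ln (G \<theta> t (flip i z)))))) / n"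
    by (simp only: symmetrize[where \<theta> = \<theta> and F = "\<lambda>z. ln (G \<theta> t z)"])
  also have "\<dots> \<le> - (1/2 * (\<Sum>i<n. \<Sum>z\<in>cube n. conductance (\<pi> z) (\<pi> (flip i z)) * (2 * (\<phi> \<theta> t z - \<phi> \<theta> t (flip i z))\<^sup>2))) / n"
    unfolding \<phi>_def
    by (intro divide_right_mono le_imp_neg_le mult_left_mono sum_mono ln_diff_ge conductance_nonneg G_pos \<theta> t flip_cube
        less_imp_le[OF \<pi>_pos]) auto
  also have "(\<Sum>i<n. \<Sum>z\<in>cube n. conductance (\<pi> z) (\<pi> (flip i z)) * (2 * (\<phi> \<theta> t z - \<phi> \<theta> t (flip i z))\<^sup>2))
      = 2 * (\<Sum>i<n. \<Sum>z\<in>cube n. conductance (\<pi> z) (\<pi> (flip i z)) * (\<phi> \<theta> t z - \<phi> \<theta> t (flip i z))\<^sup>2)"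
    by (simp only: sum_distrib_left mult.left_commute[of _ 2])
  also have "- (1/2 * \<dots>) / n = - (2 / n * dirichlet n \<pi> (\<phi> \<theta> t))"
    by (simp add: dirichlet_def)
  finally show ?thesis .
qed

lemma H_deriv:
  assumes \<theta>: "0 < \<theta>" and t: "0 \<le> t"
  shows "(H \<theta> has_real_derivative (\<Sum>y\<in>cube n. du t y * ln (G \<theta> t y))) (at t)"
proof -
  have dG: "((\<lambda>t. G \<theta> t y) has_real_derivative du t y / \<pi> y) (at t)" for y
    unfolding G_def using DERIV_add[OF DERIV_cdivide[OF u_deriv[of y t], of "\<pi> y"] DERIV_const[of "\<theta> / Z"]] by simp
  have "((\<lambda>t. \<pi> y * G \<theta> t y * ln (G \<theta> t y)) has_real_derivative du t y * ln (G \<theta> t y) + du t y) (at t)"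
    if y: "y \<in> cube n" for y
  proof -
    have g: "0 < G \<theta> t y" by (rule G_pos[OF \<theta> t y])
    have "((\<lambda>t. G \<theta> t y * ln (G \<theta> t y)) has_real_derivative
        du t y / \<pi> y * ln (G \<theta> t y) + inverse (G \<theta> t y) * (du t y / \<pi> y) * G \<theta> t y) (at t)"
      by (rule DERIV_mult[OF dG DERIV_chain2[OF DERIV_ln[OF g] dG]])
    from DERIV_cmult[OF this, of "\<pi> y"]
    have "((\<lambda>t. \<pi> y * G \<theta> t y * ln (G \<theta> t y)) has_real_derivative
        \<pi> y * (du t y / \<pi> y * ln (G \<theta> t y) + inverse (G \<theta> t y) * (du t y / \<pi> y) * G \<theta> t y)) (at t)"
      by (simp only: mult.assoc)
    moreover have "\<pi> y * (du t y / \<pi> y * ln (G \<theta> t y) + inverse (G \<theta> t y) * (du t y / \<pi> y) * G \<theta> t y)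
        = du t y * ln (G \<theta> t y) + du t y"
      using g \<pi>_pos[of y] by (simp add: field_simps)
    ultimately show ?thesis by (simp only:)
  qed
  then have "((\<lambda>t. \<Sum>y\<in>cube n. \<pi> y * G \<theta> t y * ln (G \<theta> t y)) has_real_derivative
      (\<Sum>y\<in>cube n. du t y * ln (G \<theta> t y) + du t y)) (at t)"
    by (intro DERIV_sum)
  moreover have "(\<Sum>y\<in>cube n. du t y) = 0"
    using sum_du[of t "\<lambda>_. 1"] by simp
  ultimately show ?thesis by (simp add: H_def[abs_def] sum.distrib)
qed

lemma H_lower:
  assumes \<theta>: "0 < \<theta>" and t: "0 \<le> t"
  shows "- ((1 + \<theta>) * ln Z) \<le> H \<theta> t"
proof -
  have "(\<Sum>y\<in>cube n. \<pi> y * (G \<theta> t y * (1 - ln Z) - 1 / Z)) \<le> H \<theta> t"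
    unfolding H_def mult.assoc
  proof (intro sum_mono mult_left_mono)
    fix y assume y: "y \<in> cube n"
    have g: "0 < G \<theta> t y" by (rule G_pos[OF \<theta> t y])
    \<comment> \<open>Gibbs' inequality in tangent form, touching at the constant density
      \<open>1 / Z\<close> of the stationary law.\<close>
    have "ln (1 / (Z * G \<theta> t y)) \<le> 1 / (Z * G \<theta> t y) - 1"
      using g Z_pos by (intro ln_le_minus_one) simp
    then have "1 - ln Z - 1 / (Z * G \<theta> t y) \<le> ln (G \<theta> t y)"
      using g Z_pos by (simp add: ln_div ln_mult)
    then have "G \<theta> t y * (1 - ln Z - 1 / (Z * G \<theta> t y)) \<le> G \<theta> t y * ln (G \<theta> t y)"
      using g by (intro mult_left_mono) auto
    then show "G \<theta> t y * (1 - ln Z) - 1 / Z \<le> G \<theta> t y * ln (G \<theta> t y)"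
      using g by (simp add: right_diff_distrib)
    show "0 \<le> \<pi> y" using \<pi>_pos[of y] by simp
  qed
  moreover have "(\<Sum>y\<in>cube n. \<pi> y * (G \<theta> t y * (1 - ln Z) - 1 / Z)) = (1 + \<theta>) * (1 - ln Z) - 1"
  proof -
    have "(\<Sum>y\<in>cube n. \<pi> y * (G \<theta> t y * (1 - ln Z) - 1 / Z))
        = (\<Sum>y\<in>cube n. \<pi> y * G \<theta> t y) * (1 - ln Z) - (\<Sum>y\<in>cube n. \<pi> y) / Z"
      by (simp add: right_diff_distrib sum_subtractf sum_distrib_right sum_divide_distrib mult.assoc)
    then show ?thesis using Z_pos unfolding sum_pi_G Z_def[symmetric] by simp
  qed
  ultimately show ?thesis using \<theta> by (simp add: right_diff_distrib)
qed

lemma H_0_le: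
  assumes \<theta>: "0 < \<theta>"
  shows "H \<theta> 0 \<le> (1 + \<theta>) * (ln (1 + \<theta>) - ln (\<pi> x0))"
proof -
  have "H \<theta> 0 \<le> (\<Sum>y\<in>cube n. \<pi> y * G \<theta> 0 y * (ln (1 + \<theta>) - ln (\<pi> x0)))"
    unfolding H_def
  proof (intro sum_mono mult_left_mono)
    fix y assume y: "y \<in> cube n"
    have g: "0 < G \<theta> 0 y" by (rule G_pos[OF \<theta> _ y]) simp
    have "\<theta> / Z \<le> \<theta> / \<pi> x0"
      using \<theta> \<pi>_pos Z_pos pi_le_Z[OF x0] by (intro divide_left_mono) auto
    moreover have "u 0 y / \<pi> y \<le> 1 / \<pi> x0" using \<pi>_pos[of x0] by (auto simp: u_0 of_bool_def)
    ultimately have "G \<theta> 0 y \<le> (1 + \<theta>) / \<pi> x0" by (simp add: G_def add_divide_distrib)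
    then have "ln (G \<theta> 0 y) \<le> ln ((1 + \<theta>) / \<pi> x0)" using g by simp
    then show "ln (G \<theta> 0 y) \<le> ln (1 + \<theta>) - ln (\<pi> x0)" using \<theta> \<pi>_pos[of x0] by (simp add: ln_div)
    show "0 \<le> \<pi> y * G \<theta> 0 y" using g \<pi>_pos[of y] by simp
  qed
  also have "\<dots> = (1 + \<theta>) * (ln (1 + \<theta>) - ln (\<pi> x0))"
    by (simp add: sum_distrib_right[symmetric] sum_pi_G)
  finally show ?thesis .
qed

lemma cont_dirichlet:
  "continuous_on X (\<lambda>t. dirichlet n \<pi> (\<phi> \<theta> t))"
proof -
  have "continuous_on X (\<lambda>t. \<phi> \<theta> t y)" for y
    unfolding \<phi>_def G_def using \<pi>_pos[of y]
    by (intro continuous_on_real_sqrt continuous_on_add continuous_on_divide cont_u continuous_on_const) simp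
  then show ?thesis unfolding dirichlet_def by (intro continuous_intros)
qed

text \<open>The right side does not depend on \<open>T\<close>: a longer horizon forces a smaller
  Dirichlet form at most times.\<close>

lemma dirichlet_integral_le:
  assumes \<theta>: "0 < \<theta>" and T: "0 \<le> T"
  shows "integral {0..T} (\<lambda>t. dirichlet n \<pi> (\<phi> \<theta> t)) \<le> n / 2 * ((1 + \<theta>) * (ln (1 + \<theta>) + ln (Z / \<pi> x0)))"
proof -
  let ?D = "\<lambda>t. dirichlet n \<pi> (\<phi> \<theta> t)"
  let ?d = "\<lambda>t. \<Sum>y\<in>cube n. du t y * ln (G \<theta> t y)"
  have "(?d has_integral (H \<theta> T - H \<theta> 0)) {0..T}"
  proof (rule fundamental_theorem_of_calculus[OF T])
    fix t assume "t \<in> {0..T}"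
    then have "(H \<theta> has_real_derivative ?d t) (at t)" using H_deriv[OF \<theta>] by simp
    then show "(H \<theta> has_vector_derivative ?d t) (at t within {0..T})"
      by (simp add: has_real_derivative_iff_has_vector_derivative has_vector_derivative_at_within)
  qed
  from has_integral_neg[OF this]
  have neg: "((\<lambda>t. - ?d t) has_integral (H \<theta> 0 - H \<theta> T)) {0..T}" by (simp only: minus_diff_eq)
  have D: "(?D has_integral integral {0..T} ?D) {0..T}"
    by (intro integrable_integral integrable_continuous_real cont_dirichlet)
  have "2 / n * integral {0..T} ?D \<le> H \<theta> 0 - H \<theta> T"
  proof (rule has_integral_le[OF has_integral_mult_right[OF D] neg])
    fix t assume "t \<in> {0..T}"
    then show "2 / n * ?D t \<le> - ?d t" using entropy_deriv_le[OF \<theta>, of t] by simp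
  qed
  also have "\<dots> \<le> (1 + \<theta>) * (ln (1 + \<theta>) - ln (\<pi> x0)) + (1 + \<theta>) * ln Z"
    using H_0_le[OF \<theta>] H_lower[OF \<theta> T] by simp
  also have "\<dots> = (1 + \<theta>) * (ln (1 + \<theta>) + ln (Z / \<pi> x0))"
    using \<pi>_pos[of x0] Z_pos by (simp add: ln_div algebra_simps)
  finally have "n / 2 * (2 / n * integral {0..T} ?D) \<le> n / 2 * ((1 + \<theta>) * (ln (1 + \<theta>) + ln (Z / \<pi> x0)))"
    by (rule mult_left_mono) simp
  then show ?thesis using n by simp
qed

end

section \<open>Matrices of the statement\<close>

lemma quadratic_form_eq_bil:
  assumes "A \<in> carrier_mat n n" "u \<in> carrier_vec n"
  shows "u \<bullet> (A *\<^sub>v u) = bil n (\<lambda>i j. A $$ (i, j)) (($) u) (($) u)"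
  using assms
  by (simp add: bil_def scalar_prod_def mult_mat_vec_def lessThan_atLeast0 sum_distrib_left mult_ac)

lemma loewner_le_bil:
  assumes "A \<preceq>\<^sub>L B" "A \<in> carrier_mat n n" "B \<in> carrier_mat n n"
  shows "bil n (\<lambda>i j. A $$ (i, j)) c c \<le> bil n (\<lambda>i j. B $$ (i, j)) c c"
proof -
  have "0 \<le> Matrix.vec n c \<bullet> ((B - A) *\<^sub>v Matrix.vec n c)"
    using assms by (auto simp: loewner_le_def)
  also have "\<dots> = bil n (\<lambda>i j. (B - A) $$ (i, j)) c c"
    using assms by (subst quadratic_form_eq_bil[of _ n]) (auto simp: bil_def)
  also have "\<dots> = bil n (\<lambda>i j. B $$ (i, j)) c c - bil n (\<lambda>i j. A $$ (i, j)) c c"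
    using assms by (simp add: bil_def left_diff_distrib sum_subtractf)
  finally show ?thesis by simp
qed

lemma bil_scaled_one: "bil n (\<lambda>i j. (k \<cdot>\<^sub>m 1\<^sub>m n) $$ (i, j)) c c = k * (\<Sum>i<n. (c i)\<^sup>2)"
proof -
  have "(\<Sum>j<n. (k \<cdot>\<^sub>m 1\<^sub>m n) $$ (i, j) * c i * c j) = k * (c i)\<^sup>2" if "i < n" for i
    using that by (subst sum.remove[of _ i]) (auto simp: power2_eq_square intro!: sum.neutral)
  then show ?thesis by (simp add: bil_def sum_distrib_left)
qed

section \<open>Markov's inequality for the uniformly random time, and the assembly of the
  bounds\<close>

lemma measure_superlevel_le:
  fixes D :: "real \<Rightarrow> real"
  assumes D: "continuous_on UNIV D" "\<And>t. 0 \<le> t \<Longrightarrow> 0 \<le> D t" and \<beta>: "0 < \<beta>"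
  shows "measure lborel {t \<in> {0..T}. \<beta> < D t} \<le> integral {0..T} D / \<beta>"
    and "{t \<in> {0..T}. \<beta> < D t} \<in> sets borel"
proof -
  let ?B = "{t \<in> {0..T}. \<beta> < D t}"
  have Dm[measurable]: "D \<in> borel_measurable borel" by (rule borel_measurable_continuous_onI[OF D(1)])
  have "?B = {0..T} \<inter> {t \<in> space borel. \<beta> < D t}" by auto
  also have "\<dots> \<in> sets borel" by measurable
  finally show B: "?B \<in> sets borel" .
  have "emeasure lborel ?B \<le> emeasure lborel {0..T}" by (rule emeasure_mono) auto
  also have "\<dots> < \<infinity>" by (simp add: emeasure_lborel_Icc_eq)
  finally have Bfin: "emeasure lborel ?B < \<infinity>" .
  have set_int: "set_integrable lborel {0..T} D"
    using D(1) continuous_on_subset by (intro borel_integrable_atLeastAtMost') blast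
  then have int: "integrable lborel (\<lambda>t. indicator {0..T} t * D t)"
    by (simp add: set_integrable_def)
  have "\<beta> * measure lborel ?B = (\<integral>t. \<beta> * indicator ?B t \<partial>lborel)"
    using B by simp
  also have "\<dots> \<le> (\<integral>t. indicator {0..T} t * D t \<partial>lborel)"
  proof (rule integral_mono[OF _ int])
    show "integrable lborel (\<lambda>t. \<beta> * indicator ?B t)"
      using B Bfin by (intro integrable_mult_right integrable_real_indicator) auto
    show "\<beta> * indicator ?B t \<le> indicator {0..T} t * D t" for t
      using D(2)[of t] \<beta> by (auto simp: indicator_def)
  qed
  also have "\<dots> = integral {0..T} D"
    using set_borel_integral_eq_integral(2)[OF set_int] by (simp add: set_lebesgue_integral_def)
  finally show "measure lborel ?B \<le> integral {0..T} D / \<beta>"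
    using \<beta> by (simp add: pos_le_divide_eq mult.commute)
qed

lemma uniform_measure_ge:
  assumes T: "0 < T" and X: "X \<in> sets borel" and B: "B \<in> sets borel" "B \<subseteq> {0..T}" "{0..T} - B \<subseteq> X"
  shows "1 - measure lborel B / T \<le> measure (uniform_measure lborel {0..T}) X"
proof -
  have "measure lborel ({0..T} - B) = T - measure lborel B"
    using B T by (subst measure_Diff) auto
  moreover have "measure lborel ({0..T} - B) \<le> measure lborel ({0..T} \<inter> X)"
  proof (rule measure_mono_fmeasurable)
    have "{0..T} \<in> fmeasurable lborel" by (intro fmeasurableI) (simp_all add: emeasure_lborel_Icc_eq)
    then show "{0..T} \<inter> X \<in> fmeasurable lborel" by (rule fmeasurableI2) (use X in auto)
    show "{0..T} - B \<in> sets lborel" using B(1) by simp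
  qed (use B(3) in blast)
  ultimately have "(T - measure lborel B) / T \<le> measure lborel ({0..T} \<inter> X) / T"
    using T by (intro divide_right_mono) auto
  also have "\<dots> = measure (uniform_measure lborel {0..T}) X"
    using T X by (subst measure_uniform_measure) auto
  finally show ?thesis using T by (simp add: diff_divide_distrib)
qed

text \<open>Everything except asymptotics. The premise \<open>low\<close> stands for the numerical
  step from the inequality of \<open>magnetization_lower_bound\<close> at a good time to the desired
  bound \<open>K\<close>.\<close>

lemma heat_magnetization_prob:
  fixes n :: nat and W :: "real mat" and v x\<^sub>0 :: "real Matrix.vec" and \<kappa> lam T \<beta> :: real
  defines "f \<equiv> \<lambda>t. heat_expectation (cube n) (glauber (ising0 (W + lam \<cdot>\<^sub>m outer_square v))) t x\<^sub>0 (\<lambda>x. \<bar>x \<bullet> v\<bar>)"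
  assumes \<kappa>: "0 < \<kappa>" "\<kappa> < 1/2" and n: "1 \<le> n" and T: "0 < T" and \<beta>: "0 < \<beta>"
    and lam: "6 * exp 20 \<le> lam"
    and W: "W \<in> carrier_mat n n" "W\<^sup>T = W" "\<kappa> \<cdot>\<^sub>m 1\<^sub>m n \<preceq>\<^sub>L W" "W \<preceq>\<^sub>L (1 - \<kappa>) \<cdot>\<^sub>m 1\<^sub>m n"
    and v: "v \<in> carrier_vec n" "\<And>i. i < n \<Longrightarrow> v $ i \<in> {1 / sqrt (real n), - (1 / sqrt (real n))}"
    and x0: "x\<^sub>0 \<in> cube n"
    and low: "\<And>E. lam * sqrt n / 8 * (99/100 * (101/100) - 2 / \<kappa> * \<beta> * (1 + 100 * (lam * sqrt n / 4)\<^sup>2 * n))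
        \<le> lam * (E + sqrt n / 100) + sqrt lam * (101/100) \<Longrightarrow> K \<le> E"
  shows "1 - (3 + lam) * (real n)\<^sup>2 / (\<beta> * T) \<le> \<P>(t in uniform_measure lborel {0..T}. K \<le> f t)"
proof -
  define Wf where "Wf = (\<lambda>i j. W $$ (i, j))"
  define vf where "vf = (($) v)"
  define p where "p = ising0 (W + lam \<cdot>\<^sub>m outer_square v)"
  have lam0: "0 < lam" by (rule less_le_trans[OF _ lam]) simp
  have lower: "\<kappa> * (\<Sum>i<n. (c i)\<^sup>2) \<le> bil n Wf c c" for c
    using loewner_le_bil[OF W(3), of n c] W(1) unfolding bil_scaled_one Wf_def by simp
  have upper: "bil n Wf c c \<le> (1 - \<kappa>) * (\<Sum>i<n. (c i)\<^sup>2)" for c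
    using loewner_le_bil[OF W(4), of n c] W(1) unfolding bil_scaled_one Wf_def by simp
  have "psd n Wf"
    unfolding psd_def
  proof (intro conjI allI impI)
    show "Wf i j = Wf j i" if "i < n" "j < n" for i j
      using that W(1) arg_cong[OF W(2), of "\<lambda>A. A $$ (i, j)"] by (simp add: Wf_def)
    have "0 \<le> \<kappa> * (\<Sum>i<n. (y i)\<^sup>2)" for y using \<kappa> by (intro mult_nonneg_nonneg sum_nonneg) auto
    then show "0 \<le> bil n Wf y y" for y using lower[of y] by (rule order_trans)
  qed
  moreover have "\<bar>vf i\<bar> = 1 / sqrt n" if "i < n" for i
    using v(2)[OF that] by (auto simp: vf_def)
  ultimately interpret O: outlier n Wf vf lam "1 - \<kappa>"
    using n \<kappa> upper lam by (intro outlier.intro) auto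
  have M: "x \<bullet> v = O.M x" if "x \<in> cube n" for x
    using v(1) cube_dim[OF that] by (simp add: scalar_prod_def lin_def vf_def lessThan_atLeast0 mult.commute)
  define J where "J = W + lam \<cdot>\<^sub>m outer_square v"
  have J: "J \<in> carrier_mat n n" "dim_row J = n" using W(1) v(1) by (auto simp: J_def outer_square_def)
  have weight: "ising_weight J (0\<^sub>v n) x = O.Wt x" if x: "x \<in> cube n" for x
  proof -
    have xc: "x \<in> carrier_vec n" using x by (simp add: cube_def)
    have "x \<bullet> (J *\<^sub>v x) = (\<Sum>i<n. \<Sum>j<n. (W $$ (i, j) + lam * (v $ i * v $ j)) * x $ i * x $ j)"
      using W(1) v(1) unfolding quadratic_form_eq_bil[OF J(1) xc] bil_def
      by (intro sum.cong refl) (simp add: J_def outer_square_def)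
    also have "\<dots> = bil n Wf (($) x) (($) x) + lam * (O.M x)\<^sup>2"
      by (simp add: bil_def Wf_def lin_def vf_def power2_eq_square sum_product
          distrib_left distrib_right sum.distrib sum_distrib_left mult_ac)
    finally show ?thesis using xc by (simp add: ising_weight_def O.Wt_def distrib_left)
  qed
  have pmf_p: "pmf p x = O.Wt x / (\<Sum>y\<in>cube n. O.Wt y)" if "x \<in> cube n" for x
    using that unfolding p_def J_def[symmetric] pmf_ising J(2) by (simp add: weight)
  interpret H: glauber_heat n O.Wt p x\<^sub>0
    by unfold_locales (use n O.Wt_pos pmf_p x0 in auto)
  \<comment> \<open>The regularization adds one percent of stationary mass: the total becomes
    \<open>101/100\<close>, and the magnetization changes by at most
    \<open>sqrt n / 100\<close>.\<close>
  define \<theta> :: real where "\<theta> = 1 / 100"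
  have \<theta>: "0 < \<theta>" by (simp add: \<theta>_def)
  define D where "D = (\<lambda>t. dirichlet n O.Wt (H.\<phi> \<theta> t))"
  have f: "f t = (\<Sum>y\<in>cube n. H.u t y * \<bar>O.M y\<bar>)" for t
    unfolding f_def heat_expectation_def H.u_def p_def[symmetric] by (intro sum.cong refl) (simp add: M)
  have contD: "continuous_on UNIV D" unfolding D_def by (rule H.cont_dirichlet)
  have D0: "0 \<le> D t" for t
    unfolding D_def using O.Wt_pos by (intro dirichlet_nonneg) (auto intro: less_imp_le)
  define B where "B = {t \<in> {0..T}. \<beta> < D t}"
  have B: "measure lborel B \<le> integral {0..T} D / \<beta>" "B \<in> sets borel"
    unfolding B_def by (rule measure_superlevel_le[OF contD D0 \<beta>])+
  have Kf: "K \<le> f t" if t: "t \<in> {0..T} - B" for t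
  proof (rule low)
    have t0: "0 \<le> t" and Dt: "D t \<le> \<beta>" using t by (auto simp: B_def)
    define a where "a = lam * sqrt n / 4"
    have a: "0 < a" using lam0 n by (simp add: a_def)
    \<comment> \<open>Makes the loss \<open>a * \<tau>\<close> exactly one percent of the mass; the
      price is the factor \<open>100 * a\<^sup>2 * n\<close> on \<open>\<eta>\<close>.\<close>
    define \<tau> where "\<tau> = 1 / (100 * a)"
    have phi_sq: "(H.\<phi> \<theta> t x)\<^sup>2 = H.G \<theta> t x" if "x \<in> cube n" for x
      using H.G_pos[OF \<theta> t0 that] by (simp add: H.\<phi>_def)
    have mass: "(\<Sum>x\<in>cube n. O.Wt x * (H.\<phi> \<theta> t x)\<^sup>2) = 101/100"
    proof -
      have "(\<Sum>x\<in>cube n. O.Wt x * (H.\<phi> \<theta> t x)\<^sup>2) = (\<Sum>x\<in>cube n. O.Wt x * H.G \<theta> t x)"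
        by (intro sum.cong refl) (simp add: phi_sq)
      then show ?thesis unfolding H.sum_pi_G by (simp add: \<theta>_def)
    qed
    define \<eta> where "\<eta> = 2 / \<kappa> * D t"
    have \<eta>: "0 \<le> \<eta>" "\<eta> \<le> 2 / \<kappa> * \<beta>" using D0[of t] Dt \<kappa> by (auto simp: \<eta>_def intro!: divide_right_mono)
    have ext: "(\<Sum>x\<in>cube n. O.Wt x * (H.\<phi> \<theta> t x)\<^sup>2 * \<bar>O.M x\<bar>) \<le> f t + sqrt n / 100"
    proof -
      have "(\<Sum>x\<in>cube n. O.Wt x * (H.\<phi> \<theta> t x)\<^sup>2 * \<bar>O.M x\<bar>)
          = (\<Sum>x\<in>cube n. H.u t x * \<bar>O.M x\<bar> + \<theta> / H.Z * (O.Wt x * \<bar>O.M x\<bar>))"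
      proof (rule sum.cong[OF refl])
        fix x assume "x \<in> cube n"
        then show "O.Wt x * (H.\<phi> \<theta> t x)\<^sup>2 * \<bar>O.M x\<bar> = H.u t x * \<bar>O.M x\<bar> + \<theta> / H.Z * (O.Wt x * \<bar>O.M x\<bar>)"
          using O.Wt_pos[of x] by (simp add: phi_sq H.G_def field_simps)
      qed
      also have "\<dots> \<le> (\<Sum>x\<in>cube n. H.u t x * \<bar>O.M x\<bar> + \<theta> / H.Z * (O.Wt x * sqrt n))"
        using O.Wt_pos H.Z_pos \<theta> by (intro sum_mono add_left_mono mult_left_mono O.abs_M_le) (auto intro: less_imp_le)
      also have "\<dots> = f t + \<theta> / H.Z * (H.Z * sqrt n)"
        by (simp only: f sum.distrib sum_distrib_left[symmetric] sum_distrib_right[symmetric] H.Z_def)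
      finally show ?thesis using H.Z_pos by (simp add: \<theta>_def)
    qed
    have "a / 2 * (101/100 - \<eta> - a * (\<tau> * (101/100) + n * \<eta> / \<tau>)) \<le> lam * (f t + sqrt n / 100) + sqrt lam * (101/100)"
    proof -
      have "2 / (1 - (1 - \<kappa>)) * dirichlet n O.Wt (H.\<phi> \<theta> t) = \<eta>" by (simp add: \<eta>_def D_def)
      moreover have "0 < \<tau>" using a by (simp add: \<tau>_def)
      ultimately have "a / 2 * (101/100 - \<eta> - a * (\<tau> * (101/100) + n * \<eta> / \<tau>))
          \<le> lam * (\<Sum>x\<in>cube n. O.Wt x * (H.\<phi> \<theta> t x)\<^sup>2 * \<bar>O.M x\<bar>) + sqrt lam * (101/100)"
        using O.magnetization_lower_bound[of \<tau> "H.\<phi> \<theta> t"] unfolding mass a_def[symmetric] by (simp only:)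
      also have "\<dots> \<le> lam * (f t + sqrt n / 100) + sqrt lam * (101/100)"
        using ext lam0 by (intro add_right_mono mult_left_mono) auto
      finally show ?thesis .
    qed
    moreover have "a / 2 * (101/100 - \<eta> - a * (\<tau> * (101/100) + n * \<eta> / \<tau>))
        = a / 2 * (99/100 * (101/100) - \<eta> * (1 + 100 * a\<^sup>2 * n))"
      using a by (simp add: \<tau>_def power2_eq_square field_simps)
    moreover have "a / 2 * (99/100 * (101/100) - 2 / \<kappa> * \<beta> * (1 + 100 * a\<^sup>2 * n))
        \<le> a / 2 * (99/100 * (101/100) - \<eta> * (1 + 100 * a\<^sup>2 * n))"
      using a \<eta> by (intro mult_left_mono diff_mono mult_right_mono) auto
    ultimately have "a / 2 * (99/100 * (101/100) - 2 / \<kappa> * \<beta> * (1 + 100 * a\<^sup>2 * n))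
        \<le> lam * (f t + sqrt n / 100) + sqrt lam * (101/100)" by linarith
    moreover have "a / 2 = lam * sqrt n / 8" by (simp add: a_def)
    ultimately show "lam * sqrt n / 8 * (99/100 * (101/100) - 2 / \<kappa> * \<beta> * (1 + 100 * (lam * sqrt n / 4)\<^sup>2 * n))
        \<le> lam * (f t + sqrt n / 100) + sqrt lam * (101/100)"
      unfolding a_def[symmetric] by (simp only:)
  qed
  have "continuous_on UNIV f" unfolding f by (intro continuous_intros H.cont_u)
  then have "f \<in> borel_measurable borel" by (rule borel_measurable_continuous_onI)
  then have X: "{t \<in> space borel. K \<le> f t} \<in> sets borel" by measurable
  have "1 - measure lborel B / T \<le> measure (uniform_measure lborel {0..T}) {t. K \<le> f t}"
  proof (rule uniform_measure_ge[OF T _ B(2)])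
    show "{t. K \<le> f t} \<in> sets borel" using X by simp
    show "B \<subseteq> {0..T}" by (auto simp: B_def)
    show "{0..T} - B \<subseteq> {t. K \<le> f t}" using Kf by blast
  qed
  moreover have "measure lborel B / T \<le> (3 + lam) * (real n)\<^sup>2 / (\<beta> * T)"
  proof -
    \<comment> \<open>The starting weight is at least \<open>1\<close> and the total weight at most
      \<open>exp (n * (2 + lam))\<close>, so the initial entropy is linear in \<open>n\<close>
      uniformly over \<open>x\<^sub>0\<close>.\<close>
    have "integral {0..T} D \<le> n / 2 * ((1 + \<theta>) * (ln (1 + \<theta>) + ln (H.Z / O.Wt x\<^sub>0)))"
      unfolding D_def using H.dirichlet_integral_le[OF \<theta>] T by simp
    also have "\<dots> \<le> n / 2 * (2 * (n + n * (2 + lam)))"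
    proof (intro mult_left_mono mult_mono add_mono)
      show "ln (1 + \<theta>) \<le> n" using ln_add_one_self_le_self[of \<theta>] n by (simp add: \<theta>_def)
      have W1: "1 \<le> O.Wt x\<^sub>0" using O.W lam0 by (simp add: O.Wt_def psd_def)
      have "O.Wt x \<le> exp (n * (1 + lam))" if "x \<in> cube n" for x
      proof -
        have "bil n Wf (($) x) (($) x) \<le> n" using O.W1[of "($) x"] that by (simp add: cube_sq)
        moreover have "lam / 2 * (O.M x)\<^sup>2 \<le> lam / 2 * n" using O.M_sq_le[OF that] lam0 by (intro mult_left_mono) auto
        ultimately have "1/2 * bil n Wf (($) x) (($) x) + lam / 2 * (O.M x)\<^sup>2 \<le> 1/2 * n + lam / 2 * n" by linarith
        also have "\<dots> \<le> n * (1 + lam)" using lam0 by (simp add: field_simps)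
        finally show ?thesis by (simp add: O.Wt_def)
      qed
      then have "H.Z \<le> (\<Sum>x\<in>cube n. exp (n * (1 + lam)))" unfolding H.Z_def by (rule sum_mono)
      also have "\<dots> = card (cube n) * exp (n * (1 + lam))" by simp
      also have "\<dots> \<le> 2 ^ n * exp (n * (1 + lam))"
        using of_nat_mono[OF card_cube_le[of n], where 'a = real] by (intro mult_right_mono) auto
      also have "\<dots> \<le> exp n * exp (n * (1 + lam))"
        using power_mono[of 2 "exp (1::real)" n] exp_ge_add_one_self[of "1::real"]
        by (intro mult_right_mono) (auto simp: exp_of_nat_mult[symmetric])
      finally have "H.Z \<le> exp (n * (2 + lam))" by (simp add: exp_add[symmetric] algebra_simps)
      moreover have "H.Z / O.Wt x\<^sub>0 \<le> H.Z / 1" using W1 H.Z_pos by (intro divide_left_mono) auto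
      ultimately have "H.Z / O.Wt x\<^sub>0 \<le> exp (n * (2 + lam))" by simp
      then have "ln (H.Z / O.Wt x\<^sub>0) \<le> ln (exp (n * (2 + lam)))"
        using H.Z_pos O.Wt_pos[of x\<^sub>0] by (subst ln_le_cancel_iff) auto
      then show "ln (H.Z / O.Wt x\<^sub>0) \<le> n * (2 + lam)" by simp
      have "1 \<le> H.Z / O.Wt x\<^sub>0" using H.pi_le_Z[OF x0] O.Wt_pos[of x\<^sub>0] by (simp add: le_divide_eq)
      then show "0 \<le> ln (1 + \<theta>) + ln (H.Z / O.Wt x\<^sub>0)" using \<theta> by simp
    qed (auto simp: \<theta>_def)
    also have "\<dots> = (3 + lam) * (real n)\<^sup>2" by (simp add: power2_eq_square algebra_simps)
    finally have "integral {0..T} D / \<beta> / T \<le> (3 + lam) * (real n)\<^sup>2 / \<beta> / T"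
      using \<beta> T by (intro divide_right_mono) auto
    then show ?thesis using divide_right_mono[OF B(1), of T] T by simp
  qed
  ultimately show ?thesis by simp
qed

theorem theorem1p7:
  fixes \<kappa> :: real
  assumes "0 < \<kappa>" and "\<kappa> < 1/2"
  shows "\<exists>lam>0. \<forall>T :: nat \<Rightarrow> real. (\<forall>n. 0 < T n) \<and> T \<in> soft_Theta (\<lambda>n. real n ^ 5) \<longrightarrow>
    (\<exists>\<epsilon> \<delta> :: nat \<Rightarrow> real. \<epsilon> \<in> o(\<lambda>_. 1) \<and> \<delta> \<in> o(\<lambda>_. 1) \<and>
      (\<forall>n\<ge>1. \<forall>W :: real mat. \<forall>v x\<^sub>0 :: real Matrix.vec.
        W \<in> carrier_mat n n \<and> W\<^sup>T = W \<and>
        \<kappa> \<cdot>\<^sub>m 1\<^sub>m n \<preceq>\<^sub>L W \<and> W \<preceq>\<^sub>L (1 - \<kappa>) \<cdot>\<^sub>m 1\<^sub>m n \<and>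
        v \<in> carrier_vec n \<and> (\<forall>i<n. v $ i \<in> {1 / sqrt (real n), - (1 / sqrt (real n))}) \<and>
        x\<^sub>0 \<in> cube n \<longrightarrow>
        \<P>(t in uniform_measure lborel {0..T n}.
            heat_expectation (cube n) (glauber (ising0 (W + lam \<cdot>\<^sub>m outer_square v))) t x\<^sub>0
              (\<lambda>x. \<bar>x \<bullet> v\<bar>)
            \<ge> (\<kappa> * exp (- (1 / \<kappa>)) - \<epsilon> n) * sqrt (real n))
        \<ge> 1 - \<delta> n))"
proof -
  define lam :: real where "lam = 6 * exp 20"
  have lam: "0 < lam" "6 * exp 20 \<le> lam" by (simp_all add: lam_def)
  \<comment> \<open>The tent error needs \<open>\<beta> n * n\<^sup>2\<close> to vanish, and the
    measure of bad times needs \<open>n\<^sup>2 / (\<beta> n * T n)\<close> to vanish. For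
    \<open>T\<close> of order \<open>n ^ 5\<close> up to logarithms the exponent may lie strictly
    between \<open>- 3\<close> and \<open>- 2\<close>.\<close>
  define \<beta> where "\<beta> = (\<lambda>n::nat. real n powr (- 5 / 2))"
  define g where "g = (\<lambda>n::nat. 1 / 8 * (2 / \<kappa> * \<beta> n * (1 + 100 * (lam * sqrt n / 4)\<^sup>2 * n)) + 101/100 / (sqrt lam * sqrt n))"
  have "(\<lambda>n::nat. g n) \<longlonglongrightarrow> 0"
    unfolding g_def \<beta>_def using assms(1) lam(1) by real_asymp
  then have "\<forall>\<^sub>F n in sequentially. g n < 1 / 100" by (rule order_tendstoD) simp
  then obtain N where N: "\<And>n. N \<le> n \<Longrightarrow> g n < 1 / 100"
    by (auto simp: eventually_sequentially)
  have const: "\<kappa> * exp (- (1 / \<kappa>)) \<le> 1 / 10"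
  proof -
    have "exp (- (1 / \<kappa>)) \<le> exp (- 2)" using assms by (simp add: field_simps)
    also have "\<dots> \<le> 1 / 5"
      using exp_lower_Taylor_quadratic[of "2::real"] by (simp add: exp_minus field_simps)
    finally have "\<kappa> * exp (- (1 / \<kappa>)) \<le> 1 / 2 * (1 / 5)" using assms by (intro mult_mono) auto
    then show ?thesis by simp
  qed
  have main: "\<kappa> * exp (- (1 / \<kappa>)) * sqrt n \<le> E"
    if n: "1 \<le> n" "N \<le> n"
      and E: "lam * sqrt n / 8 * (99/100 * (101/100) - 2 / \<kappa> * \<beta> n * (1 + 100 * (lam * sqrt n / 4)\<^sup>2 * n))
        \<le> lam * (E + sqrt n / 100) + sqrt lam * (101/100)" for n :: nat and E
  proof -
    have sn: "0 < sqrt n" and sl: "0 < sqrt lam" using n lam by auto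
    define h where "h = 2 / \<kappa> * \<beta> n * (1 + 100 * (lam * sqrt n / 4)\<^sup>2 * n)"
    have "sqrt lam * (101/100) = lam * (101/100 / sqrt lam)" using sl by (simp add: field_simps)
    then have "lam * (E + sqrt n / 100 + 101/100 / sqrt lam) = lam * (E + sqrt n / 100) + sqrt lam * (101/100)"
      by (simp only: distrib_left)
    moreover have "lam * (sqrt n / 8 * (99/100 * (101/100) - h)) = lam * sqrt n / 8 * (99/100 * (101/100) - h)"
      by simp
    ultimately have "lam * (sqrt n / 8 * (99/100 * (101/100) - h)) \<le> lam * (E + sqrt n / 100 + 101/100 / sqrt lam)"
      using E unfolding h_def by (simp only:)
    then have "sqrt n / 8 * (99/100 * (101/100) - h) \<le> E + sqrt n / 100 + 101/100 / sqrt lam"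
      using lam by simp
    moreover have "101/100 / sqrt lam = sqrt n * (101/100 / (sqrt lam * sqrt n))" using sn by simp
    moreover have "g n = 1 / 8 * h + 101/100 / (sqrt lam * sqrt n)" by (simp add: g_def h_def)
    ultimately have "sqrt n * (99/100 * (101/100) / 8 - 1 / 100 - g n) \<le> E"
      by (simp add: algebra_simps)
    \<comment> \<open>The mass term contributes \<open>0.9999 / 8\<close>, about
      \<open>0.125\<close>; the regularization and \<open>g n\<close> take away at most
      \<open>0.01\<close> each.\<close>
    moreover have "sqrt n * (1 / 10) \<le> sqrt n * (99/100 * (101/100) / 8 - 1 / 100 - g n)"
      using N[OF n(2)] sn by (intro mult_left_mono) auto
    moreover have "\<kappa> * exp (- (1 / \<kappa>)) * sqrt n \<le> 1 / 10 * sqrt n" using const sn by (intro mult_right_mono) auto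
    ultimately show ?thesis by (simp add: mult.commute)
  qed
  show ?thesis
  proof (intro exI[of _ lam] conjI lam(1) allI impI)
    fix T :: "nat \<Rightarrow> real"
    assume T: "(\<forall>n. 0 < T n) \<and> T \<in> soft_Theta (\<lambda>n. real n ^ 5)"
    then obtain k :: nat where k: "T \<in> \<Omega>(\<lambda>n. real n ^ 5 / ln (real n) ^ k)"
      by (auto simp: soft_Theta_def)
    \<comment> \<open>For \<open>n < N\<close> the value \<open>1\<close> makes the claim trivial,
      since probabilities are nonnegative.\<close>
    define \<delta> where "\<delta> = (\<lambda>n. if n < N then 1 else (3 + lam) * (real n)\<^sup>2 / (\<beta> n * T n))"
    have "\<delta> \<in> o(\<lambda>_. 1)"
    proof -
      have "(\<lambda>n. real n ^ 5 / ln (real n) ^ k) \<in> O(T)"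
        using k by (simp add: bigomega_iff_bigo)
      then have "(\<lambda>n. inverse (T n)) \<in> O(\<lambda>n. inverse (real n ^ 5 / ln (real n) ^ k))"
      proof (rule landau_o.big.inverse[rotated 2])
        show "\<forall>\<^sub>F n in sequentially. real n ^ 5 / ln (real n) ^ k \<noteq> 0"
          using eventually_gt_at_top[of 1] by eventually_elim simp
        show "\<forall>\<^sub>F n in sequentially. T n \<noteq> 0"
          using T by (intro always_eventually allI) (simp add: less_imp_neq[symmetric])
      qed
      then have "(\<lambda>n. (3 + lam) * (real n)\<^sup>2 / \<beta> n * inverse (T n))
          \<in> O(\<lambda>n. (3 + lam) * (real n)\<^sup>2 / \<beta> n * inverse (real n ^ 5 / ln (real n) ^ k))"
        by (rule landau_o.big.mult[OF landau_o.big_refl])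
      moreover have "(\<lambda>n. (3 + lam) * (real n)\<^sup>2 / \<beta> n * inverse (real n ^ 5 / ln (real n) ^ k)) \<in> o(\<lambda>_. 1)"
        unfolding \<beta>_def using lam(1) by real_asymp
      ultimately have "(\<lambda>n. (3 + lam) * (real n)\<^sup>2 / \<beta> n * inverse (T n)) \<in> o(\<lambda>_. 1)"
        by (rule landau_o.big_small_trans)
      moreover have "\<forall>\<^sub>F n in sequentially. (3 + lam) * (real n)\<^sup>2 / \<beta> n * inverse (T n) = \<delta> n"
        using eventually_ge_at_top[of N] by eventually_elim (simp add: \<delta>_def divide_inverse)
      ultimately show ?thesis by (simp only: landau_o.small.in_cong)
    qed
    moreover have "1 - \<delta> n \<le> \<P>(t in uniform_measure lborel {0..T n}.
        (\<kappa> * exp (- (1 / \<kappa>)) - 0) * sqrt (real n) \<le>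
          heat_expectation (cube n) (glauber (ising0 (W + lam \<cdot>\<^sub>m outer_square v))) t x\<^sub>0 (\<lambda>x. \<bar>x \<bullet> v\<bar>))"
      if "1 \<le> n" and "W \<in> carrier_mat n n \<and> W\<^sup>T = W \<and>
        \<kappa> \<cdot>\<^sub>m 1\<^sub>m n \<preceq>\<^sub>L W \<and> W \<preceq>\<^sub>L (1 - \<kappa>) \<cdot>\<^sub>m 1\<^sub>m n \<and>
        v \<in> carrier_vec n \<and> (\<forall>i<n. v $ i \<in> {1 / sqrt (real n), - (1 / sqrt (real n))}) \<and>
        x\<^sub>0 \<in> cube n" for n W v x\<^sub>0
    proof (cases "n < N")
      case True
      then show ?thesis by (simp add: \<delta>_def)
    next
      case False
      have "1 - (3 + lam) * (real n)\<^sup>2 / (\<beta> n * T n) \<le> \<P>(t in uniform_measure lborel {0..T n}.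
        \<kappa> * exp (- (1 / \<kappa>)) * sqrt (real n) \<le>
          heat_expectation (cube n) (glauber (ising0 (W + lam \<cdot>\<^sub>m outer_square v))) t x\<^sub>0 (\<lambda>x. \<bar>x \<bullet> v\<bar>))"
      proof (rule heat_magnetization_prob[OF assms \<open>1 \<le> n\<close> _ _ lam(2)])
        show "0 < T n" using T by blast
        show "0 < \<beta> n" using that(1) by (simp add: \<beta>_def)
        show "\<kappa> * exp (- (1 / \<kappa>)) * sqrt (real n) \<le> E"
          if "lam * sqrt n / 8 * (99/100 * (101/100) - 2 / \<kappa> * \<beta> n * (1 + 100 * (lam * sqrt n / 4)\<^sup>2 * n))
            \<le> lam * (E + sqrt n / 100) + sqrt lam * (101/100)" for E
          using False by (intro main[OF \<open>1 \<le> n\<close> _ that]) simp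
      qed (use that in blast)+
      then show ?thesis using False by (simp add: \<delta>_def)
    qed
    ultimately show "\<exists>\<epsilon> \<delta> :: nat \<Rightarrow> real. \<epsilon> \<in> o(\<lambda>_. 1) \<and> \<delta> \<in> o(\<lambda>_. 1) \<and>
      (\<forall>n\<ge>1. \<forall>W :: real mat. \<forall>v x\<^sub>0 :: real Matrix.vec.
        W \<in> carrier_mat n n \<and> W\<^sup>T = W \<and>
        \<kappa> \<cdot>\<^sub>m 1\<^sub>m n \<preceq>\<^sub>L W \<and> W \<preceq>\<^sub>L (1 - \<kappa>) \<cdot>\<^sub>m 1\<^sub>m n \<and>
        v \<in> carrier_vec n \<and> (\<forall>i<n. v $ i \<in> {1 / sqrt (real n), - (1 / sqrt (real n))}) \<and>
        x\<^sub>0 \<in> cube n \<longrightarrow>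
        \<P>(t in uniform_measure lborel {0..T n}.
            heat_expectation (cube n) (glauber (ising0 (W + lam \<cdot>\<^sub>m outer_square v))) t x\<^sub>0
              (\<lambda>x. \<bar>x \<bullet> v\<bar>)
            \<ge> (\<kappa> * exp (- (1 / \<kappa>)) - \<epsilon> n) * sqrt (real n))
        \<ge> 1 - \<delta> n)"
      \<comment> \<open>The witness for \<open>\<epsilon>\<close> is zero: the constant obtained
        exceeds the required one with room for all error terms.\<close>
      by (intro exI[of _ "\<lambda>_. 0"] exI[of _ \<delta>] conjI allI impI) simp_all
  qed
qed

end
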